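(* Let $k$ be an algebraically closed field of characteristic $0$, let $X$ be a normal projective variety over $k$ and $K$ its fraction field. The residue map defines an isomorphism of groups $$\operatorname{Res}:\mathrm I^{et}(K)\to\operatorname{Cl}^t_{\mathbb Q}(X),\qquad[\gamma]\mapsto[\operatorname{Res}(\gamma)],$$ whose inverse is given by $\operatorname{Res}^{-1}:[D]\mapsto[\tfrac1r\operatorname{dlog}\phi]$, where $rD\sim(\phi)$ for some $r\in\mathbb Q^*$ and $\phi\in K$.
   Context: $\mathcal D_K$ is the ring of $k$-linear differential operators of $K$. A closed $1$-form $\gamma\in\Omega^{cl}_{K/k}$ defines the rank one module $M_\gamma=K\mu$, $\partial\mu=\gamma(\partial)\mu$, and $M_\gamma\cong M_{\gamma'}$ iff $\gamma-\gamma'\in\operatorname{dlog}K^*$. $M_\gamma$ is étale trivial if $L\otimes_KM_\gamma\cong L$ as $\mathcal D_L$-module for some finite field extension $L/K$; equivalently $l\gamma\in\operatorname{dlog}K^*$ for some integer $l\geq1$. $\mathrm I^{et}(K)$ is the group (under tensor product) of isomorphism classes of étale trivial $\mathcal D_K$-modules of rank $1$, identified with a subgroup of $\Omega_K^{cl}/\operatorname{dlog}K^*$. $\operatorname{Res}(\gamma)=\sum_{\operatorname{ht}(x)=1}\operatorname{res}_x(\gamma)\,x$, where $\operatorname{res}_x(\gamma)\in k$ is the residue of the closed form $\gamma$ along the prime divisor with generic point $x$ (characterized for the forms at hand by additivity and $\operatorname{res}_x(c\operatorname{dlog}\phi)=c\,\nu_x(\phi)$, $c\in k$, with $\nu_x$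 the valuation at $x$). $\operatorname{Cl}_{\mathbb Q}(X)$ is the group of Weil divisors with rational coefficients modulo linear equivalence, i.e. modulo the principal divisors $(\phi)$, $\phi\in K^*$; $\operatorname{Cl}^t_{\mathbb Q}(X)$ is its torsion subgroup. *)

theory Defs
  imports
    "HOL-Algebra.Algebra"
    "HOL-Algebra.Algebraic_Closure_Type"
    "HOL-Library.Poly_Mapping"
begin

section \<open>Projective varieties\<close>

text \<open>
  A projective variety over \<open>'k\<close> is \<open>X = Proj ('k[x\<^sub>i : i \<in> 'i] / I)\<close> for a relevant homogeneous
  prime ideal \<open>I\<close>; the finite type \<open>'i\<close> indexes the homogeneous coordinates of the ambient
  projective space.  A polynomial is a finitely supported map from exponent vectors to
  coefficients, with the convolution product.
\<close>

type_synonym ('i, 'k) mpoly = "('i \<Rightarrow>\<^sub>0 nat) \<Rightarrow>\<^sub>0 'k"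

abbreviation poly_ring_of :: "('i, 'k::comm_ring_1) mpoly ring" where
  "poly_ring_of \<equiv> ring_of_type_algebra"

definition homogeneous :: "nat \<Rightarrow> ('i::finite, 'k::zero) mpoly \<Rightarrow> bool" where
  "homogeneous d F \<longleftrightarrow> (\<forall>m \<in> Poly_Mapping.keys F. (\<Sum>i\<in>UNIV. Poly_Mapping.lookup m i) = d)"

definition homogeneous_ideal :: "('i::finite, 'k::comm_ring_1) mpoly set \<Rightarrow> bool" where
  "homogeneous_ideal P \<longleftrightarrow>
     ideal P poly_ring_of \<and> P = genideal poly_ring_of {F \<in> P. \<exists>d. homogeneous d F}"

definition relevant :: "('i, 'k::comm_ring_1) mpoly set \<Rightarrow> bool" where
  "relevant P \<longleftrightarrow> (\<exists>i. Poly_Mapping.single (Poly_Mapping.single i 1) 1 \<notin> P)"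

definition projective_variety :: "('i::finite, 'k::comm_ring_1) mpoly set \<Rightarrow> bool" where
  "projective_variety I \<longleftrightarrow> primeideal I poly_ring_of \<and> homogeneous_ideal I \<and> relevant I"

text \<open>Scheme-theoretic points; the generic point is \<open>I\<close> itself.\<close>

definition points :: "('i::finite, 'k::comm_ring_1) mpoly set \<Rightarrow> ('i, 'k) mpoly set set" where
  "points I = {P. primeideal P poly_ring_of \<and> homogeneous_ideal P \<and> relevant P \<and> I \<subseteq> P}"

text \<open>
  The generic points of prime divisors.  Generizations of \<open>P\<close> are the points contained in \<open>P\<close>,
  so height one means that the generic point is the only proper one.
\<close>

definition height_one :: "('i::finite, 'k::comm_ring_1) mpoly set \<Rightarrow> ('i, 'k) mpoly set set" where
  "height_one I = {P \<in> points I. P \<noteq> I \<and> (\<forall>Q \<in> points I. Q \<subseteq> P \<longrightarrow> Q = I \<or> Q = P)}"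

definition eval_at :: "('k \<Rightarrow> 'K) \<Rightarrow> ('i \<Rightarrow> 'K) \<Rightarrow> ('i::finite, 'k::zero) mpoly \<Rightarrow> 'K::comm_ring_1" where
  "eval_at \<iota> \<xi> F = (\<Sum>m \<in> Poly_Mapping.keys F.
      \<iota> (Poly_Mapping.lookup F m) * (\<Prod>i\<in>UNIV. \<xi> i ^ Poly_Mapping.lookup m i))"

text \<open>
  \<open>'K\<close>, with structure map \<open>\<iota>\<close>, is the function field of \<open>X\<close>: the field of fractions \<open>F/G\<close> of
  homogeneous elements of equal degree in the homogeneous coordinate ring.  The identification is
  given by the homogeneous coordinates \<open>\<xi>\<close> of the generic point, i.e. \<open>F/G\<close> corresponds to
  \<open>F(\<xi>)/G(\<xi>)\<close>; one can take \<open>\<xi> i = x\<^sub>i/x\<^sub>j\<close> for any \<open>j\<close> with \<open>x\<^sub>j \<notin> I\<close>.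
\<close>

definition function_field ::
  "('i::finite, 'k::field) mpoly set \<Rightarrow> ('k \<Rightarrow> 'K::field) \<Rightarrow> ('i \<Rightarrow> 'K) \<Rightarrow> bool" where
  "function_field I \<iota> \<xi> \<longleftrightarrow>
     \<iota> \<in> ring_hom ring_of_type_algebra ring_of_type_algebra \<and>
     (\<forall>d F. homogeneous d F \<longrightarrow> (F \<in> I \<longleftrightarrow> eval_at \<iota> \<xi> F = 0)) \<and>
     (\<forall>z. \<exists>d F G. homogeneous d F \<and> homogeneous d G \<and> G \<notin> I \<and> z = eval_at \<iota> \<xi> F / eval_at \<iota> \<xi> G)"

definition local_ring ::
  "('k \<Rightarrow> 'K) \<Rightarrow> ('i \<Rightarrow> 'K) \<Rightarrow> ('i::finite, 'k::field) mpoly set \<Rightarrow> 'K::field set" where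
  "local_ring \<iota> \<xi> P = {eval_at \<iota> \<xi> F / eval_at \<iota> \<xi> G | d F G.
     homogeneous d F \<and> homogeneous d G \<and> G \<notin> P}"

definition integrally_closed :: "'K::field set \<Rightarrow> bool" where
  "integrally_closed R \<longleftrightarrow>
     (\<forall>z. (\<exists>p. Polynomial.lead_coeff p = 1 \<and> (\<forall>n. Polynomial.coeff p n \<in> R) \<and> Polynomial.poly p z = 0)
        \<longrightarrow> z \<in> R)"

definition normal_variety ::
  "('i::finite, 'k::field) mpoly set \<Rightarrow> ('k \<Rightarrow> 'K::field) \<Rightarrow> ('i \<Rightarrow> 'K) \<Rightarrow> bool" where
  "normal_variety I \<iota> \<xi> \<longleftrightarrow> (\<forall>P \<in> points I. integrally_closed (local_ring \<iota> \<xi> P))"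


section \<open>Weil divisors with rational coefficients\<close>

definition units_in :: "'K::field set \<Rightarrow> 'K set" where
  "units_in R = {u \<in> R. u \<noteq> 0 \<and> inverse u \<in> R}"

definition uniformizer :: "'K::field set \<Rightarrow> 'K \<Rightarrow> bool" where
  "uniformizer R t \<longleftrightarrow> t \<in> R \<and> t \<noteq> 0 \<and> R - units_in R = {t * r | r. r \<in> R}"

definition valuation :: "'K::field set \<Rightarrow> 'K \<Rightarrow> int" where
  "valuation R \<phi> = (THE n. \<exists>t u. uniformizer R t \<and> u \<in> units_in R \<and> \<phi> = u * t powi n)"

text \<open>
  Divisors are functions into \<open>'k\<close>, which is where residues live; rational coefficients are
  coefficients in the prime field \<open>\<rat> \<subseteq> 'k\<close>.
\<close>

definition Div_Q :: "('i::finite, 'k::field_char_0) mpoly set \<Rightarrow> (('i, 'k) mpoly set \<Rightarrow> 'k) monoid" where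
  "Div_Q I = \<lparr>carrier = {D. (\<forall>x. D x \<in> \<rat>) \<and> (\<forall>x. x \<notin> height_one I \<longrightarrow> D x = 0) \<and> finite {x. D x \<noteq> 0}},
     monoid.mult = (\<lambda>D E x. D x + E x), one = (\<lambda>x. 0)\<rparr>"

definition div_of ::
  "('i::finite, 'k::field_char_0) mpoly set \<Rightarrow> ('k \<Rightarrow> 'K::field) \<Rightarrow> ('i \<Rightarrow> 'K) \<Rightarrow> 'K
    \<Rightarrow> (('i, 'k) mpoly set \<Rightarrow> 'k)" where
  "div_of I \<iota> \<xi> \<phi> = (\<lambda>x. if x \<in> height_one I then of_int (valuation (local_ring \<iota> \<xi> x) \<phi>) else 0)"

definition principal_divisors ::
  "('i::finite, 'k::field_char_0) mpoly set \<Rightarrow> ('k \<Rightarrow> 'K::field) \<Rightarrow> ('i \<Rightarrow> 'K)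
    \<Rightarrow> (('i, 'k) mpoly set \<Rightarrow> 'k) set" where
  "principal_divisors I \<iota> \<xi> = {div_of I \<iota> \<xi> \<phi> | \<phi>. \<phi> \<noteq> 0}"

definition Cl_Q ::
  "('i::finite, 'k::field_char_0) mpoly set \<Rightarrow> ('k \<Rightarrow> 'K::field) \<Rightarrow> ('i \<Rightarrow> 'K)
    \<Rightarrow> (('i, 'k) mpoly set \<Rightarrow> 'k) set monoid" where
  "Cl_Q I \<iota> \<xi> = Div_Q I Mod principal_divisors I \<iota> \<xi>"

definition divisor_class ::
  "('i::finite, 'k::field_char_0) mpoly set \<Rightarrow> ('k \<Rightarrow> 'K::field) \<Rightarrow> ('i \<Rightarrow> 'K)
    \<Rightarrow> (('i, 'k) mpoly set \<Rightarrow> 'k) \<Rightarrow> (('i, 'k) mpoly set \<Rightarrow> 'k) set" where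
  "divisor_class I \<iota> \<xi> D = principal_divisors I \<iota> \<xi> #>\<^bsub>Div_Q I\<^esub> D"

definition torsion_subgroup :: "'a monoid \<Rightarrow> 'a monoid" where
  "torsion_subgroup G = G\<lparr>carrier := {x \<in> carrier G. \<exists>n::nat. n > 0 \<and> x [^]\<^bsub>G\<^esub> n = \<one>\<^bsub>G\<^esub>}\<rparr>"

definition Cl_Q_tors ::
  "('i::finite, 'k::field_char_0) mpoly set \<Rightarrow> ('k \<Rightarrow> 'K::field) \<Rightarrow> ('i \<Rightarrow> 'K)
    \<Rightarrow> (('i, 'k) mpoly set \<Rightarrow> 'k) set monoid" where
  "Cl_Q_tors I \<iota> \<xi> = torsion_subgroup (Cl_Q I \<iota> \<xi>)"


section \<open>Differential forms\<close>

text \<open>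
  \<open>C \<subseteq> L\<close> are subfields of an ambient field.  The last clause makes a derivation of \<open>L\<close>
  a unique function on the ambient field.
\<close>

definition derivations :: "'f::field set \<Rightarrow> 'f set \<Rightarrow> ('f \<Rightarrow> 'f) set" where
  "derivations C L = {\<theta>. (\<forall>a\<in>L. \<theta> a \<in> L) \<and>
     (\<forall>a\<in>L. \<forall>b\<in>L. \<theta> (a + b) = \<theta> a + \<theta> b) \<and>
     (\<forall>a\<in>L. \<forall>b\<in>L. \<theta> (a * b) = \<theta> a * b + a * \<theta> b) \<and>
     (\<forall>c\<in>C. \<theta> c = 0) \<and> (\<forall>a. a \<notin> L \<longrightarrow> \<theta> a = 0)}"

text \<open>
  A form is represented by its pairing \<open>\<theta> \<mapsto> \<gamma>(\<theta>)\<close> with the \<open>C\<close>-linear derivations, set to \<open>0\<close> on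
  other arguments.  The Kaehler differentials of \<open>L/C\<close> are an \<open>L\<close>-vector space with dual
  \<open>derivations C L\<close>, so they embed into the functionals on derivations, with image the \<open>L\<close>-span
  of the exact forms \<open>db : \<theta> \<mapsto> \<theta> b\<close>.  The set \<open>A\<close> of pairs stands for the sum of all \<open>a db\<close>
  with \<open>(a, b) \<in> A\<close>.
\<close>

type_synonym 'f form = "('f \<Rightarrow> 'f) \<Rightarrow> 'f"

definition form_of :: "'f::field set \<Rightarrow> 'f set \<Rightarrow> ('f \<times> 'f) set \<Rightarrow> 'f form" where
  "form_of C L A = (\<lambda>\<theta>. if \<theta> \<in> derivations C L then \<Sum>(a, b)\<in>A. a * \<theta> b else 0)"

definition forms :: "'f::field set \<Rightarrow> 'f set \<Rightarrow> 'f form set" where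
  "forms C L = {form_of C L A | A. finite A \<and> A \<subseteq> L \<times> L}"

definition dlog :: "'f::field set \<Rightarrow> 'f set \<Rightarrow> 'f \<Rightarrow> 'f form" where
  "dlog C L \<phi> = form_of C L {(inverse \<phi>, \<phi>)}"

text \<open>The Cartan formula for the exterior derivative of a 1-form.\<close>

definition closed_form :: "'f::field set \<Rightarrow> 'f set \<Rightarrow> 'f form \<Rightarrow> bool" where
  "closed_form C L \<gamma> \<longleftrightarrow> \<gamma> \<in> forms C L \<and>
     (\<forall>\<theta> \<in> derivations C L. \<forall>\<delta> \<in> derivations C L.
        \<theta> (\<gamma> \<delta>) - \<delta> (\<gamma> \<theta>) - \<gamma> (\<lambda>a. \<theta> (\<delta> a) - \<delta> (\<theta> a)) = 0)"


section \<open>Rank one modules and etale triviality\<close>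

text \<open>
  \<open>connection \<gamma> \<theta>\<close> is the action of \<open>\<theta>\<close> on \<open>M\<^sub>\<gamma> = L\<mu>\<close>, \<open>\<theta>\<mu> = \<gamma>(\<theta>)\<mu>\<close>, in the coordinate \<open>f\<close> of \<open>f\<mu>\<close>.
  In characteristic \<open>0\<close> the ring of differential operators of \<open>L\<close> is generated by \<open>L\<close> and the
  derivations, so a morphism of modules over it is an \<open>L\<close>-linear map commuting with derivations.
\<close>

definition connection :: "'f::field form \<Rightarrow> ('f \<Rightarrow> 'f) \<Rightarrow> 'f \<Rightarrow> 'f" where
  "connection \<gamma> \<theta> f = \<theta> f + \<gamma> \<theta> * f"

definition D_module_iso :: "'f::field set \<Rightarrow> 'f set \<Rightarrow> 'f form \<Rightarrow> 'f form \<Rightarrow> bool" where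
  "D_module_iso C L \<gamma> \<gamma>' \<longleftrightarrow> (\<exists>h. bij_betw h L L \<and>
     (\<forall>f\<in>L. \<forall>g\<in>L. h (f + g) = h f + h g) \<and> (\<forall>a\<in>L. \<forall>f\<in>L. h (a * f) = a * h f) \<and>
     (\<forall>\<theta> \<in> derivations C L. \<forall>f\<in>L. h (connection \<gamma> \<theta> f) = connection \<gamma>' \<theta> (h f)))"

text \<open>
  \<open>\<iota> : 'k \<rightarrow> 'K\<close> is the structure map.  Every finite extension of \<open>'K\<close> is isomorphic to a subfield
  \<open>L\<close> of the algebraic closure.  The base change \<open>L \<otimes> M\<^sub>\<gamma>\<close> is the module of the pullback of \<open>\<gamma>\<close>
  to \<open>L\<close>, and \<open>L\<close> itself is the module of the zero form.
\<close>

definition finite_ext :: "'K::field alg_closure set \<Rightarrow> bool" where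
  "finite_ext L \<longleftrightarrow> subfield L ring_of_type_algebra \<and> range to_ac \<subseteq> L \<and>
     ring.finite_dimension ring_of_type_algebra (range to_ac) L"

definition base_change ::
  "('k \<Rightarrow> 'K::field) \<Rightarrow> 'K alg_closure set \<Rightarrow> 'K form \<Rightarrow> 'K alg_closure form \<Rightarrow> bool" where
  "base_change \<iota> L \<gamma> \<gamma>L \<longleftrightarrow> (\<exists>A. finite A \<and> \<gamma> = form_of (range \<iota>) UNIV A \<and>
     \<gamma>L = form_of (range (to_ac \<circ> \<iota>)) L (map_prod to_ac to_ac ` A))"

definition etale_trivial :: "('k \<Rightarrow> 'K::field) \<Rightarrow> 'K form \<Rightarrow> bool" where
  "etale_trivial \<iota> \<gamma> \<longleftrightarrow> (\<exists>L \<gamma>L. finite_ext L \<and> base_change \<iota> L \<gamma> \<gamma>L \<and>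
     D_module_iso (range (to_ac \<circ> \<iota>)) L \<gamma>L (\<lambda>\<theta>. 0))"

definition closed_forms :: "('k \<Rightarrow> 'K::field) \<Rightarrow> 'K form monoid" where
  "closed_forms \<iota> = \<lparr>carrier = {\<gamma>. closed_form (range \<iota>) UNIV \<gamma>},
     monoid.mult = (\<lambda>\<gamma> \<delta> \<theta>. \<gamma> \<theta> + \<delta> \<theta>), one = (\<lambda>\<theta>. 0)\<rparr>"

abbreviation dlog_K :: "('k \<Rightarrow> 'K::field) \<Rightarrow> 'K \<Rightarrow> 'K form" where
  "dlog_K \<iota> \<equiv> dlog (range \<iota>) UNIV"

definition dlog_forms :: "('k \<Rightarrow> 'K::field) \<Rightarrow> 'K form set" where
  "dlog_forms \<iota> = {dlog_K \<iota> \<phi> | \<phi>. \<phi> \<noteq> 0}"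

definition form_class :: "('k \<Rightarrow> 'K::field) \<Rightarrow> 'K form \<Rightarrow> 'K form set" where
  "form_class \<iota> \<gamma> = dlog_forms \<iota> #>\<^bsub>closed_forms \<iota>\<^esub> \<gamma>"

text \<open>
  Isomorphism classes of modules \<open>M\<^sub>\<gamma>\<close> are the classes of closed forms modulo \<open>dlog\<close>, and the
  tensor product corresponds to addition of forms.
\<close>

definition I_et :: "('k \<Rightarrow> 'K::field) \<Rightarrow> 'K form set monoid" where
  "I_et \<iota> = (closed_forms \<iota> Mod dlog_forms \<iota>)
     \<lparr>carrier := {form_class \<iota> \<gamma> | \<gamma>. \<gamma> \<in> carrier (closed_forms \<iota>) \<and> etale_trivial \<iota> \<gamma>}\<rparr>"


section \<open>Residues\<close>

text \<open>
  \<open>residue\<close> is meant for etale trivial \<open>\<gamma>\<close> only.  An integer multiple of such a form is some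
  \<open>dlog \<phi>\<close>, so the rule \<open>res (c dlog \<phi>) = c \<nu>(\<phi>)\<close> determines its residue already from rational \<open>c\<close>.
\<close>

definition residue ::
  "('k::field_char_0 \<Rightarrow> 'K::field_char_0) \<Rightarrow> ('i \<Rightarrow> 'K) \<Rightarrow> ('i::finite, 'k) mpoly set
    \<Rightarrow> 'K form \<Rightarrow> 'k" where
  "residue \<iota> \<xi> x \<gamma> = (THE r. \<exists>(c::rat) \<phi>. \<phi> \<noteq> 0 \<and> \<gamma> = (\<lambda>\<theta>. of_rat c * dlog_K \<iota> \<phi> \<theta>) \<and>
     r = of_rat c * of_int (valuation (local_ring \<iota> \<xi> x) \<phi>))"

definition Res ::
  "('i::finite, 'k::field_char_0) mpoly set \<Rightarrow> ('k \<Rightarrow> 'K::field_char_0) \<Rightarrow> ('i \<Rightarrow> 'K)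
    \<Rightarrow> 'K form \<Rightarrow> (('i, 'k) mpoly set \<Rightarrow> 'k)" where
  "Res I \<iota> \<xi> \<gamma> = (\<lambda>x. if x \<in> height_one I then residue \<iota> \<xi> x \<gamma> else 0)"

end

theory Submission
  imports Defs
begin

text \<open>
  An etale trivial form is \<open>\<gamma> = (1/n) dlog \<phi>\<close>: a horizontal section \<open>g\<close> over a finite extension has a
  minimal polynomial whose constant term \<open>a\<close> satisfies \<open>n \<gamma> = dlog a\<close>, and conversely \<open>\<phi>\<^sup>1\<^sup>/\<^sup>n\<close> trivialises
  \<open>(1/n) dlog \<phi>\<close>.  Hence \<open>Res \<gamma> = (1/n) (\<phi>)\<close> is torsion modulo principal divisors, and every torsion class
  arises like this.  Both well-definedness and injectivity come down to two facts: a function killed by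
  all derivations is constant, because a derivation of a subfield extends to the whole field; and a
  function without zeros and poles is constant, because on a normal variety it is regular on every
  affine chart by the Hartogs property, and a globally regular function acts on the
  finite-dimensional space of forms of a large degree.
\<close>

section \<open>Extension of derivations\<close>

text \<open>A form is known only through its values on derivations, so every identity between forms
  has to be tested there. Hence derivations must be moved between \<open>'K\<close> and a finite
  extension in both directions: upwards by extension, downwards by composition with
  \<open>'K\<close>-linear functionals. A function with dlog \<phi> = 0 is likewise recognised as
  constant only by producing a derivation that does not kill a non-constant one.

  \<open>residue\<close> is a definite description over all ways of writing \<gamma> as a rational
  multiple of a logarithmic form. Nothing about it, not even additivity, is available before these
  ways are compared; clearing denominators reduces the comparison to two functions with equal dlog.

  Rational coefficients make the correspondence exact before passing to classes: if n D = (\<phi>),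
  then (1/n) dlog \<phi> has residue D itself and not merely a divisor in its class.

  The geometry takes place inside the function field. Charts and local rings are subsets of
  \<open>'K\<close>, so that a localisation is a set of fractions and the Hartogs property is a
  statement about membership.\<close>

text \<open>
  A derivation \<open>D\<close> of a subring \<open>R\<close> into the field is encoded by its graph.  This is a subring of the
  dual numbers meeting the ideal \<open>{(0, b)}\<close> only in \<open>0\<close>, so that the union of a chain of derivations
  is simply the union of graphs.
\<close>

definition derivation_graph :: "('a::field \<times> 'a) set \<Rightarrow> bool" where
  "derivation_graph G \<longleftrightarrow> (1, 0) \<in> G \<and>
     (\<forall>a b c d. (a, b) \<in> G \<longrightarrow> (c, d) \<in> G \<longrightarrow> (a - c, b - d) \<in> G \<and> (a * c, a * d + b * c) \<in> G) \<and>
     (\<forall>b. (0, b) \<in> G \<longrightarrow> b = 0)"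

text \<open>The pair \<open>(p, q)\<close> stands for the polynomial p + eps q over the dual numbers
  (eps^2 = 0). Membership says that \<open>q\<close> arises from \<open>p\<close> by applying the
  derivation to every coefficient.\<close>

definition dual_polys :: "('a::field \<times> 'a) set \<Rightarrow> ('a poly \<times> 'a poly) set" where
  "dual_polys G = {(p, q). \<forall>i. (coeff p i, coeff q i) \<in> G}"

text \<open>The eps-part of the value of p + eps q at the dual number \<alpha> + eps u; the part
  without eps is \<open>poly p \<alpha>\<close>.\<close>

definition dual_eval :: "'a::field \<Rightarrow> 'a \<Rightarrow> 'a poly \<Rightarrow> 'a poly \<Rightarrow> 'a" where
  "dual_eval \<alpha> u p q = poly q \<alpha> + poly (pderiv p) \<alpha> * u"

lemma dual_eval_diff: "dual_eval \<alpha> u (p - r) (q - s) = dual_eval \<alpha> u p q - dual_eval \<alpha> u r s"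
  by (simp add: dual_eval_def pderiv_diff algebra_simps)

lemma dual_eval_mult:
  "dual_eval \<alpha> u (p * r) (p * s + q * r) = poly p \<alpha> * dual_eval \<alpha> u r s + dual_eval \<alpha> u p q * poly r \<alpha>"
  by (simp add: dual_eval_def pderiv_mult algebra_simps)

lemma derivation_graph_zero: "derivation_graph G \<Longrightarrow> (0, 0) \<in> G"
  unfolding derivation_graph_def by (metis diff_self)

lemma derivation_graph_diff:
  "derivation_graph G \<Longrightarrow> (a, b) \<in> G \<Longrightarrow> (c, d) \<in> G \<Longrightarrow> (a - c, b - d) \<in> G"
  unfolding derivation_graph_def by blast

lemma derivation_graph_mult:
  "derivation_graph G \<Longrightarrow> (a, b) \<in> G \<Longrightarrow> (c, d) \<in> G \<Longrightarrow> (a * c, a * d + b * c) \<in> G"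
  unfolding derivation_graph_def by blast

lemma derivation_graph_add:
  assumes "derivation_graph G" "(a, b) \<in> G" "(c, d) \<in> G"
  shows "(a + c, b + d) \<in> G"
  using derivation_graph_diff[OF assms(1,2) derivation_graph_diff[OF assms(1) derivation_graph_zero[OF assms(1)] assms(3)]]
  by simp

lemma derivation_graph_sum:
  assumes "derivation_graph G" "\<And>x. x \<in> A \<Longrightarrow> (f x, g x) \<in> G"
  shows "(sum f A, sum g A) \<in> G"
  using assms(2)
  by (induction A rule: infinite_finite_induct)
     (auto intro: derivation_graph_add assms(1) derivation_graph_zero)

lemma derivation_graph_unique:
  assumes "derivation_graph G" "(a, b) \<in> G" "(a, c) \<in> G"
  shows "b = c"
  using derivation_graph_diff[OF assms] assms(1) unfolding derivation_graph_def by force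

lemma dual_polys_diff:
  assumes "derivation_graph G" "(p, q) \<in> dual_polys G" "(r, s) \<in> dual_polys G"
  shows "(p - r, q - s) \<in> dual_polys G"
  using assms by (auto simp: dual_polys_def intro: derivation_graph_diff)

lemma dual_polys_mult:
  assumes "derivation_graph G" "(p, q) \<in> dual_polys G" "(r, s) \<in> dual_polys G"
  shows "(p * r, p * s + q * r) \<in> dual_polys G"
proof -
  have "coeff (p * s + q * r) n = (\<Sum>i\<le>n. coeff p i * coeff s (n - i) + coeff q i * coeff r (n - i))" for n
    by (simp add: coeff_mult sum.distrib)
  then show ?thesis
    using assms by (auto simp: dual_polys_def coeff_mult intro!: derivation_graph_sum derivation_graph_mult)
qed

lemma dual_polys_monom:
  assumes "derivation_graph G" "(a, b) \<in> G"
  shows "(monom a n, monom b n) \<in> dual_polys G"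
  using assms by (auto simp: dual_polys_def derivation_graph_zero)

lemma dual_polys_pderiv:
  assumes "derivation_graph G" "(p, q) \<in> dual_polys G"
  shows "(pderiv p, pderiv q) \<in> dual_polys G"
proof -
  have "(of_nat n * a, of_nat n * b) \<in> G" if "(a, b) \<in> G" for n a b
    using derivation_graph_sum[OF assms(1), of "{..<n}" "\<lambda>_. a" "\<lambda>_. b"] that by simp
  then show ?thesis
    using assms(2) by (auto simp: dual_polys_def coeff_pderiv simp del: of_nat_Suc)
qed

lemma dual_polys_fst_zero:
  assumes "derivation_graph G" "(0, q) \<in> dual_polys G"
  shows "q = 0"
  using assms by (intro poly_eqI) (auto simp: dual_polys_def derivation_graph_def)

text \<open>Evaluating dual polynomials at \<alpha> + eps u gives a subring of the dual numbers by
  construction. Assumption \<open>E\<close> is exactly what keeps this image the graph of a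
  function: a value with zero first component must have zero second component.\<close>

lemma derivation_graph_adjoin:
  assumes G: "derivation_graph G"
    and E: "\<And>p q. (p, q) \<in> dual_polys G \<Longrightarrow> poly p \<alpha> = 0 \<Longrightarrow> dual_eval \<alpha> u p q = 0"
  obtains H where "derivation_graph H" "G \<subseteq> H" "(\<alpha>, u) \<in> H"
proof
  define H where "H = {(poly p \<alpha>, dual_eval \<alpha> u p q) | p q. (p, q) \<in> dual_polys G}"
  have const: "(a, b) \<in> H" if "(a, b) \<in> G" for a b
    using dual_polys_monom[OF G that, of 0]
    by (force simp: H_def dual_eval_def poly_monom monom_0)
  have diff: "(a - c, b - d) \<in> H" and mult: "(a * c, a * d + b * c) \<in> H"
    if ab: "(a, b) \<in> H" and cd: "(c, d) \<in> H" for a b c d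
  proof -
    obtain p q where pq: "(p, q) \<in> dual_polys G" "a = poly p \<alpha>" "b = dual_eval \<alpha> u p q"
      using ab by (auto simp: H_def)
    obtain r s where rs: "(r, s) \<in> dual_polys G" "c = poly r \<alpha>" "d = dual_eval \<alpha> u r s"
      using cd by (auto simp: H_def)
    have "(poly (p - r) \<alpha>, dual_eval \<alpha> u (p - r) (q - s)) \<in> H"
      using dual_polys_diff[OF G pq(1) rs(1)] unfolding H_def by blast
    then show "(a - c, b - d) \<in> H" by (simp add: pq rs dual_eval_diff)
    have "(poly (p * r) \<alpha>, dual_eval \<alpha> u (p * r) (p * s + q * r)) \<in> H"
      using dual_polys_mult[OF G pq(1) rs(1)] unfolding H_def by blast
    then show "(a * c, a * d + b * c) \<in> H" by (simp add: pq rs dual_eval_mult)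
  qed
  show "G \<subseteq> H" using const by auto
  show "(\<alpha>, u) \<in> H"
    using dual_polys_monom[OF G, of 1 0 1] G
    by (force simp: H_def dual_eval_def poly_monom pderiv_monom derivation_graph_def)
  have "b = 0" if "(0, b) \<in> H" for b
    using that E by (auto simp: H_def)
  then show "derivation_graph H"
    using const diff mult G unfolding derivation_graph_def by blast
qed

text \<open>
  If \<open>\<alpha>\<close> is a root of a polynomial \<open>m\<close> over the domain of \<open>D\<close> of minimal degree, then \<open>D \<alpha>\<close> is
  forced to be the solution \<open>u\<close> of \<open>(D m)(\<alpha>) + m'(\<alpha>) u = 0\<close>, and pseudo-division by \<open>m\<close> shows that this
  choice is consistent.  If \<open>\<alpha>\<close> is transcendental, any choice is.
\<close>

lemma derivation_graph_extend_step:
  fixes G :: "('a::field_char_0 \<times> 'a) set"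
  assumes G: "derivation_graph G"
  obtains H u where "derivation_graph H" "G \<subseteq> H" "(\<alpha>, u) \<in> H"
proof -
  have "\<exists>u. \<forall>p q. (p, q) \<in> dual_polys G \<longrightarrow> poly p \<alpha> = 0 \<longrightarrow> dual_eval \<alpha> u p q = 0"
  proof (cases "\<exists>m n. (m, n) \<in> dual_polys G \<and> m \<noteq> 0 \<and> poly m \<alpha> = 0")
    case False
    then have "dual_eval \<alpha> 0 p q = 0" if "(p, q) \<in> dual_polys G" "poly p \<alpha> = 0" for p q
      using that dual_polys_fst_zero[OF G, of q] by (cases "p = 0") (auto simp: dual_eval_def)
    then show ?thesis by blast
  next
    case True
    define P where "P = (\<lambda>(m, n). (m, n) \<in> dual_polys G \<and> m \<noteq> 0 \<and> poly m \<alpha> = 0)"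
    obtain mn where mn: "P mn" "\<And>pq. P pq \<Longrightarrow> degree (fst mn) \<le> degree (fst pq)"
    proof -
      have "\<exists>x. P x" using True by (auto simp: P_def)
      then show ?thesis
        using ex_has_least_nat[of P _ "\<lambda>x. degree (fst x)"] that by blast
    qed
    obtain m n where m: "(m, n) \<in> dual_polys G" "m \<noteq> 0" "poly m \<alpha> = 0" and eq: "mn = (m, n)"
      using mn(1) by (cases mn) (auto simp: P_def)
    have min: "degree m \<le> degree p" if "(p, q) \<in> dual_polys G" "p \<noteq> 0" "poly p \<alpha> = 0" for p q
      using mn(2)[of "(p, q)"] that eq by (auto simp: P_def)
    have "degree m \<noteq> 0"
    proof
      assume "degree m = 0"
      then obtain c where "m = [:c:]" by (rule degree_eq_zeroE)
      then show False using m(2,3) by simp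
    qed
    \<comment> \<open>Characteristic 0 enters here. The derivative of \<open>m\<close> again has
      coefficients in the domain of the derivation and is nonzero of smaller degree, so by
      minimality it does not vanish at \<alpha>.\<close>
    then have "pderiv m \<noteq> 0" "degree (pderiv m) < degree m"
      by (auto simp: pderiv_eq_0_iff degree_pderiv)
    then have m': "poly (pderiv m) \<alpha> \<noteq> 0"
      using min[OF dual_polys_pderiv[OF G m(1)]] by force
    define u where "u = - poly n \<alpha> / poly (pderiv m) \<alpha>"
    have Em: "dual_eval \<alpha> u m n = 0"
      using m' by (simp add: dual_eval_def u_def)
    have "dual_eval \<alpha> u p q = 0" if "(p, q) \<in> dual_polys G" "poly p \<alpha> = 0" for p q
      using that
    proof (induction "degree p" arbitrary: p q rule: less_induct)
      case less
      show ?case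
      proof (cases "p = 0")
        case True
        then show ?thesis
          using dual_polys_fst_zero[OF G, of q] less.prems by (auto simp: dual_eval_def)
      next
        case False
        then have deg: "degree m \<le> degree p" using min less.prems by blast
        define k where "k = degree p - degree m"
        define a where "a = lead_coeff m"
        define a' where "a' = coeff n (degree m)"
        define b where "b = lead_coeff p"
        define b' where "b' = coeff q (degree p)"
        have a: "(a, a') \<in> G" and b: "(b, b') \<in> G"
          using m(1) less.prems by (auto simp: a_def a'_def b_def b'_def dual_polys_def)
        \<comment> \<open>One step of pseudo-division by \<open>m\<close>. The leading coefficient
          \<open>a\<close> need not be invertible in the domain, so \<open>p\<close> is multiplied
          by it instead of \<open>m\<close> being made monic. The formula for \<open>q2\<close> is
          the product rule, which keeps the pair in \<open>dual_polys G\<close>.\<close>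
        define p2 where "p2 = monom a 0 * p - monom b k * m"
        define q2 where "q2 = monom a 0 * q + monom a' 0 * p - (monom b k * n + monom b' k * m)"
        have pq2: "(p2, q2) \<in> dual_polys G"
          unfolding p2_def q2_def
          by (intro dual_polys_diff dual_polys_mult dual_polys_monom G a b m less.prems)
        have E2: "dual_eval \<alpha> u p2 q2 = a * dual_eval \<alpha> u p q"
          by (simp add: p2_def q2_def dual_eval_diff dual_eval_mult less.prems m Em poly_monom)
        have p2: "poly p2 \<alpha> = 0"
          by (simp add: p2_def less.prems m)
        have "coeff p2 (degree p) = 0"
          using deg by (simp add: p2_def coeff_monom_mult k_def a_def b_def monom_0)
        moreover have "degree p2 \<le> degree p"
        proof -
          have "degree (monom b k * m) \<le> k + degree m"
            by (rule order.trans[OF degree_mult_le add_right_mono[OF degree_monom_le]])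
          moreover have "degree (monom a 0 * p) \<le> degree p"
            by (simp add: monom_0)
          ultimately show ?thesis
            using deg unfolding p2_def by (intro degree_diff_le) (auto simp: k_def)
        qed
        ultimately have "p2 = 0 \<or> degree p2 < degree p"
          by (metis le_neq_implies_less leading_coeff_0_iff)
        then have "dual_eval \<alpha> u p2 q2 = 0"
          using less.hyps[OF _ pq2 p2] dual_polys_fst_zero[OF G, of q2] pq2 by (auto simp: dual_eval_def)
        then show ?thesis
          using E2 m(2) by (simp add: a_def)
      qed
    qed
    then show ?thesis by blast
  qed
  then show ?thesis
    using derivation_graph_adjoin[OF G] that by metis
qed

text \<open>Zorn's lemma: a graph that is maximal under inclusion has the whole field as domain,
  since any missing element could still be adjoined. The closure conditions involve only two pairs
  at a time, and two pairs in the union of a chain lie in a common member.\<close>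

theorem derivation_graph_extends:
  fixes G :: "('a::field_char_0 \<times> 'a) set"
  assumes G: "derivation_graph G"
  obtains D where "\<And>a b. D (a + b) = D a + D b" "\<And>a b. D (a * b) = D a * b + a * D b"
    "\<And>a b. (a, b) \<in> G \<Longrightarrow> D a = b"
proof -
  define \<A> where "\<A> = {H. derivation_graph H \<and> G \<subseteq> H}"
  have "\<exists>M\<in>\<A>. \<forall>N\<in>\<A>. M \<subseteq> N \<longrightarrow> N = M"
  proof (rule subset_Zorn_nonempty)
    show "\<A> \<noteq> {}" using G by (auto simp: \<A>_def)
    fix C assume C: "C \<noteq> {}" "subset.chain \<A> C"
    then have dg: "derivation_graph H" "G \<subseteq> H" if "H \<in> C" for H
      using that by (auto simp: subset_chain_def \<A>_def)
    have common: "\<exists>H\<in>C. x \<in> H \<and> y \<in> H" if xy: "x \<in> \<Union>C" "y \<in> \<Union>C" for x y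
    proof -
      obtain H H' where "H \<in> C" "H' \<in> C" "x \<in> H" "y \<in> H'" using xy by blast
      moreover have "H \<subseteq> H' \<or> H' \<subseteq> H"
        using C(2) \<open>H \<in> C\<close> \<open>H' \<in> C\<close> by (auto simp: subset_chain_def)
      ultimately show ?thesis by blast
    qed
    have "derivation_graph (\<Union>C)"
      unfolding derivation_graph_def
    proof (intro conjI allI impI)
      show "(1, 0) \<in> \<Union>C" using dg C(1) by (auto simp: derivation_graph_def)
      show "(a - c, b - d) \<in> \<Union>C" "(a * c, a * d + b * c) \<in> \<Union>C"
        if "(a, b) \<in> \<Union>C" "(c, d) \<in> \<Union>C" for a b c d
        using common[OF that] dg derivation_graph_diff derivation_graph_mult by blast+
      show "b = 0" if "(0, b) \<in> \<Union>C" for b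
        using that dg by (auto simp: derivation_graph_def)
    qed
    then show "\<Union>C \<in> \<A>" using dg C(1) by (auto simp: \<A>_def)
  qed
  then obtain M where M: "derivation_graph M" "G \<subseteq> M"
    and max: "\<And>N. derivation_graph N \<Longrightarrow> M \<subseteq> N \<Longrightarrow> N = M" by (fastforce simp: \<A>_def)
  have "\<exists>b. (a, b) \<in> M" for a
    using derivation_graph_extend_step[OF M(1), of a] max by metis
  then obtain D where D: "\<And>a. (a, D a) \<in> M" by metis
  have D': "D a = b" if "(a, b) \<in> M" for a b
    using derivation_graph_unique[OF M(1) D that] .
  show ?thesis
  proof
    show "D (a + b) = D a + D b" for a b
      using D' derivation_graph_add[OF M(1) D D] by blast
    show "D (a * b) = D a * b + a * D b" for a b
      using D'[OF derivation_graph_mult[OF M(1) D D]] by simp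
    show "D a = b" if "(a, b) \<in> G" for a b
      using D' that M(2) by blast
  qed
qed

section \<open>Differential forms and etale triviality\<close>

locale field_embedding =
  fixes \<iota> :: "'k::field \<Rightarrow> 'K::field"
  assumes ring_hom: "\<iota> \<in> ring_hom ring_of_type_algebra ring_of_type_algebra"
begin

lemma map_add: "\<iota> (a + b) = \<iota> a + \<iota> b"
  and map_mult: "\<iota> (a * b) = \<iota> a * \<iota> b"
  and map_one [simp]: "\<iota> 1 = 1"
  using ring_hom by (auto simp: ring_hom_def ring_of_type_algebra_def)

lemma map_zero [simp]: "\<iota> 0 = 0"
  by (metis map_add add_0 add_cancel_left_left)

lemma map_minus: "\<iota> (- a) = - \<iota> a"
  using map_add[of a "- a"] by (simp add: eq_neg_iff_add_eq_0 add.commute)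

lemma map_diff: "\<iota> (a - b) = \<iota> a - \<iota> b"
  using map_add[of a "- b"] by (simp add: map_minus)

lemma map_sum: "\<iota> (sum f A) = (\<Sum>x\<in>A. \<iota> (f x))"
  by (induction A rule: infinite_finite_induct) (auto simp: map_add)

lemma map_eq_0_iff [simp]: "\<iota> a = 0 \<longleftrightarrow> a = 0"
  by (metis map_mult map_one map_zero mult_zero_left right_inverse zero_neq_one)

lemma map_inverse: "\<iota> (inverse a) = inverse (\<iota> a)"
  by (cases "a = 0") (auto simp: map_mult[symmetric] intro!: inverse_unique[symmetric])

lemma map_poly_mult: "map_poly \<iota> (p * q) = map_poly \<iota> p * map_poly \<iota> q"
  by (intro poly_eqI) (simp add: coeff_map_poly coeff_mult map_sum map_mult)

lemma range_diff: "a \<in> range \<iota> \<Longrightarrow> b \<in> range \<iota> \<Longrightarrow> a - b \<in> range \<iota>"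
  by (auto simp flip: map_diff)

lemma range_mult: "a \<in> range \<iota> \<Longrightarrow> b \<in> range \<iota> \<Longrightarrow> a * b \<in> range \<iota>"
  by (auto simp flip: map_mult)

end

text \<open>Linear factors of \<open>p\<close> are split off one by one: each either has
  \<open>z\<close> as the image of its root or can be cancelled, and a nonzero constant has no
  root.\<close>

lemma algebraic_over_alg_closed:
  fixes \<iota> :: "'k::alg_closed_field \<Rightarrow> 'K::field"
  assumes "field_embedding \<iota>" "p \<noteq> 0" "poly (map_poly \<iota> p) z = 0"
  shows "z \<in> range \<iota>"
  using assms(2,3)
proof (induction "degree p" arbitrary: p rule: less_induct)
  case less
  interpret field_embedding \<iota> by fact
  show ?case
  proof (cases "degree p = 0")
    case True
    then obtain c where "p = [:c:]" by (rule degree_eq_zeroE)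
    then show ?thesis using less.prems by (simp add: map_poly_pCons)
  next
    case False
    then obtain x where "poly p x = 0"
      using alg_closed_imp_poly_has_root by blast
    then obtain q where q: "p = [:- x, 1:] * q"
      by (auto simp: poly_eq_0_iff_dvd)
    have "q \<noteq> 0" using q less.prems by auto
    have *: "(z - \<iota> x) * poly (map_poly \<iota> q) z = 0"
      using less.prems(2) unfolding q map_poly_mult
      by (auto simp: map_poly_pCons map_minus)
    have "degree p = Suc (degree q)"
      unfolding q using \<open>q \<noteq> 0\<close> by (subst degree_mult_eq) auto
    then show ?thesis
      using * less.hyps[of q] \<open>q \<noteq> 0\<close> by auto
  qed
qed

lemma derivations_UNIV_iff:
  "\<theta> \<in> derivations C UNIV \<longleftrightarrow>
     (\<forall>a b. \<theta> (a + b) = \<theta> a + \<theta> b) \<and> (\<forall>a b. \<theta> (a * b) = \<theta> a * b + a * \<theta> b) \<and> (\<forall>c\<in>C. \<theta> c = 0)"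
  by (auto simp: derivations_def)

text \<open>An element outside the image is transcendental over it, the base being algebraically
  closed. Hence no polynomial relation constrains the value at \<open>z\<close>: the zero derivation
  of the constants extends to k[z] with value 1 at \<open>z\<close>, and from k[z] to the whole
  field.\<close>

lemma exists_derivation_nonzero:
  fixes \<iota> :: "'k::alg_closed_field \<Rightarrow> 'K::field_char_0"
  assumes "field_embedding \<iota>" "z \<notin> range \<iota>"
  obtains \<theta> where "\<theta> \<in> derivations (range \<iota>) UNIV" "\<theta> z = 1"
proof -
  interpret field_embedding \<iota> by fact
  define G where "G = {(\<iota> c, 0 :: 'K) | c. True}"
  have G: "derivation_graph G"
    unfolding derivation_graph_def G_def
    by (auto simp: map_diff[symmetric] map_mult[symmetric] intro: exI[of _ "1 :: 'k"])
  have "dual_eval z 1 p q = 0" if pq: "(p, q) \<in> dual_polys G" and root: "poly p z = 0" for p q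
  proof -
    have coeffs: "\<exists>c. coeff p i = \<iota> c \<and> coeff q i = 0" for i
      using pq by (auto simp: dual_polys_def G_def)
    then have q: "q = 0" by (intro poly_eqI) auto
    \<comment> \<open>A polynomial with coefficients in the range of \<iota> is pulled back to one
      over the base field. For \<open>map_poly\<close> the chosen inverse must send 0 to 0.\<close>
    have "coeff p i \<in> range \<iota>" for i using coeffs[of i] by auto
    then have *: "\<iota> (inv_into UNIV \<iota> (coeff p i)) = coeff p i" for i
      by (rule f_inv_into_f)
    moreover have "inv_into UNIV \<iota> 0 = 0"
      by (metis f_inv_into_f map_eq_0_iff map_zero rangeI)
    ultimately have "p = map_poly \<iota> (map_poly (inv_into UNIV \<iota>) p)"
      by (intro poly_eqI) (simp add: coeff_map_poly)
    then have "p = 0"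
      using algebraic_over_alg_closed[OF assms(1)] assms(2) root by (metis map_poly_0)
    then show ?thesis by (simp add: q dual_eval_def)
  qed
  then obtain H where H: "derivation_graph H" "G \<subseteq> H" "(z, 1) \<in> H"
    using derivation_graph_adjoin[OF G] by metis
  from derivation_graph_extends[OF H(1)] obtain D where D:
    "\<And>a b. D (a + b) = D a + D b" "\<And>a b. D (a * b) = D a * b + a * D b" "\<And>a b. (a, b) \<in> H \<Longrightarrow> D a = b"
    by metis
  show ?thesis
  proof
    have "D (\<iota> c) = 0" for c
      using D(3)[of "\<iota> c" 0] H(2) by (auto simp: G_def)
    then show "D \<in> derivations (range \<iota>) UNIV"
      unfolding derivations_UNIV_iff using D(1,2) by auto
    show "D z = 1" using D(3) H(3) by blast
  qed
qed

lemma derivation_power: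
  assumes "\<And>a b. a \<in> L \<Longrightarrow> b \<in> L \<Longrightarrow> D (a * b) = D a * b + a * D b" "D 1 = 0" "a \<in> L"
    "\<And>n. a ^ n \<in> L"
  shows "D (a ^ n) = of_nat n * a ^ (n - 1) * (D a :: 'a::comm_ring_1)"
proof (induction n)
  case (Suc n)
  have "D (a ^ Suc n) = D a * a ^ n + a * D (a ^ n)"
    using assms(1)[OF assms(3) assms(4)] by simp
  also have "\<dots> = of_nat (Suc n) * a ^ (Suc n - 1) * D a"
    unfolding Suc.IH by (cases n) (auto simp: algebra_simps)
  finally show ?case .
qed (use assms(2) in auto)

lemma dlog_apply:
  "dlog C L \<phi> \<theta> = (if \<theta> \<in> derivations C L then inverse \<phi> * \<theta> \<phi> else 0)"
  by (simp add: dlog_def form_of_def)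

section \<open>Finite extensions inside the algebraic closure\<close>

lemma alg_closure_min_poly:
  fixes x :: "'a::field alg_closure"
  obtains p where "p \<noteq> 0" "poly (map_poly to_ac p) x = 0" "lead_coeff p = 1"
    "\<And>q. poly (map_poly to_ac q) x = 0 \<Longrightarrow> degree q < degree p \<Longrightarrow> q = 0"
proof -
  define P where "P = (\<lambda>p. p \<noteq> 0 \<and> poly (map_poly to_ac p) x = 0)"
  have "\<exists>p. P p" using alg_closure_algebraic[of x] unfolding P_def by metis
  then obtain p where p: "P p" "\<And>q. P q \<Longrightarrow> degree p \<le> degree q"
    using ex_has_least_nat[of P _ degree] by blast
  define p' where "p' = smult (inverse (lead_coeff p)) p"
  have "map_poly to_ac p' = smult (to_ac (inverse (lead_coeff p))) (map_poly to_ac p)"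
    unfolding p'_def by (intro poly_eqI) (simp add: coeff_map_poly)
  then have "poly (map_poly to_ac p') x = 0" using p(1) by (simp add: P_def)
  moreover have "degree p' = degree p" "p' \<noteq> 0" "lead_coeff p' = 1"
    using p(1) by (auto simp: p'_def P_def)
  ultimately show ?thesis
    using p(2) that[of p'] unfolding P_def by (metis not_less)
qed

lemma poly_map_poly_to_ac:
  assumes "degree p \<le> n"
  shows "poly (map_poly to_ac p) x = (\<Sum>i\<le>n. to_ac (coeff p i) * x ^ i)"
proof -
  have "degree (map_poly to_ac p) \<le> n"
    using assms map_poly_degree_leq[of to_ac p] by linarith
  then show ?thesis
    unfolding poly_altdef
    by (intro sum.mono_neutral_cong_left) (auto simp: coeff_map_poly intro: le_degree)
qed

lemma finite_ext_closed:
  assumes "finite_ext L"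
  shows "to_ac a \<in> L" "x \<in> L \<Longrightarrow> y \<in> L \<Longrightarrow> x + y \<in> L" "x \<in> L \<Longrightarrow> y \<in> L \<Longrightarrow> x * y \<in> L"
    "x \<in> L \<Longrightarrow> - x \<in> L" "x \<in> L \<Longrightarrow> inverse x \<in> L"
proof -
  interpret R: field "ring_of_type_algebra :: 'a alg_closure ring" by rule
  have L: "subfield L (ring_of_type_algebra :: 'a alg_closure ring)" and "range to_ac \<subseteq> L"
    using assms by (auto simp: finite_ext_def)
  note sr = subfieldE(1)[OF L]
  show "to_ac a \<in> L" using \<open>range to_ac \<subseteq> L\<close> by auto
  show "x \<in> L \<Longrightarrow> y \<in> L \<Longrightarrow> x + y \<in> L"
    using subringE(7)[OF sr] by (simp add: ring_of_type_algebra_def)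
  show "x \<in> L \<Longrightarrow> y \<in> L \<Longrightarrow> x * y \<in> L"
    using subringE(6)[OF sr] by (simp add: ring_of_type_algebra_def)
  show "- x \<in> L" if "x \<in> L"
  proof -
    have "\<ominus>\<^bsub>ring_of_type_algebra\<^esub> x \<in> L" using subringE(5)[OF sr that] .
    moreover have "\<ominus>\<^bsub>ring_of_type_algebra\<^esub> x = - x"
      using R.minus_equality[of "- x" x] by (simp add: ring_of_type_algebra_def)
    ultimately show ?thesis by simp
  qed
  show "inverse x \<in> L" if "x \<in> L"
  proof (cases "x = 0")
    case False
    then have "inv\<^bsub>ring_of_type_algebra\<^esub> x \<in> L"
      using R.subfield_m_inv[OF L, of x] that by (simp add: ring_of_type_algebra_def)
    moreover have "inv\<^bsub>ring_of_type_algebra\<^esub> x = inverse x"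
      using R.comm_inv_char[of x "inverse x"] False by (simp add: ring_of_type_algebra_def)
    ultimately show ?thesis by simp
  qed (use that in auto)
qed

lemma derivationsD:
  assumes "\<theta> \<in> derivations C L"
  shows "a \<in> L \<Longrightarrow> \<theta> a \<in> L" "a \<in> L \<Longrightarrow> b \<in> L \<Longrightarrow> \<theta> (a + b) = \<theta> a + \<theta> b"
    "a \<in> L \<Longrightarrow> b \<in> L \<Longrightarrow> \<theta> (a * b) = \<theta> a * b + a * \<theta> b" "c \<in> C \<Longrightarrow> \<theta> c = 0"
  using assms by (auto simp: derivations_def)

text \<open>The derivation is first extended to the whole algebraic closure, where nothing
  guarantees that \<open>L\<close> is preserved. Differentiating the minimal equation of an x in
  \<open>L\<close> expresses D x as a quotient: minus the value at x of the polynomial with \<theta>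
  applied to its coefficients, divided by the value of its derivative. Both lie in \<open>L\<close>.
  The value 0 outside \<open>L\<close> is demanded by \<open>derivations\<close>.\<close>

lemma derivation_extends_to_finite_ext:
  fixes \<iota> :: "'k::field \<Rightarrow> 'K::field_char_0"
  assumes "\<theta> \<in> derivations (range \<iota>) UNIV" and L: "finite_ext L"
  obtains \<theta>' where "\<theta>' \<in> derivations (range (to_ac \<circ> \<iota>)) L" "\<And>a. \<theta>' (to_ac a) = to_ac (\<theta> a)"
proof -
  note \<theta> = derivationsD[OF assms(1), simplified]
  have \<theta>_zero: "\<theta> 0 = 0" using \<theta>(2)[of 0 0] by simp
  have \<theta>_one: "\<theta> 1 = 0" using \<theta>(3)[of 1 1] by simp
  have \<theta>_diff: "\<theta> (a - b) = \<theta> a - \<theta> b" for a b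
    using \<theta>(2)[of "a - b" b] by (simp add: algebra_simps)
  define G where "G = {(to_ac a, to_ac (\<theta> a)) | a. True}"
  have "derivation_graph G"
    unfolding derivation_graph_def
  proof (intro conjI allI impI)
    show "(1, 0) \<in> G"
      unfolding G_def using \<theta>_one by (metis (mono_tags, lifting) mem_Collect_eq to_ac_0 to_ac_1)
    fix a b c d assume "(a, b) \<in> G" "(c, d) \<in> G"
    then obtain x y where "a = to_ac x" "b = to_ac (\<theta> x)" "c = to_ac y" "d = to_ac (\<theta> y)"
      by (auto simp: G_def)
    then show "(a - c, b - d) \<in> G" "(a * c, a * d + b * c) \<in> G"
      unfolding G_def
      by (auto simp: \<theta>_diff \<theta>(3) intro: exI[of _ "x - y"] exI[of _ "x * y"])
  next
    fix b assume "(0, b) \<in> G"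
    then show "b = 0" by (auto simp: G_def \<theta>_zero)
  qed
  from derivation_graph_extends[OF this] obtain D where D: "\<And>a b. D (a + b) = D a + D b"
    "\<And>a b. D (a * b) = D a * b + a * D b" and DG: "\<And>a b. (a, b) \<in> G \<Longrightarrow> D a = b"
    by metis
  have D_ac: "D (to_ac a) = to_ac (\<theta> a)" for a by (rule DG) (auto simp: G_def)
  have D_one: "D 1 = 0" using D(2)[of 1 1] by simp
  have D_sum: "D (sum f A) = (\<Sum>i\<in>A. D (f i))" for f and A :: "nat set"
    using D(1)[of 0 0] by (induction A rule: infinite_finite_induct) (auto simp: D(1))
  note cl = finite_ext_closed[OF L]
  have L_power: "x ^ n \<in> L" if "x \<in> L" for x n
    using that cl(1)[of 1] by (induction n) (auto intro: cl)
  have L_poly: "poly (map_poly to_ac p) x \<in> L" if "x \<in> L" for p x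
  proof (induction p)
    case 0 then show ?case using cl(1)[of 0] by simp
  next
    case (pCons a p) then show ?case by (auto simp: map_poly_pCons intro!: cl that)
  qed
  have D_poly: "D (poly (map_poly to_ac p) x) =
      poly (map_poly to_ac (map_poly \<theta> p)) x + poly (map_poly to_ac (pderiv p)) x * D x" for p x
  proof (induction p)
    case 0 then show ?case using D(1)[of 0 0] by simp
  next
    case (pCons a p)
    have "map_poly to_ac (pderiv (pCons a p)) = map_poly to_ac p + pCons 0 (map_poly to_ac (pderiv p))"
      by (intro poly_eqI) (auto simp: pderiv_pCons coeff_map_poly coeff_pCons split: nat.splits)
    then show ?case
      using pCons by (simp add: map_poly_pCons \<theta>_zero D D_ac algebra_simps)
  qed
  have D_L: "D x \<in> L" if "x \<in> L" for x
  proof -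
    obtain p where p: "p \<noteq> 0" "poly (map_poly to_ac p) x = 0" "lead_coeff p = 1"
      "\<And>q. poly (map_poly to_ac q) x = 0 \<Longrightarrow> degree q < degree p \<Longrightarrow> q = 0"
      using alg_closure_min_poly[of x] by metis
    have "degree p \<noteq> 0"
    proof
      assume "degree p = 0"
      then obtain c where "p = [:c:]" by (rule degree_eq_zeroE)
      then show False using p(1,2) by (auto simp: map_poly_pCons)
    qed
    then have "pderiv p \<noteq> 0" "degree (pderiv p) < degree p"
      by (auto simp: pderiv_eq_0_iff degree_pderiv)
    then have nz: "poly (map_poly to_ac (pderiv p)) x \<noteq> 0" using p(4) by blast
    have "poly (map_poly to_ac (map_poly \<theta> p)) x + poly (map_poly to_ac (pderiv p)) x * D x = 0"
    proof -
      have "D 0 = 0" using D(1)[of 0 0] by simp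
      then show ?thesis using D_poly[of p x] unfolding p(2) by (metis (no_types))
    qed
    then have "D x = - (poly (map_poly to_ac (map_poly \<theta> p)) x * inverse (poly (map_poly to_ac (pderiv p)) x))"
      using nz by (simp add: field_simps eq_neg_iff_add_eq_0)
    then show ?thesis using L_poly[OF that] by (auto intro!: cl)
  qed
  define \<theta>' where "\<theta>' = (\<lambda>x. if x \<in> L then D x else 0)"
  show ?thesis
  proof
    show "\<theta>' (to_ac a) = to_ac (\<theta> a)" for a
      using cl(1) D_ac by (simp add: \<theta>'_def)
    then show "\<theta>' \<in> derivations (range (to_ac \<circ> \<iota>)) L"
      using D D_L \<theta>(4) cl by (auto simp: derivations_def \<theta>'_def)
  qed
qed

text \<open>
  Differentiating the minimal equation \<open>\<Sum>a\<^sub>i g\<^sup>i = 0\<close> of degree \<open>n\<close> and subtracting \<open>n w\<close> times it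
  leaves an equation of smaller degree, so \<open>\<theta> a\<^sub>i = (n - i) w a\<^sub>i\<close>; take \<open>i = 0\<close>.
\<close>

lemma horizontal_imp_dlog:
  fixes g :: "'K::field_char_0 alg_closure"
  assumes L: "finite_ext L" "g \<in> L" and "g \<noteq> 0"
  obtains n a where "n > 0" "a \<noteq> 0"
    "\<And>C C' \<theta> \<theta>' w. \<theta> \<in> derivations C UNIV \<Longrightarrow> \<theta>' \<in> derivations C' L \<Longrightarrow>
       (\<And>a. \<theta>' (to_ac a) = to_ac (\<theta> a)) \<Longrightarrow> \<theta>' g = to_ac w * g \<Longrightarrow> of_nat n * w = inverse a * \<theta> a"
proof -
  note cl = finite_ext_closed[OF L(1)]
  have pow: "g ^ n \<in> L" for n
    using L(2) cl(1)[of 1] by (induction n) (auto intro: cl)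
  obtain p where p: "p \<noteq> 0" "poly (map_poly to_ac p) g = 0" "lead_coeff p = 1"
    "\<And>q. poly (map_poly to_ac q) g = 0 \<Longrightarrow> degree q < degree p \<Longrightarrow> q = 0"
    using alg_closure_min_poly[of g] by metis
  define n where "n = degree p"
  have a0: "coeff p 0 \<noteq> 0"
  proof
    assume "coeff p 0 = 0"
    then obtain q where q: "p = pCons 0 q" by (cases p) auto
    then have "q \<noteq> 0" "poly (map_poly to_ac q) g = 0"
      using p(1,2) assms by (auto simp: map_poly_pCons)
    moreover have "degree q < degree p" using q \<open>q \<noteq> 0\<close> by simp
    ultimately show False using p(4) by blast
  qed
  have "n > 0"
  proof (rule ccontr)
    assume "\<not> n > 0"
    then obtain c where "p = [:c:]" unfolding n_def by (auto elim: degree_eq_zeroE)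
    then show False using p(1,2) by (auto simp: map_poly_pCons)
  qed
  \<comment> \<open>\<open>n\<close> and the witness depend on \<open>g\<close> alone and are fixed
    before any derivation is chosen, so the outcome is a single identity of forms. Up to sign the
    constant term is the norm of \<open>g\<close> from K(g) to K, and a sign does not affect the
    logarithmic derivative.\<close>
  moreover have "of_nat n * w = inverse (- coeff p 0) * \<theta> (- coeff p 0)"
    if "\<theta> \<in> derivations C UNIV" "\<theta>' \<in> derivations C' L"
      and ext: "\<And>a. \<theta>' (to_ac a) = to_ac (\<theta> a)" and g: "\<theta>' g = to_ac w * g"
    for C C' \<theta> \<theta>' w
  proof -
    note \<theta> = derivationsD[OF that(1), simplified] and \<theta>' = derivationsD[OF that(2)]
    have \<theta>_zero: "\<theta> 0 = 0" using \<theta>(2)[of 0 0] by simp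
    have \<theta>_one: "\<theta> 1 = 0" using \<theta>(3)[of 1 1] by simp
    have \<theta>'_zero: "\<theta>' 0 = 0" using ext[of 0] by (simp add: \<theta>_zero)
    have \<theta>'_one: "\<theta>' 1 = 0" using ext[of 1] by (simp add: \<theta>_one)
    have \<theta>'_pow: "\<theta>' (g ^ i) = of_nat i * to_ac w * g ^ i" for i
      using derivation_power[of L \<theta>' g i] \<theta>'(3) pow[of 1] pow \<theta>'_one
      by (cases i) (auto simp: g algebra_simps)
    have sum_L: "sum f A \<in> L \<and> \<theta>' (sum f A) = (\<Sum>i\<in>A. \<theta>' (f i))"
      if "\<And>i. f i \<in> L" for f and A :: "nat set"
      using that cl(1)[of 0]
      by (induction A rule: infinite_finite_induct) (auto simp: cl \<theta>'(2) \<theta>'_zero)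
    have "0 = \<theta>' (poly (map_poly to_ac p) g)"
      by (simp add: p(2) \<theta>'_zero)
    also have "\<dots> = (\<Sum>i\<le>n. \<theta>' (to_ac (coeff p i) * g ^ i))"
      using sum_L[of "\<lambda>i. to_ac (coeff p i) * g ^ i"] pow cl
      by (simp add: poly_map_poly_to_ac[of p n] n_def)
    also have "\<dots> = (\<Sum>i\<le>n. to_ac (\<theta> (coeff p i) + of_nat i * w * coeff p i) * g ^ i)"
      using cl(1) pow by (intro sum.cong) (auto simp: \<theta>'(3) ext \<theta>'_pow algebra_simps)
    finally have eq1: "(\<Sum>i\<le>n. to_ac (\<theta> (coeff p i) + of_nat i * w * coeff p i) * g ^ i) = 0" by simp
    have eq2: "(\<Sum>i\<le>n. to_ac (of_nat n * w * coeff p i) * g ^ i) = 0"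
    proof -
      have "(\<Sum>i\<le>n. to_ac (of_nat n * w * coeff p i) * g ^ i) = to_ac (of_nat n * w) * poly (map_poly to_ac p) g"
        by (simp add: poly_map_poly_to_ac[of p n] n_def sum_distrib_left mult.assoc)
      then show ?thesis by (simp add: p(2))
    qed
    define c where "c = (\<lambda>i. \<theta> (coeff p i) + of_nat i * w * coeff p i - of_nat n * w * coeff p i)"
    define q where "q = (\<Sum>i\<le>n. monom (c i) i)"
    have coeff_q: "coeff q i = (if i \<le> n then c i else 0)" for i
      unfolding q_def by (simp add: coeff_sum)
    have "degree q \<le> n" by (rule degree_le) (simp add: coeff_q)
    have "(\<Sum>i\<le>n. to_ac (c i) * g ^ i) = 0"
      using eq1 eq2 unfolding c_def
      by (simp only: to_ac_diff left_diff_distrib sum_subtractf diff_0_right)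
    then have "poly (map_poly to_ac q) g = 0"
      using \<open>degree q \<le> n\<close> by (simp add: poly_map_poly_to_ac coeff_q)
    \<comment> \<open>At the top index the two multiples n w cancel, and \<theta> 1 = 0 because
      \<open>p\<close> is monic.\<close>
    moreover have "coeff q n = 0"
      using p(3) by (simp add: coeff_q c_def \<theta>_one n_def)
    then have "q = 0 \<or> degree q < n"
      using \<open>degree q \<le> n\<close> by (metis le_neq_implies_less leading_coeff_0_iff)
    ultimately have "q = 0" using p(4) n_def by blast
    then have "\<theta> (coeff p 0) = of_nat n * w * coeff p 0"
      using coeff_q[of 0] by (simp add: c_def)
    moreover have "\<theta> (- coeff p 0) = - \<theta> (coeff p 0)"
      using \<theta>(2)[of "- coeff p 0" "coeff p 0"] \<theta>_zero by (simp add: eq_neg_iff_add_eq_0)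
    ultimately show ?thesis using a0 by simp
  qed
  ultimately show ?thesis using that[of n "- coeff p 0"] a0 by auto
qed

lemma subfield_range_to_ac:
  "subfield (range to_ac) (ring_of_type_algebra :: 'K::field alg_closure ring)"
proof -
  interpret R: field "ring_of_type_algebra :: 'K alg_closure ring" by rule
  have inv: "inv\<^bsub>ring_of_type_algebra\<^esub> x = inverse x" if "x \<noteq> 0" for x :: "'K alg_closure"
    using R.comm_inv_char[of x "inverse x"] that by (simp add: ring_of_type_algebra_def)
  have minus: "\<ominus>\<^bsub>ring_of_type_algebra\<^esub> x = - x" for x :: "'K alg_closure"
    using R.minus_equality[of "- x" x] by (simp add: ring_of_type_algebra_def)
  show ?thesis
  proof (rule R.subfieldI')
    show "subring (range to_ac) (ring_of_type_algebra :: 'K alg_closure ring)"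
    proof (rule R.subringI)
      show "\<one>\<^bsub>ring_of_type_algebra\<^esub> \<in> range (to_ac :: 'K \<Rightarrow> _)"
        by (auto simp: ring_of_type_algebra_def intro: image_eqI[of _ _ 1])
      show "\<ominus>\<^bsub>ring_of_type_algebra\<^esub> h \<in> range to_ac" if "h \<in> range to_ac" for h :: "'K alg_closure"
        using that by (auto simp: minus simp flip: to_ac_minus)
    qed (auto simp: ring_of_type_algebra_def simp flip: to_ac_mult to_ac_add)
    show "inv\<^bsub>ring_of_type_algebra\<^esub> h \<in> range to_ac"
      if "h \<in> range to_ac - {\<zero>\<^bsub>ring_of_type_algebra\<^esub>}" for h :: "'K alg_closure"
      using that inv[of h] by (auto simp: ring_of_type_algebra_def simp flip: to_ac_inverse)
  qed
qed

lemma finite_ext_root: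
  fixes g :: "'K::field alg_closure"
  assumes "n > 0" "g ^ n = to_ac c"
  obtains L where "finite_ext L" "g \<in> L"
proof -
  interpret R: field "ring_of_type_algebra :: 'K alg_closure ring" by rule
  let ?R = "ring_of_type_algebra :: 'K alg_closure ring"
  note K = subfield_range_to_ac[where ?'K = 'K]
  have carr: "carrier ?R = UNIV" by (simp add: ring_of_type_algebra_def)
  have pow: "x [^]\<^bsub>?R\<^esub> (m::nat) = x ^ m" for x m
    by (induction m) (auto simp: ring_of_type_algebra_def nat_pow_def)
  \<comment> \<open>Coefficients are listed from the leading one down, so this is x^n - c with n - 1
    zeros in between.\<close>
  define q where "q = 1 # replicate (n - 1) 0 @ [to_ac (- c)]"
  have ops: "x \<otimes>\<^bsub>?R\<^esub> y = x * y" "x \<oplus>\<^bsub>?R\<^esub> y = x + y" "\<zero>\<^bsub>?R\<^esub> = 0" "\<one>\<^bsub>?R\<^esub> = 1" for x y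
    by (simp_all add: ring_of_type_algebra_def)
  have eval: "R.eval (replicate m 0 @ [a]) g = a" for m a
    by (induction m) (simp_all add: ops pow)
  have "R.eval q g = g ^ n - to_ac c"
    using \<open>n > 0\<close> unfolding q_def by (simp add: ops pow eval)
  then have "R.eval q g = \<zero>\<^bsub>?R\<^esub>"
    using assms(2) by (simp add: ring_of_type_algebra_def)
  moreover have "q \<in> carrier (univ_poly ?R (range to_ac))"
    unfolding univ_poly_carrier[symmetric] polynomial_def q_def
    by (auto simp: ops intro: range_eqI[of _ to_ac 0] range_eqI[of _ to_ac 1] range_eqI[of _ to_ac "- c"])
  ultimately have alg: "(R.algebraic over range to_ac) g"
    using R.algebraicI[of q "range to_ac" g] by (auto simp: q_def)
  define L where "L = R.simple_extension (range to_ac) g"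
  show ?thesis
  proof
    show "finite_ext L"
      unfolding finite_ext_def L_def
      using R.simple_extension_is_subfield[OF K] R.finite_dimension_simple_extension[OF K]
        R.simple_extension_incl[of "range to_ac" g] alg by (simp add: carr)
    show "g \<in> L"
      unfolding L_def using R.simple_extension_mem[OF subfieldE(1)[OF K]] by (simp add: carr)
  qed
qed

text \<open>The closure is a vector space over \<open>'K\<close>, and \<open>v\<close> extends to a
  basis. Composed with such functionals, a derivation of an extension becomes a family of
  derivations of \<open>'K\<close>; together the functionals detect whether a value is zero.\<close>

lemma linear_functional_nonzero:
  fixes v :: "'K::field alg_closure"
  assumes "v \<noteq> 0"
  obtains f where "\<And>x y. f (x + y) = f x + f y" "\<And>a x. f (to_ac a * x) = a * f x" "f v = 1"
proof -
  interpret vector_space_pair "\<lambda>(a::'K) x. to_ac a * x" "(*)"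
    by unfold_locales (auto simp: algebra_simps)
  have "vs1.independent {v}" using assms by simp
  from linear_independent_extend[OF this, of "\<lambda>_. 1"]
  obtain f where f: "Vector_Spaces.linear (\<lambda>(a::'K) x. to_ac a * x) (*) f" "f v = 1" by auto
  interpret f: Vector_Spaces.linear "\<lambda>(a::'K) x. to_ac a * x" "(*)" f by fact
  show ?thesis using that[of f] f(2) f.add f.scale by blast
qed

text \<open>Forms are indexed by sets of pairs, so taking an image could merge summands; injectivity
  of \<open>to_ac\<close> excludes this.\<close>

lemma form_of_to_ac:
  assumes "\<theta>' \<in> derivations (range (to_ac \<circ> \<iota>)) L"
  shows "form_of (range (to_ac \<circ> \<iota>)) L (map_prod to_ac to_ac ` A) \<theta>' = (\<Sum>(a, b)\<in>A. to_ac a * \<theta>' (to_ac b))"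
proof -
  have "inj_on (map_prod to_ac to_ac) A"
    by (auto simp: inj_on_def)
  then show ?thesis
    using assms by (simp add: form_of_def sum.reindex case_prod_unfold)
qed

text \<open>The image \<open>g\<close> of the generator under a trivialisation satisfies \<theta>' g
  = \<gamma>(\<theta>) g whenever \<theta>' extends \<theta>, and every derivation of
  \<open>'K\<close> has such an extension to \<open>L\<close>. So \<open>horizontal_imp_dlog\<close>
  applies with w = \<gamma>(\<theta>). Off the derivations both sides are 0 by convention.\<close>

lemma etale_trivial_imp_multiple_dlog:
  fixes \<iota> :: "'k::field \<Rightarrow> 'K::field_char_0"
  assumes "etale_trivial \<iota> \<gamma>"
  obtains n \<phi> where "n > 0" "\<phi> \<noteq> 0" "\<And>\<theta>. of_nat n * \<gamma> \<theta> = dlog_K \<iota> \<phi> \<theta>"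
proof -
  obtain L A h where L: "finite_ext L" and A: "finite A" "\<gamma> = form_of (range \<iota>) UNIV A"
    and h: "bij_betw h L L" "\<And>a f. a \<in> L \<Longrightarrow> f \<in> L \<Longrightarrow> h (a * f) = a * h f"
      "\<And>\<theta>' f. \<theta>' \<in> derivations (range (to_ac \<circ> \<iota>)) L \<Longrightarrow> f \<in> L \<Longrightarrow>
         h (connection (form_of (range (to_ac \<circ> \<iota>)) L (map_prod to_ac to_ac ` A)) \<theta>' f)
           = connection (\<lambda>\<theta>. 0) \<theta>' (h f)"
    using assms unfolding etale_trivial_def base_change_def D_module_iso_def by blast
  note cl = finite_ext_closed[OF L]
  have one: "1 \<in> L" using cl(1)[of 1] by simp
  have zero: "0 \<in> L" using cl(1)[of 0] by simp
  define g where "g = h 1"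
  have g_L: "g \<in> L" using h(1) one by (auto simp: g_def bij_betw_def)
  have "h 0 = 0" using h(2)[OF zero one] by simp
  then have "g \<noteq> 0"
    using h(1) one zero unfolding g_def bij_betw_def inj_on_def by (metis zero_neq_one)
  from horizontal_imp_dlog[OF L g_L \<open>g \<noteq> 0\<close>] obtain n a where n: "n > 0" "a \<noteq> 0" and
    dlog: "\<And>C C' \<theta> \<theta>' w. \<theta> \<in> derivations C UNIV \<Longrightarrow> \<theta>' \<in> derivations C' L \<Longrightarrow>
       (\<And>a. \<theta>' (to_ac a) = to_ac (\<theta> a)) \<Longrightarrow> \<theta>' g = to_ac w * g \<Longrightarrow> of_nat n * w = inverse a * \<theta> a"
    by blast
  have "of_nat n * \<gamma> \<theta> = dlog_K \<iota> a \<theta>" for \<theta>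
  proof (cases "\<theta> \<in> derivations (range \<iota>) UNIV")
    case True
    obtain \<theta>' where \<theta>': "\<theta>' \<in> derivations (range (to_ac \<circ> \<iota>)) L" "\<And>a. \<theta>' (to_ac a) = to_ac (\<theta> a)"
      using derivation_extends_to_finite_ext[OF True L] by metis
    have "form_of (range (to_ac \<circ> \<iota>)) L (map_prod to_ac to_ac ` A) \<theta>' = to_ac (\<gamma> \<theta>)"
      using True unfolding form_of_to_ac[OF \<theta>'(1)]
      by (simp add: A form_of_def \<theta>'(2) to_ac_sum case_prod_unfold)
    moreover have "\<theta>' 1 = 0"
      using derivationsD(3)[OF \<theta>'(1) one one] by simp
    ultimately have "h (to_ac (\<gamma> \<theta>) * 1) = \<theta>' g"
      using h(3)[OF \<theta>'(1) one] by (simp add: connection_def g_def)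
    then have "\<theta>' g = to_ac (\<gamma> \<theta>) * g"
      using h(2)[OF cl(1) one] by (simp add: g_def)
    from dlog[OF True \<theta>'(1,2) this] show ?thesis
      using True by (simp add: dlog_apply)
  qed (simp add: A form_of_def dlog_apply)
  with n that show ?thesis by blast
qed

text \<open>
  With \<open>g\<^sup>n = \<phi>\<close>, multiplication by \<open>g\<close> trivialises the pullback to \<open>K(g)\<close>.  The relation
  \<open>n \<gamma> = dlog \<phi>\<close> is only known on derivations of \<open>K\<close>; a derivation of \<open>K(g)\<close> is reduced to these by
  composing it with linear functionals \<open>K(g) \<rightarrow> K\<close>.
\<close>

lemma multiple_dlog_imp_etale_trivial:
  fixes \<iota> :: "'k::field \<Rightarrow> 'K::field_char_0"
  assumes "\<gamma> \<in> forms (range \<iota>) UNIV" "n > 0" "\<phi> \<noteq> 0"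
    and dlog: "\<And>\<theta>. of_nat n * \<gamma> \<theta> = dlog_K \<iota> \<phi> \<theta>"
  shows "etale_trivial \<iota> \<gamma>"
proof -
  obtain A where A: "finite A" "\<gamma> = form_of (range \<iota>) UNIV A"
    using assms(1) by (auto simp: forms_def)
  obtain g where g: "g ^ n = to_ac \<phi>"
    using nth_root_exists[OF assms(2), of "to_ac \<phi>"] by metis
  then have "g \<noteq> 0" using assms(2,3) by (metis power_0_left not_gr_zero to_ac_eq_0_iff)
  obtain L where L: "finite_ext L" "g \<in> L"
    using finite_ext_root[OF assms(2) g] .
  note cl = finite_ext_closed[OF L(1)]
  define \<gamma>L where "\<gamma>L = form_of (range (to_ac \<circ> \<iota>)) L (map_prod to_ac to_ac ` A)"
  have one: "1 \<in> L" using cl(1)[of 1] by simp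
  have g_pow: "g ^ n \<in> L" for n
    using L(2) one by (induction n) (auto intro: cl)
  have horizontal: "\<gamma>L \<theta> * g = \<theta> g" if \<theta>: "\<theta> \<in> derivations (range (to_ac \<circ> \<iota>)) L" for \<theta>
  proof -
    define v where "v = of_nat n * (\<Sum>(a, b)\<in>A. to_ac a * \<theta> (to_ac b)) - to_ac (inverse \<phi>) * \<theta> (to_ac \<phi>)"
    have "v = 0"
    proof (rule ccontr)
      assume "v \<noteq> 0"
      then obtain f where f: "\<And>x y. f (x + y) = f x + f y" "\<And>a x. f (to_ac a * x) = a * f x" "f v = 1"
        using linear_functional_nonzero by metis
      have f_zero: "f 0 = 0" using f(1)[of 0 0] by simp
      have f_diff: "f (x - y) = f x - f y" for x y
        using f(1)[of "x - y" y] by (simp add: algebra_simps)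
      have f_sum: "f (sum u B) = (\<Sum>x\<in>B. f (u x))" for u and B :: "('K \<times> 'K) set"
        by (induction B rule: infinite_finite_induct) (auto simp: f f_zero)
      define \<delta> where "\<delta> = (\<lambda>a. f (\<theta> (to_ac a)))"
      have \<delta>: "\<delta> \<in> derivations (range \<iota>) UNIV"
        unfolding derivations_UNIV_iff
      proof (intro conjI allI ballI)
        show "\<delta> (a + b) = \<delta> a + \<delta> b" for a b
          using cl(1) by (simp add: \<delta>_def derivationsD(2)[OF \<theta>] f)
        show "\<delta> (a * b) = \<delta> a * b + a * \<delta> b" for a b
          using cl(1) f(2)[of b "\<theta> (to_ac a)"]
          by (simp add: \<delta>_def derivationsD(3)[OF \<theta>] f mult.commute)
        show "\<delta> c = 0" if "c \<in> range \<iota>" for c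
          using that derivationsD(4)[OF \<theta>, of "to_ac c"] f_zero by (auto simp: \<delta>_def)
      qed
      have "f v = of_nat n * (\<Sum>(a, b)\<in>A. a * \<delta> b) - inverse \<phi> * \<delta> \<phi>"
        using f(2)[of "of_nat n"] unfolding v_def f_diff
        by (simp only: f(2) to_ac_of_nat f_sum case_prod_unfold \<delta>_def)
      also have "\<dots> = of_nat n * \<gamma> \<delta> - dlog_K \<iota> \<phi> \<delta>"
        using \<delta> by (simp add: A form_of_def dlog_apply)
      also have "\<dots> = 0" using dlog by simp
      finally show False using f(3) by simp
    qed
    then have "of_nat n * \<gamma>L \<theta> = to_ac (inverse \<phi>) * \<theta> (g ^ n)"
      unfolding \<gamma>L_def form_of_to_ac[OF \<theta>] g by (simp add: v_def)
    also have "\<theta> (g ^ n) = of_nat n * g ^ (n - 1) * \<theta> g"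
      using derivationsD(3)[OF \<theta> one one] L(2) g_pow
      by (intro derivation_power[of L]) (auto simp: derivationsD(3)[OF \<theta>])
    also have "to_ac (inverse \<phi>) = inverse (g ^ n)"
      by (simp add: g)
    finally have "\<gamma>L \<theta> = inverse (g ^ n) * (g ^ (n - 1) * \<theta> g)"
      using assms(2) by (simp add: mult.left_commute mult.assoc)
    then show ?thesis
      using \<open>g \<noteq> 0\<close> assms(2) by (cases n) (auto simp: field_simps)
  qed
  define h where "h = (\<lambda>x. x * g)"
  have "bij_betw h L L"
  proof (rule bij_betw_byWitness[of _ "\<lambda>x. x * inverse g"])
    show "h ` L \<subseteq> L" "(\<lambda>x. x * inverse g) ` L \<subseteq> L"
      using L(2) by (auto simp: h_def intro!: cl)
  qed (use \<open>g \<noteq> 0\<close> in \<open>auto simp: h_def\<close>)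
  moreover have "h (connection \<gamma>L \<theta> x) = connection (\<lambda>\<theta>. 0) \<theta> (h x)"
    if "\<theta> \<in> derivations (range (to_ac \<circ> \<iota>)) L" "x \<in> L" for \<theta> x
    using horizontal[OF that(1)] derivationsD(3)[OF that L(2)]
    by (simp add: h_def connection_def algebra_simps)
  ultimately have "D_module_iso (range (to_ac \<circ> \<iota>)) L \<gamma>L (\<lambda>\<theta>. 0)"
    unfolding D_module_iso_def by (intro exI[of _ h]) (auto simp: h_def algebra_simps)
  then show ?thesis
    unfolding etale_trivial_def base_change_def using L(1) A \<gamma>L_def by blast
qed

section \<open>Noetherian subrings of a field\<close>

definition is_subring :: "'a::field set \<Rightarrow> bool" where
  "is_subring R \<longleftrightarrow> 1 \<in> R \<and> (\<forall>a\<in>R. \<forall>b\<in>R. a - b \<in> R \<and> a * b \<in> R)"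

definition is_ideal :: "'a::field set \<Rightarrow> 'a set \<Rightarrow> bool" where
  "is_ideal R J \<longleftrightarrow> J \<subseteq> R \<and> 0 \<in> J \<and> (\<forall>a\<in>J. \<forall>b\<in>J. a + b \<in> J) \<and> (\<forall>r\<in>R. \<forall>a\<in>J. r * a \<in> J)"

definition is_prime_ideal :: "'a::field set \<Rightarrow> 'a set \<Rightarrow> bool" where
  "is_prime_ideal R P \<longleftrightarrow> is_ideal R P \<and> 1 \<notin> P \<and> (\<forall>a\<in>R. \<forall>b\<in>R. a * b \<in> P \<longrightarrow> a \<in> P \<or> b \<in> P)"

definition noetherian :: "'a::field set \<Rightarrow> bool" where
  "noetherian R \<longleftrightarrow> (\<forall>f :: nat \<Rightarrow> 'a set. (\<forall>n. is_ideal R (f n) \<and> f n \<subseteq> f (Suc n)) \<longrightarrow> (\<exists>n. \<forall>m\<ge>n. f m = f n))"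

lemma subring_closed:
  assumes "is_subring R"
  shows "1 \<in> R" "0 \<in> R" "a \<in> R \<Longrightarrow> b \<in> R \<Longrightarrow> a - b \<in> R" "a \<in> R \<Longrightarrow> b \<in> R \<Longrightarrow> a * b \<in> R"
    "a \<in> R \<Longrightarrow> - a \<in> R" "a \<in> R \<Longrightarrow> b \<in> R \<Longrightarrow> a + b \<in> R"
proof -
  show one: "1 \<in> R" and diff: "a \<in> R \<Longrightarrow> b \<in> R \<Longrightarrow> a - b \<in> R"
    and "a \<in> R \<Longrightarrow> b \<in> R \<Longrightarrow> a * b \<in> R" for a b
    using assms by (auto simp: is_subring_def)
  show zero: "0 \<in> R" using diff[OF one one] by simp
  show minus: "a \<in> R \<Longrightarrow> - a \<in> R" for a using diff[OF zero, of a] by simp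
  show "a \<in> R \<Longrightarrow> b \<in> R \<Longrightarrow> a + b \<in> R" using diff[of a "- b"] minus by simp
qed

lemma subring_power: "is_subring R \<Longrightarrow> a \<in> R \<Longrightarrow> a ^ n \<in> R"
  by (induction n) (auto simp: subring_closed)

lemma subring_sum: "is_subring R \<Longrightarrow> (\<And>x. x \<in> A \<Longrightarrow> f x \<in> R) \<Longrightarrow> sum f A \<in> R"
  by (induction A rule: infinite_finite_induct) (auto simp: subring_closed)

lemma idealD:
  assumes "is_ideal R J"
  shows "a \<in> J \<Longrightarrow> a \<in> R" "0 \<in> J" "a \<in> J \<Longrightarrow> b \<in> J \<Longrightarrow> a + b \<in> J"
    "r \<in> R \<Longrightarrow> a \<in> J \<Longrightarrow> r * a \<in> J" "r \<in> R \<Longrightarrow> a \<in> J \<Longrightarrow> a * r \<in> J"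
  using assms by (auto simp: is_ideal_def mult.commute)

lemma ideal_minus: "is_subring R \<Longrightarrow> is_ideal R J \<Longrightarrow> a \<in> J \<Longrightarrow> - a \<in> J"
  using idealD(4)[of R J "- 1" a] subring_closed(1)[of R] subring_closed(5)[of R 1] by simp

lemma ideal_diff: "is_subring R \<Longrightarrow> is_ideal R J \<Longrightarrow> a \<in> J \<Longrightarrow> b \<in> J \<Longrightarrow> a - b \<in> J"
  using idealD(3)[of R J a "- b"] ideal_minus[of R J b] by simp

lemma principal_ideal: "is_subring R \<Longrightarrow> a \<in> R \<Longrightarrow> is_ideal R {r * a | r. r \<in> R}"
  unfolding is_ideal_def
  by (auto simp: subring_closed simp flip: distrib_right mult.assoc intro: exI[of _ 0])

lemma ideal_insert:
  assumes "is_subring R" "is_ideal R J" "a \<in> R"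
  shows "is_ideal R {j + r * a | j r. j \<in> J \<and> r \<in> R}" (is "is_ideal R ?I")
    "J \<subseteq> {j + r * a | j r. j \<in> J \<and> r \<in> R}" "a \<in> {j + r * a | j r. j \<in> J \<and> r \<in> R}"
proof -
  show "J \<subseteq> ?I" using subring_closed(2)[OF assms(1)] by force
  show "a \<in> ?I" using subring_closed(1)[OF assms(1)] idealD(2)[OF assms(2)] by force
  show "is_ideal R ?I"
    unfolding is_ideal_def
  proof (intro conjI ballI)
    show "?I \<subseteq> R" using assms by (auto simp: subring_closed idealD)
    show "0 \<in> ?I" using \<open>J \<subseteq> ?I\<close> idealD(2)[OF assms(2)] by blast
    fix x y assume "x \<in> ?I" "y \<in> ?I"
    then obtain j r j' r' where "j \<in> J" "j' \<in> J" "r \<in> R" "r' \<in> R" "x = j + r * a" "y = j' + r' * a"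
      by blast
    then have "x + y = (j + j') + (r + r') * a" "j + j' \<in> J" "r + r' \<in> R"
      using assms by (auto simp: algebra_simps subring_closed intro: idealD(3))
    then show "x + y \<in> ?I" by blast
  next
    fix s x assume "s \<in> R" "x \<in> ?I"
    then obtain j r where "j \<in> J" "r \<in> R" "x = j + r * a" by blast
    then have "s * x = s * j + (s * r) * a" "s * j \<in> J" "s * r \<in> R"
      using assms \<open>s \<in> R\<close> by (auto simp: algebra_simps subring_closed intro: idealD(4,5))
    then show "s * x \<in> ?I" by blast
  qed
qed

lemma noetherian_stable:
  fixes f :: "nat \<Rightarrow> 'a::field set"
  assumes "noetherian R" "\<And>n. is_ideal R (f n)" "\<And>n. f n \<subseteq> f (Suc n)"
  obtains n where "\<And>m. m \<ge> n \<Longrightarrow> f m = f n"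
  using assms unfolding noetherian_def by blast

lemma noetherian_maximal:
  assumes "noetherian R" "\<F> \<noteq> {}" "\<And>J. J \<in> \<F> \<Longrightarrow> is_ideal R J"
  obtains M where "M \<in> \<F>" "\<And>J. J \<in> \<F> \<Longrightarrow> M \<subseteq> J \<Longrightarrow> J = M"
proof -
  have "\<exists>M\<in>\<F>. \<forall>J\<in>\<F>. M \<subseteq> J \<longrightarrow> J = M"
  proof (rule ccontr)
    assume "\<not> ?thesis"
    then have step: "\<exists>J. J \<in> \<F> \<and> M \<subset> J" if "M \<in> \<F>" for M
      using that by (metis psubsetI)
    obtain J0 where "J0 \<in> \<F>" using assms(2) by blast
    then obtain f where f: "\<And>n::nat. f n \<in> \<F>" "\<And>n. f n \<subset> f (Suc n)"
      using dependent_nat_choice[of "\<lambda>_ J. J \<in> \<F>" "\<lambda>_ J J'. J \<subset> J'"] step by metis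
    then obtain n where "\<forall>m\<ge>n. f m = f n"
      using assms(1,3) unfolding noetherian_def by (metis psubset_imp_subset)
    then show False using f(2)[of n] by (metis le_SucI order_refl psubset_eq)
  qed
  with that show ?thesis by blast
qed

lemma noetherian_field:
  assumes "is_subring R" "\<And>a. a \<in> R \<Longrightarrow> inverse a \<in> R"
  shows "noetherian R"
  unfolding noetherian_def
proof (intro allI impI)
  fix f :: "nat \<Rightarrow> 'a set"
  assume f: "\<forall>n. is_ideal R (f n) \<and> f n \<subseteq> f (Suc n)"
  have trivial: "f n = {0} \<or> f n = R" for n
  proof (rule disjCI)
    assume "f n \<noteq> R"
    have J: "is_ideal R (f n)" using f by blast
    have "a = 0" if "a \<in> f n" for a
    proof (rule ccontr)
      assume "a \<noteq> 0"
      have "r \<in> f n" if "r \<in> R" for r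
      proof -
        have "r * inverse a \<in> R"
          using subring_closed(4)[OF assms(1)] that assms(2) idealD(1)[OF J \<open>a \<in> f n\<close>] by blast
        from idealD(4)[OF J this \<open>a \<in> f n\<close>] show ?thesis using \<open>a \<noteq> 0\<close> by (simp add: mult.assoc)
      qed
      then show False using \<open>f n \<noteq> R\<close> idealD(1)[OF J] by blast
    qed
    then show "f n = {0}" using idealD(2)[OF J] by blast
  qed
  have mono: "f m \<subseteq> f n" if "m \<le> n" for m n
    by (rule lift_Suc_mono_le[OF _ that]) (use f in blast)
  show "\<exists>n. \<forall>m\<ge>n. f m = f n"
  proof (cases "\<exists>n. f n = R")
    case True
    then obtain n where "f n = R" by blast
    then have "f m = f n" if "m \<ge> n" for m
      using mono[OF that] f by (auto simp: is_ideal_def)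
    then show ?thesis by blast
  next
    case False
    then show ?thesis using trivial by metis
  qed
qed

section \<open>Adjoining an element to a noetherian ring\<close>

definition adjoin :: "'a::field set \<Rightarrow> 'a \<Rightarrow> 'a set" where
  "adjoin R \<alpha> = {poly p \<alpha> | p. \<forall>i. coeff p i \<in> R}"

lemma adjoin_subring:
  assumes "is_subring R"
  shows "is_subring (adjoin R \<alpha>)" "R \<subseteq> adjoin R \<alpha>" "\<alpha> \<in> adjoin R \<alpha>"
proof -
  have const: "r \<in> adjoin R \<alpha>" if "r \<in> R" for r
    unfolding adjoin_def using that subring_closed(2)[OF assms]
    by (auto intro!: exI[of _ "[:r:]"] simp: coeff_pCons split: nat.split)
  then show "R \<subseteq> adjoin R \<alpha>" by blast
  show "\<alpha> \<in> adjoin R \<alpha>"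
    unfolding adjoin_def using subring_closed(1,2)[OF assms]
    by (auto intro!: exI[of _ "[:0, 1:]"] simp: coeff_pCons split: nat.split)
  show "is_subring (adjoin R \<alpha>)"
    unfolding is_subring_def
  proof (intro conjI ballI)
    show "1 \<in> adjoin R \<alpha>" using const subring_closed(1)[OF assms] by blast
    fix a b assume "a \<in> adjoin R \<alpha>" "b \<in> adjoin R \<alpha>"
    then obtain p q where "\<forall>i. coeff p i \<in> R" "\<forall>i. coeff q i \<in> R" "a = poly p \<alpha>" "b = poly q \<alpha>"
      by (auto simp: adjoin_def)
    then have "a - b = poly (p - q) \<alpha>" "\<forall>i. coeff (p - q) i \<in> R"
      "a * b = poly (p * q) \<alpha>" "\<forall>i. coeff (p * q) i \<in> R"
      using assms by (auto simp: subring_closed coeff_mult intro!: subring_sum)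
    then show "a - b \<in> adjoin R \<alpha>" "a * b \<in> adjoin R \<alpha>"
      unfolding adjoin_def by blast+
  qed
qed

lemma adjoin_least:
  assumes "is_subring S" "R \<subseteq> S" "\<alpha> \<in> S"
  shows "adjoin R \<alpha> \<subseteq> S"
  using assms
  by (auto simp: adjoin_def poly_altdef intro!: subring_sum subring_closed(4) subring_power)

text \<open>
  Hilbert's basis theorem.  An ideal \<open>J\<close> of \<open>R[\<alpha>]\<close> is controlled by the ideals \<open>lead d J\<close> of
  coefficients of \<open>x\<^sup>d\<close> in polynomials of degree at most \<open>d\<close> with value in \<open>J\<close>, which are monotone
  in both \<open>d\<close> and \<open>J\<close>; an ascending double sequence of ideals stabilises uniformly.
\<close>

lemma noetherian_adjoin:
  assumes R: "is_subring R" "noetherian R"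
  shows "noetherian (adjoin R \<alpha>)"
  unfolding noetherian_def
proof (intro allI impI)
  fix f :: "nat \<Rightarrow> 'a set"
  assume f: "\<forall>n. is_ideal (adjoin R \<alpha>) (f n) \<and> f n \<subseteq> f (Suc n)"
  note A = adjoin_subring[OF R(1), of \<alpha>]
  have id: "is_ideal (adjoin R \<alpha>) (f n)" for n using f by blast
  have mono: "f m \<subseteq> f n" if "m \<le> n" for m n
    by (rule lift_Suc_mono_le[OF _ that]) (use f in blast)
  define lead where "lead = (\<lambda>d n. {coeff p d | p. (\<forall>i. coeff p i \<in> R) \<and> degree p \<le> d \<and> poly p \<alpha> \<in> f n})"
  have lead_ideal: "is_ideal R (lead d n)" for d n
    unfolding is_ideal_def
  proof (intro conjI ballI)
    show "lead d n \<subseteq> R" by (auto simp: lead_def)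
    show "0 \<in> lead d n"
    proof -
      have "0 \<in> R" "0 \<in> f n" using subring_closed(2)[OF R(1)] idealD(2)[OF id] by blast+
      then show ?thesis
        unfolding lead_def by (intro CollectI exI[of _ "0 :: 'a poly"] conjI) auto
    qed
    fix a b assume "a \<in> lead d n" "b \<in> lead d n"
    then obtain p q where "\<forall>i. coeff p i \<in> R" "degree p \<le> d" "poly p \<alpha> \<in> f n" "a = coeff p d"
      "\<forall>i. coeff q i \<in> R" "degree q \<le> d" "poly q \<alpha> \<in> f n" "b = coeff q d"
      by (auto simp: lead_def)
    then have "a + b = coeff (p + q) d" "\<forall>i. coeff (p + q) i \<in> R" "degree (p + q) \<le> d"
      "poly (p + q) \<alpha> \<in> f n"
      by (simp_all add: idealD(3)[OF id] subring_closed[OF R(1)] degree_add_le)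
    then show "a + b \<in> lead d n" unfolding lead_def by blast
  next
    fix r a assume "r \<in> R" "a \<in> lead d n"
    then obtain p where "\<forall>i. coeff p i \<in> R" "degree p \<le> d" "poly p \<alpha> \<in> f n" "a = coeff p d"
      by (auto simp: lead_def)
    then have "r * a = coeff (smult r p) d" "\<forall>i. coeff (smult r p) i \<in> R" "degree (smult r p) \<le> d"
      "poly (smult r p) \<alpha> \<in> f n"
      using \<open>r \<in> R\<close> A(2)
      by (auto simp: idealD(4)[OF id] subring_closed[OF R(1)] intro: order.trans[OF degree_smult_le])
    then show "r * a \<in> lead d n" unfolding lead_def by blast
  qed
  have lead_mono2: "lead d m \<subseteq> lead d n" if "m \<le> n" for d m n
    using mono[OF that] by (auto simp: lead_def)
  have lead_Suc: "lead d n \<subseteq> lead (Suc d) n" for d n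
  proof
    fix a assume "a \<in> lead d n"
    then obtain p where p: "\<forall>i. coeff p i \<in> R" "degree p \<le> d" "poly p \<alpha> \<in> f n" "a = coeff p d"
      by (auto simp: lead_def)
    then have "a = coeff (pCons 0 p) (Suc d)" "\<forall>i. coeff (pCons 0 p) i \<in> R"
      "degree (pCons 0 p) \<le> Suc d" "poly (pCons 0 p) \<alpha> \<in> f n"
      by (auto simp: coeff_pCons degree_pCons_eq_if subring_closed(2)[OF R(1)] idealD(4)[OF id A(3)]
          split: nat.split)
    then show "a \<in> lead (Suc d) n" unfolding lead_def by blast
  qed
  have lead_mono: "lead d m \<subseteq> lead e n" if "d \<le> e" "m \<le> n" for d e m n
    using lift_Suc_mono_le[of "\<lambda>d. lead d m" d e] lead_Suc that lead_mono2 by blast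
  obtain N0 where N0: "\<And>n. n \<ge> N0 \<Longrightarrow> lead n n = lead N0 N0"
    using noetherian_stable[OF R(2), of "\<lambda>n. lead n n"] lead_ideal lead_mono by (metis lessI less_imp_le)
  have "\<exists>N. \<forall>n\<ge>N. lead d n = lead d N" for d
    using noetherian_stable[OF R(2), of "lead d"] lead_ideal lead_mono2 by (metis lessI less_imp_le)
  then obtain N1 where N1: "\<And>d n. n \<ge> N1 d \<Longrightarrow> lead d n = lead d (N1 d)" by metis
  \<comment> \<open>Beyond \<open>N0\<close> the diagonal sequence controls \<open>lead d\<close>
    for all larger d at once; only the finitely many d \<le> N0 need a bound of their own.\<close>
  define N where "N = Max (insert N0 (N1 ` {..N0}))"
  have N: "N0 \<le> N" "\<And>d. d \<le> N0 \<Longrightarrow> N1 d \<le> N" unfolding N_def by (intro Max_ge; simp)+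
  have stable: "lead d n = lead d N" if "n \<ge> N" for d n
  proof (cases "d \<le> N0")
    case True
    then show ?thesis using N1[of d n] N1[of d N] N(2)[of d] that by simp
  next
    case False
    \<comment> \<open>Both ideals are squeezed between two members of the diagonal, at N0 from below
      and at max d n from above, and these two members coincide.\<close>
    have "lead N0 N0 \<subseteq> lead d N" "lead d n \<subseteq> lead (max d n) (max d n)"
      using False N(1) lead_mono[of N0 d N0 N] lead_mono[of d "max d n" n "max d n"] by auto
    moreover have "lead (max d n) (max d n) = lead N0 N0"
      using False by (intro N0) auto
    ultimately show ?thesis using lead_mono2[OF that, of d] by blast
  qed
  have "f n \<subseteq> f N" if "n \<ge> N" for n
  proof
    fix x assume "x \<in> f n"
    then obtain p where "\<forall>i. coeff p i \<in> R" "poly p \<alpha> = x"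
      using idealD(1)[OF id] by (fastforce simp: adjoin_def)
    then show "x \<in> f N"
      using \<open>x \<in> f n\<close>
    proof (induction "degree p" arbitrary: p x rule: less_induct)
      case less
      have "coeff p (degree p) \<in> lead (degree p) n"
        using less.prems by (auto simp: lead_def)
      then have "coeff p (degree p) \<in> lead (degree p) N" using stable[OF that] by simp
      \<comment> \<open>The value of \<open>q\<close> is already in \<open>f N\<close> and its
        coefficient at the degree of \<open>p\<close> matches, so the induction hypothesis applies
        to \<open>p - q\<close>.\<close>
      then obtain q where q: "\<forall>i. coeff q i \<in> R" "degree q \<le> degree p" "poly q \<alpha> \<in> f N"
        "coeff p (degree p) = coeff q (degree p)"
        by (auto simp: lead_def)
      have "poly q \<alpha> \<in> f n" using q(3) mono[OF that] by blast
      then have diff: "poly (p - q) \<alpha> \<in> f n"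
        using ideal_diff[OF A(1) id] less.prems by auto
      have "poly (p - q) \<alpha> \<in> f N"
      proof (cases "p - q = 0")
        case True
        then show ?thesis using idealD(2)[OF id] by simp
      next
        case False
        have "degree (p - q) \<le> degree p" using q(2) by (intro degree_diff_le) auto
        moreover have "coeff (p - q) (degree p) = 0" using q(4) by simp
        ultimately have "degree (p - q) < degree p"
          using False by (metis le_neq_implies_less leading_coeff_0_iff)
        then show ?thesis
          using less.hyps[of "p - q" "poly (p - q) \<alpha>"] less.prems q(1) diff R(1)
          by (auto simp: subring_closed)
      qed
      then have "poly (p - q) \<alpha> + poly q \<alpha> \<in> f N" using q(3) idealD(3)[OF id] by blast
      then show ?case using less.prems by simp
    qed
  qed
  then show "\<exists>N. \<forall>n\<ge>N. f n = f N" using mono by blast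
qed

section \<open>Localisation and discrete valuations\<close>

definition local_at :: "'a::field set \<Rightarrow> 'a set \<Rightarrow> 'a set" where
  "local_at A p = {a / s | a s. a \<in> A \<and> s \<in> A - p}"

lemma prime_idealD:
  assumes "is_prime_ideal A p"
  shows "is_ideal A p" "1 \<notin> p" "a \<in> A \<Longrightarrow> b \<in> A \<Longrightarrow> a * b \<in> p \<Longrightarrow> a \<in> p \<or> b \<in> p"
  using assms by (auto simp: is_prime_ideal_def)

lemma prime_ideal_power:
  assumes "is_subring A" "is_prime_ideal A p" "a \<in> A" "a ^ n \<in> p"
  shows "a \<in> p"
  using assms(4) prime_idealD(2)[OF assms(2)]
  by (induction n) (auto dest!: prime_idealD(3)[OF assms(2,3) subring_power[OF assms(1,3)]])

lemma local_at_subring: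
  assumes A: "is_subring A" "is_prime_ideal A p"
  shows "is_subring (local_at A p)" "A \<subseteq> local_at A p"
proof -
  have p: "0 \<in> p" using idealD(2)[OF prime_idealD(1)[OF A(2)]] .
  have one: "1 \<in> A - p" using subring_closed(1)[OF A(1)] prime_idealD(2)[OF A(2)] by blast
  show sub: "A \<subseteq> local_at A p"
  proof
    fix a assume "a \<in> A"
    then have "a = a / 1 \<and> a \<in> A \<and> 1 \<in> A - p" using one by simp
    then show "a \<in> local_at A p" unfolding local_at_def by blast
  qed
  show "is_subring (local_at A p)"
    unfolding is_subring_def
  proof (intro conjI ballI)
    show "1 \<in> local_at A p" using one sub by blast
    fix x y assume "x \<in> local_at A p" "y \<in> local_at A p"
    then obtain a s b t where ab: "a \<in> A" "b \<in> A" "s \<in> A - p" "t \<in> A - p" "x = a / s" "y = b / t"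
      unfolding local_at_def by blast
    then have nz: "s \<noteq> 0" "t \<noteq> 0" using p by auto
    have st: "s * t \<in> A - p"
      using ab prime_idealD(3)[OF A(2)] subring_closed(4)[OF A(1)] by blast
    have "x - y = (a * t - b * s) / (s * t)" "a * t - b * s \<in> A"
      using ab nz by (auto simp: field_simps subring_closed[OF A(1)])
    then show "x - y \<in> local_at A p" using st unfolding local_at_def by blast
    have "x * y = (a * b) / (s * t)" "a * b \<in> A"
      using ab by (auto simp: subring_closed[OF A(1)])
    then show "x * y \<in> local_at A p" using st unfolding local_at_def by blast
  qed
qed

text \<open>An ideal of the localisation is recovered from its contraction to \<open>A\<close> by
  allowing denominators again, so an ascending chain becomes stationary together with its
  contractions.\<close>

lemma noetherian_local_at:
  assumes A: "is_subring A" "noetherian A" "is_prime_ideal A p"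
  shows "noetherian (local_at A p)"
  unfolding noetherian_def
proof (intro allI impI)
  let ?R = "local_at A p"
  fix f :: "nat \<Rightarrow> 'a set"
  assume f: "\<forall>n. is_ideal ?R (f n) \<and> f n \<subseteq> f (Suc n)"
  note R = local_at_subring[OF A(1,3)]
  have id: "is_ideal ?R (f n)" for n using f by blast
  have "is_ideal A (f n \<inter> A)" for n
    unfolding is_ideal_def
  proof (intro conjI ballI)
    show "0 \<in> f n \<inter> A" using idealD(2)[OF id] subring_closed(2)[OF A(1)] by blast
    show "a + b \<in> f n \<inter> A" if "a \<in> f n \<inter> A" "b \<in> f n \<inter> A" for a b
      using that idealD(3)[OF id] subring_closed(6)[OF A(1)] by blast
    show "r * a \<in> f n \<inter> A" if "r \<in> A" "a \<in> f n \<inter> A" for r a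
      using that idealD(4)[OF id] subring_closed(4)[OF A(1)] R(2) by blast
  qed blast
  moreover have "f n \<inter> A \<subseteq> f (Suc n) \<inter> A" for n using f by blast
  ultimately obtain n where n: "\<And>m. m \<ge> n \<Longrightarrow> f m \<inter> A = f n \<inter> A"
    using noetherian_stable[OF A(2), of "\<lambda>n. f n \<inter> A"] by metis
  have eq: "f m = {a / s | a s. a \<in> f m \<inter> A \<and> s \<in> A - p}" for m
  proof (intro equalityI subsetI)
    fix x assume "x \<in> f m"
    then obtain a s where x: "a \<in> A" "s \<in> A - p" "x = a / s"
      using idealD(1)[OF id] unfolding local_at_def by blast
    then have "s \<noteq> 0" using idealD(2)[OF prime_idealD(1)[OF A(3)]] by auto
    then have "a = s * x" using x by simp
    then have "a \<in> f m" using idealD(4)[OF id _ \<open>x \<in> f m\<close>] R(2) x by blast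
    then show "x \<in> {a / s | a s. a \<in> f m \<inter> A \<and> s \<in> A - p}" using x by blast
  next
    fix x assume "x \<in> {a / s | a s. a \<in> f m \<inter> A \<and> s \<in> A - p}"
    then obtain a s where x: "a \<in> f m" "s \<in> A - p" "x = (1 / s) * a" by auto
    then have "1 / s \<in> ?R" using subring_closed(1)[OF A(1)] unfolding local_at_def by blast
    then show "x \<in> f m" using idealD(4)[OF id] x by blast
  qed
  have "f m = f n" if "m \<ge> n" for m
    by (subst eq[of m], subst eq[of n]) (simp only: n[OF that])
  then show "\<exists>n. \<forall>m\<ge>n. f m = f n" by blast
qed

text \<open>
  If \<open>y J \<subseteq> J\<close> then all \<open>y\<^sup>i a\<close> lie in \<open>J\<close>, and \<open>y\<^sup>n a \<in> (a, y a, \<dots>, y\<^sup>n\<^sup>-\<^sup>1 a)\<close> for some \<open>n\<close> is an integral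
  equation for \<open>y\<close>.
\<close>

lemma stabilizer_integral:
  assumes R: "is_subring R" "noetherian R" "integrally_closed R"
    and J: "is_ideal R J" "a \<in> J" "a \<noteq> 0" "\<And>x. x \<in> J \<Longrightarrow> y * x \<in> J"
  shows "y \<in> R"
proof -
  define f where "f = (\<lambda>n. {\<Sum>i<n. c i * (y ^ i * a) | c :: nat \<Rightarrow> 'a. \<forall>i. c i \<in> R})"
  have ya: "y ^ i * a \<in> J" for i
    by (induction i) (use J in \<open>auto simp: mult.assoc\<close>)
  have f: "is_ideal R (f n)" for n
    unfolding is_ideal_def
  proof (intro conjI ballI)
    show "f n \<subseteq> R"
      by (auto simp: f_def intro!: subring_sum[OF R(1)] subring_closed(4)[OF R(1) _ idealD(1)[OF J(1) ya]])
    show "0 \<in> f n"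
      unfolding f_def using subring_closed(2)[OF R(1)] by (intro CollectI exI[of _ "\<lambda>_. 0"]) auto
    fix x z assume "x \<in> f n" "z \<in> f n"
    then obtain c d where "\<forall>i. c i \<in> R" "\<forall>i. d i \<in> R" "x = (\<Sum>i<n. c i * (y ^ i * a))" "z = (\<Sum>i<n. d i * (y ^ i * a))"
      unfolding f_def by blast
    then have "x + z = (\<Sum>i<n. (c i + d i) * (y ^ i * a))" "\<forall>i. c i + d i \<in> R"
      by (auto simp: sum.distrib distrib_right subring_closed[OF R(1)])
    then show "x + z \<in> f n"
      unfolding f_def by (intro CollectI exI[of _ "\<lambda>i. c i + d i"] conjI)
  next
    fix r x assume "r \<in> R" "x \<in> f n"
    then obtain c where "\<forall>i. c i \<in> R" "x = (\<Sum>i<n. c i * (y ^ i * a))"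
      unfolding f_def by blast
    then have "r * x = (\<Sum>i<n. (r * c i) * (y ^ i * a))" "\<forall>i. r * c i \<in> R"
      using \<open>r \<in> R\<close> by (auto simp: sum_distrib_left mult.assoc subring_closed[OF R(1)])
    then show "r * x \<in> f n"
      unfolding f_def by (intro CollectI exI[of _ "\<lambda>i. r * c i"] conjI)
  qed
  have f_Suc: "f n \<subseteq> f (Suc n)" for n
  proof
    fix x assume "x \<in> f n"
    then obtain c where "\<forall>i. c i \<in> R" "x = (\<Sum>i<n. c i * (y ^ i * a))"
      unfolding f_def by blast
    then have "x = (\<Sum>i<Suc n. (if i < n then c i else 0) * (y ^ i * a))" "\<forall>i. (if i < n then c i else 0) \<in> R"
      by (auto simp: subring_closed[OF R(1)])
    then show "x \<in> f (Suc n)"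
      unfolding f_def by (intro CollectI exI[of _ "\<lambda>i. if i < n then c i else 0"] conjI)
  qed
  obtain n where "f (Suc n) = f n"
    using noetherian_stable[of R f, OF R(2) f f_Suc] by (metis lessI less_imp_le)
  moreover have "y ^ n * a \<in> f (Suc n)"
    unfolding f_def using subring_closed(1,2)[OF R(1)]
    by (intro CollectI exI[of _ "\<lambda>i. if i = n then 1 else 0"] conjI) (auto simp: if_distrib[of "\<lambda>c. c * _"] cong: if_cong)
  ultimately obtain c where c: "\<forall>i. c i \<in> R" "y ^ n * a = (\<Sum>i<n. c i * (y ^ i * a))"
    unfolding f_def by blast
  then have "y ^ n * a = (\<Sum>i<n. c i * y ^ i) * a" by (simp add: sum_distrib_right mult.assoc)
  then have y: "y ^ n = (\<Sum>i<n. c i * y ^ i)" using J(3) by simp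
  define P where "P = monom 1 n - (\<Sum>i<n. monom (c i) i)"
  have coeff: "coeff P i = (if i = n then 1 else if i < n then - c i else 0)" for i
    unfolding P_def by (auto simp: coeff_sum)
  then have "degree P = n"
    by (intro antisym degree_le le_degree) auto
  then have "lead_coeff P = 1" by (simp add: coeff)
  moreover have "\<forall>i. coeff P i \<in> R"
    using c(1) by (simp add: coeff subring_closed[OF R(1)])
  moreover have "poly P y = 0"
    by (simp add: P_def poly_monom poly_sum y)
  ultimately show ?thesis using R(3) unfolding integrally_closed_def by blast
qed

section \<open>Discrete valuation rings\<close>

definition nonunits :: "'a::field set \<Rightarrow> 'a set" where
  "nonunits R = R - units_in R"

lemma units_in_mult: "is_subring R \<Longrightarrow> u \<in> units_in R \<Longrightarrow> v \<in> units_in R \<Longrightarrow> u * v \<in> units_in R"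
  by (auto simp: units_in_def subring_closed)

lemma units_in_inverse: "u \<in> units_in R \<Longrightarrow> inverse u \<in> units_in R"
  by (auto simp: units_in_def)

lemma units_in_one: "is_subring R \<Longrightarrow> 1 \<in> units_in R"
  by (auto simp: units_in_def subring_closed)

text \<open>With y = c/b the assumptions say that y is not in \<open>R\<close> while y M is
  contained in \<open>R\<close>, M being the ideal of nonunits. If y M were contained in M, y would
  be integral over \<open>R\<close>; so y m is a unit for some m in M. Scaling m by that unit gives
  t with y t = 1, and then x = t (y x) for every x in M.\<close>

lemma uniformizer_exists:
  assumes R: "is_subring R" "noetherian R" "integrally_closed R" and M: "is_ideal R (nonunits R)"
    and bc: "b \<in> R" "c \<in> R" "b \<noteq> 0" "\<And>r. r \<in> R \<Longrightarrow> c \<noteq> b * r" "\<And>m. m \<in> nonunits R \<Longrightarrow> \<exists>r\<in>R. m * c = b * r"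
  obtains t where "uniformizer R t"
proof -
  define y where "y = c / b"
  have y: "y \<notin> R" using bc(3) bc(4)[of "c / b"] by (auto simp: y_def)
  have yM: "y * m \<in> R" if "m \<in> nonunits R" for m
    using bc(5)[OF that] bc(3) by (auto simp: y_def field_simps)
  have "b \<in> nonunits R"
  proof (rule ccontr)
    assume "b \<notin> nonunits R"
    then have "inverse b * c \<in> R" using bc by (auto simp: nonunits_def units_in_def subring_closed[OF R(1)])
    then show False using bc(3) bc(4)[of "inverse b * c"] by simp
  qed
  then obtain m where m: "m \<in> nonunits R" "y * m \<notin> nonunits R"
    using stabilizer_integral[OF R M _ bc(3), of y] y by blast
  define u where "u = y * m"
  have u: "u \<in> units_in R" using yM[OF m(1)] m(2) by (simp add: nonunits_def u_def)
  define t where "t = inverse u * m"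
  have "u \<noteq> 0" "m \<noteq> 0" "y \<noteq> 0" using u by (auto simp: units_in_def u_def)
  have t: "t \<in> nonunits R"
    using units_in_inverse[OF u] m(1) idealD(4)[OF M] by (auto simp: t_def units_in_def)
  have yt: "y * t = 1" using \<open>m \<noteq> 0\<close> \<open>y \<noteq> 0\<close> by (simp add: t_def u_def field_simps)
  have "nonunits R = {t * r | r. r \<in> R}"
  proof (intro equalityI subsetI)
    fix x assume "x \<in> nonunits R"
    then have "x = t * (y * x)" "y * x \<in> R" using yt yM by (auto simp: mult.assoc[symmetric] mult.commute)
    then show "x \<in> {t * r | r. r \<in> R}" by blast
  qed (use idealD(5)[OF M _ t] in auto)
  moreover have "t \<in> R" "t \<noteq> 0" using t yt by (auto simp: nonunits_def)
  ultimately have "uniformizer R t" by (simp add: uniformizer_def nonunits_def)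
  then show ?thesis by (rule that)
qed

text \<open>The normal form is required for the whole ambient field, which thereby is the fraction
  field of \<open>R\<close>; it is what the description in \<open>valuation\<close> needs.\<close>

definition dvr :: "'a::field set \<Rightarrow> bool" where
  "dvr R \<longleftrightarrow> is_subring R \<and> (\<exists>t. uniformizer R t \<and> (\<forall>\<phi>. \<phi> \<noteq> 0 \<longrightarrow> (\<exists>(n::int) u. u \<in> units_in R \<and> \<phi> = u * t powi n)))"

lemma uniformizer_not_unit:
  assumes "is_subring R" "uniformizer R t"
  shows "t \<notin> units_in R"
proof -
  have "t \<in> {t * r | r. r \<in> R}" using subring_closed(1)[OF assms(1)] by force
  then show ?thesis using assms(2) by (auto simp: uniformizer_def)
qed

text \<open>If some element had no such form, choose one whose principal ideal is maximal. It is a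
  nonunit, hence equals t r, and r has no such form either. Maximality makes r a multiple of t r, so
  t would be a unit.\<close>

lemma uniformizer_factor:
  assumes R: "is_subring R" "noetherian R" "uniformizer R t" and a: "a \<in> R" "a \<noteq> 0"
  shows "\<exists>(n::nat) u. u \<in> units_in R \<and> a = u * t ^ n"
proof (rule ccontr)
  assume bad_a: "\<not> ?thesis"
  define bad where "bad = (\<lambda>a. a \<in> R \<and> a \<noteq> 0 \<and> (\<nexists>(n::nat) u. u \<in> units_in R \<and> a = u * t ^ n))"
  define \<F> where "\<F> = {{r * a | r. r \<in> R} | a. bad a}"
  have "\<F> \<noteq> {}" using a bad_a by (auto simp: \<F>_def bad_def)
  moreover have "is_ideal R J" if "J \<in> \<F>" for J
    using that principal_ideal[OF R(1)] by (auto simp: \<F>_def bad_def)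
  ultimately obtain M where M: "M \<in> \<F>" "\<And>J. J \<in> \<F> \<Longrightarrow> M \<subseteq> J \<Longrightarrow> J = M"
    using noetherian_maximal[OF R(2)] by metis
  then obtain x where x: "bad x" "M = {r * x | r. r \<in> R}" by (auto simp: \<F>_def)
  have "x \<notin> units_in R"
  proof
    assume "x \<in> units_in R"
    then have "x \<in> units_in R \<and> x = x * t ^ 0" by simp
    then show False using x(1) unfolding bad_def by blast
  qed
  then have "x \<in> R - units_in R" using x(1) by (simp add: bad_def)
  then obtain r where r: "r \<in> R" "x = t * r"
    using R(3) unfolding uniformizer_def by blast
  have "bad r"
    unfolding bad_def
  proof (intro conjI notI)
    show "r \<in> R" by fact
    show False if "r = 0" using that r x(1) by (simp add: bad_def)
    assume "\<exists>(n::nat) u. u \<in> units_in R \<and> r = u * t ^ n"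
    then obtain n u where "u \<in> units_in R" "r = u * t ^ n" by blast
    then have "u \<in> units_in R \<and> x = u * t ^ Suc n" using r by simp
    then show False using x(1) unfolding bad_def by blast
  qed
  then have J: "{s * r | s. s \<in> R} \<in> \<F>" unfolding \<F>_def by blast
  have t_R: "t \<in> R" using R(3) by (simp add: uniformizer_def)
  have "M \<subseteq> {s * r | s. s \<in> R}"
    unfolding x(2) r(2) using t_R by (force simp: mult.assoc[symmetric] intro: subring_closed(4)[OF R(1)])
  from M(2)[OF J this] have "r \<in> M"
    using subring_closed(1)[OF R(1)] by force
  then obtain s where "s \<in> R" "r = s * (t * r)" unfolding x(2) r(2) by blast
  then have "s * t = 1" using x(1) r(2) by (auto simp: bad_def)
  then have "inverse t = s" by (metis inverse_unique mult.commute)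
  then have "t \<in> units_in R"
    using R(3) \<open>s \<in> R\<close> by (auto simp: units_in_def uniformizer_def)
  then show False using uniformizer_not_unit[OF R(1,3)] by blast
qed

lemma dvrI:
  assumes R: "is_subring R" "noetherian R" "uniformizer R t"
    and frac: "\<And>z. \<exists>a\<in>R. \<exists>b\<in>R. b \<noteq> 0 \<and> z = a / b"
  shows "dvr R"
  unfolding dvr_def
proof (intro conjI exI[of _ t] allI impI)
  fix \<phi> :: 'a assume "\<phi> \<noteq> 0"
  then obtain a b where ab: "a \<in> R" "b \<in> R" "a \<noteq> 0" "b \<noteq> 0" "\<phi> = a / b"
    using frac[of \<phi>] by auto
  obtain n u where u: "u \<in> units_in R" "a = u * t ^ n"
    using uniformizer_factor[OF R ab(1,3)] by blast
  obtain m v where v: "v \<in> units_in R" "b = v * t ^ m"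
    using uniformizer_factor[OF R ab(2,4)] by blast
  have "t \<noteq> 0" using R(3) by (simp add: uniformizer_def)
  have "\<phi> = (u * inverse v) * t powi (int n - int m)"
    using \<open>t \<noteq> 0\<close> by (simp add: ab(5) u v power_int_diff field_simps)
  moreover have "u * inverse v \<in> units_in R"
    using u v units_in_mult[OF R(1)] units_in_inverse by blast
  ultimately show "\<exists>n u. u \<in> units_in R \<and> \<phi> = u * t powi n" by blast
qed (use R in auto)

lemma uniformizer_power_unit:
  assumes R: "is_subring R" "uniformizer R t" and "t powi n \<in> units_in R"
  shows "n = 0"
proof -
  have pos: "m = 0" if "t ^ m \<in> units_in R" for m
  proof (rule ccontr)
    assume "m \<noteq> 0"
    then obtain k where k: "m = Suc k" by (cases m) auto
    have tR: "t \<in> R" "t \<noteq> 0" using R(2) by (auto simp: uniformizer_def)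
    have "inverse t = t ^ k * inverse (t ^ m)" using tR k by (simp add: field_simps)
    also have "\<dots> \<in> R"
      using that subring_power[OF R(1) tR(1)] by (auto simp: units_in_def intro: subring_closed(4)[OF R(1)])
    finally have "t \<in> units_in R" using tR by (simp add: units_in_def)
    then show False using uniformizer_not_unit[OF R] by blast
  qed
  show ?thesis
  proof (cases "n \<ge> 0")
    case True
    then have "t powi n = t ^ nat n" by (simp add: power_int_def)
    then have "nat n = 0" using pos assms(3) by metis
    then show ?thesis using True by simp
  next
    case False
    then have "inverse (t powi n) = t ^ nat (- n)" by (simp add: power_int_def power_inverse)
    then have "nat (- n) = 0" using pos units_in_inverse[OF assms(3)] by metis
    then show ?thesis using False by simp
  qed
qed

lemma uniformizer_associated:
  assumes R: "is_subring R" "uniformizer R t" "uniformizer R t'"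
  shows "\<exists>w\<in>units_in R. t' = w * t"
proof -
  have nu: "x \<in> R - units_in R" if "uniformizer R x" for x
    using uniformizer_not_unit[OF R(1) that] that subring_closed(1)[OF R(1)] by (simp add: uniformizer_def)
  obtain r where r: "r \<in> R" "t' = t * r"
    using nu[OF R(3)] R(2) unfolding uniformizer_def by blast
  obtain s where s: "s \<in> R" "t = t' * s"
    using nu[OF R(2)] R(3) unfolding uniformizer_def by blast
  have "t \<noteq> 0" using R(2) by (simp add: uniformizer_def)
  moreover have "t = t * (r * s)" using r s by (metis mult.assoc)
  ultimately have "r * s = 1" by simp
  then have "r \<in> units_in R" using r s inverse_unique[of r s] by (auto simp: units_in_def)
  then show ?thesis using r(2) by (auto simp: mult.commute)
qed

lemma units_in_powi:
  assumes "is_subring R" "w \<in> units_in R"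
  shows "w powi n \<in> units_in R"
proof -
  have nat: "x ^ m \<in> units_in R" if "x \<in> units_in R" for x m
    using that by (induction m) (auto simp: units_in_one[OF assms(1)] units_in_mult[OF assms(1)])
  show ?thesis
    unfolding power_int_def using nat[OF assms(2)] nat[OF units_in_inverse[OF assms(2)]] by simp
qed

text \<open>\<open>valuation\<close> leaves the uniformizer free. Two uniformizers differ by a unit,
  and only the zeroth power of a uniformizer is a unit, so the exponent is the same for all of
  them.\<close>

lemma valuation_eqI:
  assumes "is_subring R" "uniformizer R t" "u \<in> units_in R" "\<phi> = u * t powi n"
  shows "valuation R \<phi> = n"
  unfolding valuation_def
proof (rule the_equality)
  show "\<exists>t u. uniformizer R t \<and> u \<in> units_in R \<and> \<phi> = u * t powi n" using assms by blast
  fix m assume "\<exists>t u. uniformizer R t \<and> u \<in> units_in R \<and> \<phi> = u * t powi m"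
  then obtain t' u' where t': "uniformizer R t'" "u' \<in> units_in R" "\<phi> = u' * t' powi m" by blast
  obtain w where w: "w \<in> units_in R" "t' = w * t"
    using uniformizer_associated[OF assms(1,2) t'(1)] by blast
  have nz: "t \<noteq> 0" "u \<noteq> 0" "u' \<noteq> 0" "w \<noteq> 0"
    using assms t' w by (auto simp: uniformizer_def units_in_def)
  have "u * t powi n = (u' * w powi m) * t powi m"
    using assms(4) t'(3) by (simp add: w power_int_mult_distrib mult.assoc)
  then have "t powi (n - m) = inverse u * (u' * w powi m)"
    using nz by (simp add: power_int_diff field_simps)
  also have "\<dots> \<in> units_in R"
    using assms t' w by (intro units_in_mult units_in_inverse units_in_powi)
  finally show "m = n" using uniformizer_power_unit[OF assms(1,2)] by fastforce
qed

lemma dvr_cases: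
  assumes "dvr R"
  obtains t where "is_subring R" "uniformizer R t" "t \<noteq> 0"
    "\<And>\<phi>. \<phi> \<noteq> 0 \<Longrightarrow> \<exists>u. u \<in> units_in R \<and> \<phi> = u * t powi (valuation R \<phi>)"
proof -
  obtain t where t: "is_subring R" "uniformizer R t"
    "\<And>\<phi>. \<phi> \<noteq> 0 \<Longrightarrow> \<exists>(n::int) u. u \<in> units_in R \<and> \<phi> = u * t powi n"
    using assms unfolding dvr_def by blast
  show ?thesis
  proof (rule that[OF t(1,2)])
    show "t \<noteq> 0" using t(2) by (simp add: uniformizer_def)
    fix \<phi> :: 'a assume "\<phi> \<noteq> 0"
    then obtain n u where u: "u \<in> units_in R" "\<phi> = u * t powi n" using t(3) by blast
    have "valuation R \<phi> = n" by (rule valuation_eqI[OF t(1,2) u])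
    then show "\<exists>u. u \<in> units_in R \<and> \<phi> = u * t powi (valuation R \<phi>)"
      using u by blast
  qed
qed

lemma valuation_mult:
  assumes "dvr R" "\<phi> \<noteq> 0" "\<psi> \<noteq> 0"
  shows "valuation R (\<phi> * \<psi>) = valuation R \<phi> + valuation R \<psi>"
proof -
  obtain t where t: "is_subring R" "uniformizer R t" "t \<noteq> 0"
    "\<And>\<phi>. \<phi> \<noteq> 0 \<Longrightarrow> \<exists>u. u \<in> units_in R \<and> \<phi> = u * t powi (valuation R \<phi>)"
    using dvr_cases[OF assms(1)] by metis
  define n m where "n = valuation R \<phi>" "m = valuation R \<psi>"
  obtain u v where "u \<in> units_in R" "\<phi> = u * t powi n" "v \<in> units_in R" "\<psi> = v * t powi m"
    using t(4) assms unfolding n_m_def by meson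
  then have "\<phi> * \<psi> = (u * v) * t powi (n + m)" "u * v \<in> units_in R"
    using t(3) units_in_mult[OF t(1)] by (auto simp: power_int_add)
  then show ?thesis unfolding n_m_def by (intro valuation_eqI[OF t(1,2)])
qed

lemma valuation_unit:
  assumes "dvr R" "u \<in> units_in R"
  shows "valuation R u = 0"
proof -
  obtain t where t: "is_subring R" "uniformizer R t" using dvr_cases[OF assms(1)] by metis
  show ?thesis by (rule valuation_eqI[OF t assms(2)]) simp
qed

lemma valuation_zero_imp_unit:
  assumes "dvr R" "\<phi> \<noteq> 0" "valuation R \<phi> = 0"
  shows "\<phi> \<in> units_in R"
  using dvr_cases[OF assms(1)] assms(2,3) by (metis mult.right_neutral power_int_0_right)

section \<open>Minimal primes and the Hartogs property\<close>

text \<open>Minimality is meant among the nonzero primes: in a domain these are the primes of height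
  one.\<close>

definition minimal_prime :: "'a::field set \<Rightarrow> 'a set \<Rightarrow> bool" where
  "minimal_prime A p \<longleftrightarrow> is_prime_ideal A p \<and> p \<noteq> {0} \<and> (\<forall>q. is_prime_ideal A q \<longrightarrow> q \<subseteq> p \<longrightarrow> q \<noteq> {0} \<longrightarrow> q = p)"

text \<open>
  By noetherian induction: if \<open>J\<close> is neither prime nor the whole ring, there is a product \<open>a b \<in> J\<close> with
  \<open>a, b \<notin> J\<close>, and a prime containing \<open>J\<close> contains \<open>J + (a)\<close> or \<open>J + (b)\<close>.
\<close>

lemma finite_primes_below:
  assumes A: "is_subring A" "noetherian A" and J: "is_ideal A J"
  shows "\<exists>P. finite P \<and> (\<forall>p\<in>P. is_prime_ideal A p \<and> J \<subseteq> p) \<and>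
    (\<forall>q. is_prime_ideal A q \<longrightarrow> J \<subseteq> q \<longrightarrow> (\<exists>p\<in>P. p \<subseteq> q))"
proof (rule ccontr)
  define good where "good = (\<lambda>J. \<exists>P. finite P \<and> (\<forall>p\<in>P. is_prime_ideal A p \<and> J \<subseteq> p) \<and>
    (\<forall>q. is_prime_ideal A q \<longrightarrow> J \<subseteq> q \<longrightarrow> (\<exists>p\<in>P. p \<subseteq> q)))"
  assume "\<not> ?thesis"
  then have "\<not> good J" by (simp add: good_def)
  then have "{J. is_ideal A J \<and> \<not> good J} \<noteq> {}" using J by blast
  then obtain M where M: "is_ideal A M" "\<not> good M"
    and max: "\<And>J. is_ideal A J \<Longrightarrow> M \<subseteq> J \<Longrightarrow> J \<noteq> M \<Longrightarrow> good J"
    by (rule noetherian_maximal[OF A(2)]) auto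
  have "\<not> is_prime_ideal A M"
    using M(2) unfolding good_def by (metis finite.emptyI finite_insert insertCI order_refl singletonD)
  have "1 \<notin> M"
  proof
    assume "1 \<in> M"
    then have "\<not> M \<subseteq> q" if "is_prime_ideal A q" for q
      using that by (auto simp: is_prime_ideal_def)
    then have "good M" unfolding good_def by (intro exI[of _ "{}"]) auto
    then show False using M(2) by blast
  qed
  then obtain a b where ab: "a \<in> A" "b \<in> A" "a * b \<in> M" "a \<notin> M" "b \<notin> M"
    using \<open>\<not> is_prime_ideal A M\<close> M(1) unfolding is_prime_ideal_def by blast
  define Ma where "Ma = {j + r * a | j r. j \<in> M \<and> r \<in> A}"
  define Mb where "Mb = {j + r * b | j r. j \<in> M \<and> r \<in> A}"
  have "good Ma" "good Mb"
    using ideal_insert[OF A(1) M(1) ab(1), folded Ma_def] ideal_insert[OF A(1) M(1) ab(2), folded Mb_def]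
      ab(4,5) max[of Ma] max[of Mb] by blast+
  obtain P where P: "finite P" "\<forall>p\<in>P. is_prime_ideal A p \<and> Ma \<subseteq> p"
      "\<And>q. is_prime_ideal A q \<Longrightarrow> Ma \<subseteq> q \<Longrightarrow> \<exists>p\<in>P. p \<subseteq> q"
    using \<open>good Ma\<close> unfolding good_def by blast
  obtain Q where Q: "finite Q" "\<forall>p\<in>Q. is_prime_ideal A p \<and> Mb \<subseteq> p"
      "\<And>q. is_prime_ideal A q \<Longrightarrow> Mb \<subseteq> q \<Longrightarrow> \<exists>p\<in>Q. p \<subseteq> q"
    using \<open>good Mb\<close> unfolding good_def by blast
  have sub: "M \<subseteq> Ma" "M \<subseteq> Mb"
    using ideal_insert(2)[OF A(1) M(1)] ab unfolding Ma_def Mb_def by blast+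
  have below: "\<exists>p\<in>P \<union> Q. p \<subseteq> q" if q: "is_prime_ideal A q" "M \<subseteq> q" for q
  proof -
    have id: "is_ideal A q" using prime_idealD(1)[OF q(1)] .
    have "a \<in> q \<or> b \<in> q" using prime_idealD(3)[OF q(1)] ab q(2) by blast
    then show ?thesis
    proof
      assume "a \<in> q"
      then have "Ma \<subseteq> q" using q(2) by (auto simp: Ma_def intro!: idealD(3,4)[OF id])
      then show ?thesis using P(3) q(1) by blast
    next
      assume "b \<in> q"
      then have "Mb \<subseteq> q" using q(2) by (auto simp: Mb_def intro!: idealD(3,4)[OF id])
      then show ?thesis using Q(3) q(1) by blast
    qed
  qed
  have "good M"
    unfolding good_def
  proof (intro exI[of _ "P \<union> Q"] conjI)
    show "finite (P \<union> Q)" using P(1) Q(1) by blast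
    show "\<forall>p\<in>P \<union> Q. is_prime_ideal A p \<and> M \<subseteq> p" using P(2) Q(2) sub by fast
  qed (use below in blast)
  then show False using M(2) by blast
qed

text \<open>Each such prime contains one of the finitely many primes supplied by
  \<open>finite_primes_below\<close> for the ideal generated by \<open>f\<close>. That prime
  contains \<open>f\<close>, so it is nonzero, and minimality identifies the two.\<close>

lemma finite_minimal_primes_containing:
  assumes A: "is_subring A" "noetherian A" and f: "f \<in> A" "f \<noteq> 0"
  shows "finite {p. minimal_prime A p \<and> f \<in> p}"
proof -
  define J where "J = {r * f | r. r \<in> A}"
  have "is_ideal A J" unfolding J_def by (rule principal_ideal[OF A(1) f(1)])
  from finite_primes_below[OF A this] obtain P where P: "finite P"
    "\<And>p. p \<in> P \<Longrightarrow> is_prime_ideal A p \<and> J \<subseteq> p" "\<And>q. is_prime_ideal A q \<Longrightarrow> J \<subseteq> q \<Longrightarrow> \<exists>p\<in>P. p \<subseteq> q"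
    by blast
  have "f \<in> J" using subring_closed(1)[OF A(1)] by (force simp: J_def)
  have "p \<in> P" if p: "minimal_prime A p" "f \<in> p" for p
  proof -
    have prime: "is_prime_ideal A p" using p(1) by (simp add: minimal_prime_def)
    have "J \<subseteq> p" unfolding J_def using idealD(4)[OF prime_idealD(1)[OF prime] _ p(2)] by blast
    then obtain q where "q \<in> P" "q \<subseteq> p" using P(3) prime by blast
    moreover have "q \<noteq> {0}" using P(2)[OF \<open>q \<in> P\<close>] \<open>f \<in> J\<close> f(2) by blast
    ultimately show ?thesis using p(1) P(2) unfolding minimal_prime_def by metis
  qed
  then have "{p. minimal_prime A p \<and> f \<in> p} \<subseteq> P" by blast
  then show ?thesis using P(1) by (rule finite_subset)
qed

text \<open>
  An associated prime: a colon ideal \<open>(b : r a)\<close>, maximal among the proper ones.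
\<close>

lemma colon_prime:
  assumes A: "is_subring A" "noetherian A" and ab: "a \<in> A" "b \<in> A" "\<forall>x\<in>A. a \<noteq> b * x"
  shows "\<exists>p r. is_prime_ideal A p \<and> b \<in> p \<and> r \<in> A \<and> (\<forall>x\<in>A. r * a \<noteq> b * x) \<and>
    p = {s \<in> A. \<exists>x\<in>A. s * (r * a) = b * x}"
proof -
  note cl = subring_closed[OF A(1)]
  define colon where "colon = (\<lambda>c. {s \<in> A. \<exists>x\<in>A. s * c = b * x})"
  define \<F> where "\<F> = {colon (r * a) | r. r \<in> A \<and> (\<forall>x\<in>A. r * a \<noteq> b * x)}"
  have ideal: "is_ideal A (colon c)" for c
    unfolding is_ideal_def
  proof (intro conjI ballI)
    show "colon c \<subseteq> A" by (auto simp: colon_def)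
    show "0 \<in> colon c" using cl(2) by (auto simp: colon_def intro!: bexI[of _ 0])
    show "s + t \<in> colon c" if "s \<in> colon c" "t \<in> colon c" for s t
    proof -
      obtain x y where "x \<in> A" "y \<in> A" "s * c = b * x" "t * c = b * y" "s \<in> A" "t \<in> A"
        using \<open>s \<in> colon c\<close> \<open>t \<in> colon c\<close> by (auto simp: colon_def)
      then have "(s + t) * c = b * (x + y)" "x + y \<in> A" "s + t \<in> A" by (auto simp: algebra_simps cl)
      then show ?thesis by (auto simp: colon_def)
    qed
    show "r * s \<in> colon c" if "r \<in> A" "s \<in> colon c" for r s
    proof -
      obtain x where "x \<in> A" "s * c = b * x" "s \<in> A"
        using \<open>s \<in> colon c\<close> by (auto simp: colon_def)
      then have "(r * s) * c = b * (r * x)" "r * x \<in> A" "r * s \<in> A"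
        using \<open>r \<in> A\<close> by (auto simp: algebra_simps cl)
      then show ?thesis unfolding colon_def by blast
    qed
  qed
  have "\<forall>x\<in>A. 1 * a \<noteq> b * x" using ab(3) by simp
  then have "colon (1 * a) \<in> \<F>" unfolding \<F>_def using cl(1) by blast
  then have "\<F> \<noteq> {}" by blast
  moreover have "is_ideal A J" if "J \<in> \<F>" for J using that ideal by (auto simp: \<F>_def)
  ultimately obtain M where M: "M \<in> \<F>" "\<And>J. J \<in> \<F> \<Longrightarrow> M \<subseteq> J \<Longrightarrow> J = M"
    using noetherian_maximal[OF A(2)] by metis
  then obtain r where r: "r \<in> A" "\<And>x. x \<in> A \<Longrightarrow> r * a \<noteq> b * x" "M = colon (r * a)"
    by (auto simp: \<F>_def)
  have "is_prime_ideal A M"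
    unfolding is_prime_ideal_def
  proof (intro conjI ballI impI)
    show "is_ideal A M" using ideal r(3) by blast
    show "1 \<notin> M" using r by (auto simp: colon_def)
    fix s t assume st: "s \<in> A" "t \<in> A" "s * t \<in> M"
    show "s \<in> M \<or> t \<in> M"
    proof (rule disjCI)
      assume "t \<notin> M"
      \<comment> \<open>Then t r a is not a multiple of b, so (b : t r a) belongs to the family. It
        contains M, hence equals M by maximality, and s lies in it.\<close>
      then have "(t * r) * a \<noteq> b * x" if "x \<in> A" for x
        using that st(2) unfolding r(3) colon_def by (auto simp: mult.assoc)
      then have "colon ((t * r) * a) \<in> \<F>" using st(2) r(1) cl(4) unfolding \<F>_def by blast
      moreover have "M \<subseteq> colon ((t * r) * a)"
      proof
        fix s' assume "s' \<in> M"
        then have "t * s' \<in> M" "s' \<in> A"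
          using idealD(1,4)[OF \<open>is_ideal A M\<close>] st(2) by blast+
        then show "s' \<in> colon ((t * r) * a)"
          unfolding r(3) colon_def by (auto simp: ac_simps)
      qed
      ultimately have "colon ((t * r) * a) = M" using M(2) by blast
      moreover have "s \<in> colon ((t * r) * a)"
        using st unfolding r(3) colon_def by (auto simp: ac_simps)
      ultimately show "s \<in> M" by blast
    qed
  qed
  moreover have "b \<in> M"
    unfolding r(3) colon_def using ab r(1) cl(4) by auto
  ultimately show ?thesis using r unfolding colon_def by blast
qed

section \<open>Maximal ideals of localisations and normality in height one\<close>

lemma local_at_nonunits:
  assumes A: "is_subring A" "is_prime_ideal A p"
  shows "nonunits (local_at A p) = {a / s | a s. a \<in> p \<and> s \<in> A - p}"
    "nonunits (local_at A p) \<inter> A = p"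
    "is_ideal (local_at A p) (nonunits (local_at A p))"
proof -
  let ?R = "local_at A p"
  note R = local_at_subring[OF A]
  note p = prime_idealD(1)[OF A(2)]
  have nz: "s \<noteq> 0" if "s \<in> A - p" for s using idealD(2)[OF p] that by auto
  have frac_mem: "a \<in> p" if "a / s \<in> nonunits ?R" "a \<in> A" "s \<in> A - p" for a s
  proof (rule ccontr)
    assume "a \<notin> p"
    then have "s / a \<in> ?R" using that unfolding local_at_def by blast
    then have "a / s \<in> units_in ?R"
      using that nz[of a] nz[OF that(3)] \<open>a \<notin> p\<close> by (auto simp: units_in_def nonunits_def)
    then show False using that(1) by (simp add: nonunits_def)
  qed
  have mem_nonunits: "a / s \<in> nonunits ?R" if "a \<in> p" "s \<in> A - p" for a s
  proof -
    have "a / s \<in> ?R" using that idealD(1)[OF p] unfolding local_at_def by blast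
    moreover have "a / s \<notin> units_in ?R"
    proof
      assume "a / s \<in> units_in ?R"
      then have "s / a \<in> ?R" "a \<noteq> 0" by (auto simp: units_in_def)
      then obtain b t where bt: "s / a = b / t" "b \<in> A" "t \<in> A - p"
        unfolding local_at_def by blast
      then have "s * t = b * a" using \<open>a \<noteq> 0\<close> nz[OF bt(3)] by (simp add: field_simps)
      then have "s * t \<in> p" using idealD(4)[OF p bt(2) that(1)] by simp
      then show False using prime_idealD(3)[OF A(2)] that(2) bt(3) by blast
    qed
    ultimately show ?thesis by (simp add: nonunits_def)
  qed
  show eq: "nonunits ?R = {a / s | a s. a \<in> p \<and> s \<in> A - p}"
  proof (intro equalityI subsetI)
    fix x assume x: "x \<in> nonunits ?R"
    then obtain a s where "x = a / s" "a \<in> A" "s \<in> A - p"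
      unfolding nonunits_def local_at_def by blast
    then show "x \<in> {a / s | a s. a \<in> p \<and> s \<in> A - p}" using frac_mem x by blast
  qed (use mem_nonunits in blast)
  have one: "1 \<in> A - p" using subring_closed(1)[OF A(1)] prime_idealD(2)[OF A(2)] by blast
  show "nonunits ?R \<inter> A = p"
    using frac_mem[of _ 1] mem_nonunits[OF _ one] one idealD(1)[OF p] by auto
  show "is_ideal ?R (nonunits ?R)"
    unfolding is_ideal_def
  proof (intro conjI ballI)
    show "nonunits ?R \<subseteq> ?R" by (auto simp: nonunits_def)
    show "0 \<in> nonunits ?R" using mem_nonunits[OF idealD(2)[OF p] one] by simp
    fix x y assume "x \<in> nonunits ?R" "y \<in> nonunits ?R"
    then obtain a s b t where ab: "x = a / s" "y = b / t" "a \<in> p" "b \<in> p" "s \<in> A - p" "t \<in> A - p"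
      unfolding eq by blast
    have st: "s * t \<in> A - p"
      using ab prime_idealD(3)[OF A(2)] subring_closed(4)[OF A(1)] by blast
    have "x + y = (a * t + b * s) / (s * t)"
      using ab nz[OF ab(5)] nz[OF ab(6)] by (simp add: field_simps)
    moreover have "a * t + b * s \<in> p" using ab by (auto intro!: idealD(3,5)[OF p])
    ultimately show "x + y \<in> nonunits ?R" using mem_nonunits st by metis
  next
    fix r x assume "r \<in> ?R" "x \<in> nonunits ?R"
    then obtain a s b t where ab: "r = a / s" "x = b / t" "a \<in> A" "b \<in> p" "s \<in> A - p" "t \<in> A - p"
      unfolding eq unfolding local_at_def by blast
    have st: "s * t \<in> A - p"
      using ab prime_idealD(3)[OF A(2)] subring_closed(4)[OF A(1)] by blast
    have "r * x = (a * b) / (s * t)" "a * b \<in> p" using ab idealD(4)[OF p] by auto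
    then show "r * x \<in> nonunits ?R" using mem_nonunits st by metis
  qed
qed

lemma prime_ideal_restrict:
  assumes "is_subring A" "A \<subseteq> R" "is_prime_ideal R q"
  shows "is_prime_ideal A (q \<inter> A)"
proof -
  note q = prime_idealD[OF assms(3)] and cl = subring_closed[OF assms(1)]
  note q_id = idealD[OF q(1)]
  show ?thesis
    unfolding is_prime_ideal_def is_ideal_def
  proof (intro conjI ballI impI)
    show "0 \<in> q \<inter> A" using q_id(2) cl(2) by blast
    show "a + b \<in> q \<inter> A" if "a \<in> q \<inter> A" "b \<in> q \<inter> A" for a b
      using that q_id(3) cl(6) by blast
    show "r * a \<in> q \<inter> A" if "r \<in> A" "a \<in> q \<inter> A" for r a
      using that q_id(4) cl(4) assms(2) by blast
    show "1 \<notin> q \<inter> A" using q(2) by blast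
    show "a \<in> q \<inter> A \<or> b \<in> q \<inter> A" if "a \<in> A" "b \<in> A" "a * b \<in> q \<inter> A" for a b
      using that q(3)[of a b] assms(2) by blast
  qed blast
qed

text \<open>To apply \<open>uniformizer_exists\<close>, the maximal ideal of the local ring R has to
  be a colon ideal (b : r). Pick a nonzero b in \<open>p\<close>. An associated prime of b R meets
  \<open>A\<close> in a nonzero prime inside \<open>p\<close>, hence in \<open>p\<close> itself, and
  therefore contains all nonunits of R.\<close>

lemma dvr_local_at_minimal_prime:
  assumes A: "is_subring A" "noetherian A" and p: "minimal_prime A p"
    and int: "integrally_closed (local_at A p)"
    and frac: "\<And>z. \<exists>a\<in>A. \<exists>b\<in>A. b \<noteq> 0 \<and> z = a / b"
  shows "dvr (local_at A p)"
proof -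
  let ?R = "local_at A p"
  have prime: "is_prime_ideal A p" using p by (simp add: minimal_prime_def)
  note R = local_at_subring[OF A(1) prime] and noeth = noetherian_local_at[OF A prime]
  note M = local_at_nonunits[OF A(1) prime]
  obtain b where b: "b \<in> p" "b \<noteq> 0"
    using p idealD(2)[OF prime_idealD(1)[OF prime]] unfolding minimal_prime_def by blast
  have bM: "b \<in> nonunits ?R" using b M(2) by blast
  then have bR: "b \<in> ?R" by (simp add: nonunits_def)
  have ne: "1 \<noteq> b * x" if "x \<in> ?R" for x
    using bM that inverse_unique[of b x] b by (auto simp: nonunits_def units_in_def)
  obtain q r where q: "is_prime_ideal ?R q" "b \<in> q" "r \<in> ?R" "\<And>x. x \<in> ?R \<Longrightarrow> r * 1 \<noteq> b * x"
    "q = {s \<in> ?R. \<exists>x\<in>?R. s * (r * 1) = b * x}"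
    using colon_prime[OF R(1) noeth subring_closed(1)[OF R(1)] bR] ne by blast
  have q_id: "is_ideal ?R q" using prime_idealD(1)[OF q(1)] .
  have "q \<subseteq> nonunits ?R"
  proof
    fix x assume x: "x \<in> q"
    have "x \<notin> units_in ?R"
    proof
      assume "x \<in> units_in ?R"
      then have "inverse x \<in> ?R" "x \<noteq> 0" by (auto simp: units_in_def)
      then have "inverse x * x \<in> q" "x \<noteq> 0" using idealD(4)[OF q_id _ x] by blast+
      then show False using prime_idealD(2)[OF q(1)] by simp
    qed
    then show "x \<in> nonunits ?R" using idealD(1)[OF q_id x] by (simp add: nonunits_def)
  qed
  have bA: "b \<in> A" using idealD(1)[OF prime_idealD(1)[OF prime]] b by blast
  have "q \<inter> A = p"
    using p prime_ideal_restrict[OF A(1) R(2) q(1)] \<open>q \<subseteq> nonunits ?R\<close> M(2) q(2) b bA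
    unfolding minimal_prime_def by blast
  have "nonunits ?R \<subseteq> q"
  proof
    fix x assume "x \<in> nonunits ?R"
    then obtain a s where x: "x = (1 / s) * a" "a \<in> p" "s \<in> A - p" unfolding M(1) by auto
    then have "1 / s \<in> ?R" using subring_closed(1)[OF A(1)] unfolding local_at_def by blast
    then show "x \<in> q" using idealD(4)[OF q_id] x \<open>q \<inter> A = p\<close> by blast
  qed
  then obtain t where "uniformizer ?R t"
    using uniformizer_exists[OF R(1) noeth int M(3) bR, of "r * 1"] q b by force
  then show ?thesis
    using frac R(2) by (intro dvrI[OF R(1) noeth]) blast+
qed

text \<open>
  If \<open>z \<notin> A\<close>, an associated prime \<open>p\<close> of the ideal of denominators of \<open>z\<close> has a principal maximal
  ideal in its local ring by normality, hence height one, and \<open>z\<close> is not regular at \<open>p\<close>.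
\<close>

lemma algebraic_hartogs:
  assumes A: "is_subring A" "noetherian A"
    and int: "\<And>p. is_prime_ideal A p \<Longrightarrow> integrally_closed (local_at A p)"
    and frac: "\<And>z. \<exists>a\<in>A. \<exists>b\<in>A. b \<noteq> 0 \<and> z = a / b"
    and z: "\<And>p. minimal_prime A p \<Longrightarrow> z \<in> local_at A p"
  shows "z \<in> A"
proof (rule ccontr)
  assume "z \<notin> A"
  obtain a b where ab: "a \<in> A" "b \<in> A" "b \<noteq> 0" "z = a / b" using frac by blast
  then have ne: "a \<noteq> b * x" if "x \<in> A" for x using \<open>z \<notin> A\<close> that by auto
  obtain p r where p: "is_prime_ideal A p" "b \<in> p" "r \<in> A" "\<And>x. x \<in> A \<Longrightarrow> r * a \<noteq> b * x"
    "p = {s \<in> A. \<exists>x\<in>A. s * (r * a) = b * x}"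
    using colon_prime[OF A ab(1,2)] ne by blast
  let ?R = "local_at A p"
  note cl = subring_closed[OF A(1)] and p_id = prime_idealD(1)[OF p(1)]
  note R = local_at_subring[OF A(1) p(1)] and noeth = noetherian_local_at[OF A p(1)]
  note M = local_at_nonunits[OF A(1) p(1)]
  have nz: "s \<noteq> 0" if "s \<in> A - p" for s using idealD(2)[OF p_id] that by auto
  \<comment> \<open>Localising does not turn r a into a multiple of b: a denominator outside
    \<open>p\<close> would itself lie in the colon ideal \<open>p\<close>.\<close>
  have not_mult: "r * a \<noteq> b * x" if xR: "x \<in> ?R" for x
  proof
    assume eq: "r * a = b * x"
    obtain c s where x: "x = c / s" "c \<in> A" "s \<in> A - p" using xR unfolding local_at_def by blast
    then have "s * (r * a) = b * c" using eq nz[OF x(3)] by (simp add: field_simps)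
    then have "s \<in> p" using x p(5) by blast
    then show False using x(3) by blast
  qed
  have "\<exists>x\<in>?R. m * (r * a) = b * x" if mR: "m \<in> nonunits ?R" for m
  proof -
    obtain c s where m: "m = c / s" "c \<in> p" "s \<in> A - p" using mR unfolding M(1) by blast
    obtain x where x: "x \<in> A" "c * (r * a) = b * x" using m(2) unfolding p(5) by blast
    have "x / s \<in> ?R" using x(1) m(3) unfolding local_at_def by blast
    moreover have "m * (r * a) = b * (x / s)" using m x(2) by (simp add: field_simps)
    ultimately show ?thesis by blast
  qed
  then obtain t where t: "uniformizer ?R t"
    using uniformizer_exists[OF R(1) noeth int[OF p(1)] M(3), of b "r * a"] not_mult R(2) ab p(3) cl(4)
    by (metis subsetD)
  \<comment> \<open>A nonzero e in q is a unit times t^n in the local ring, while every x in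
    \<open>p\<close> is a multiple of t there, so e divides x^n. Clearing the denominator puts s x^n
    into q with s outside \<open>p\<close>, hence outside q, and x lies in q.\<close>
  have "q = p" if q: "is_prime_ideal A q" "q \<subseteq> p" "q \<noteq> {0}" for q
  proof (rule antisym[OF q(2)], rule subsetI)
    note q_id = prime_idealD(1)[OF q(1)]
    fix x assume x: "x \<in> p"
    obtain e where e: "e \<in> q" "e \<noteq> 0" using q(3) idealD(2)[OF q_id] by blast
    then have "e \<in> ?R" using idealD(1)[OF q_id] R(2) by blast
    then obtain n u where u: "u \<in> units_in ?R" "e = u * t ^ n"
      using uniformizer_factor[OF R(1) noeth t _ e(2)] by blast
    have "x \<in> nonunits ?R" using x M(2) by blast
    then obtain w where w: "w \<in> ?R" "x = t * w"
      using t unfolding uniformizer_def nonunits_def by blast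
    have "u \<noteq> 0" using u(1) by (simp add: units_in_def)
    then have "x ^ n = e * (inverse u * w ^ n)"
      unfolding u(2) w(2) by (simp add: power_mult_distrib)
    moreover have "inverse u * w ^ n \<in> ?R"
      using u(1) subring_closed(4)[OF R(1)] subring_power[OF R(1) w(1)] by (simp add: units_in_def)
    moreover obtain c s where cs: "inverse u * w ^ n = c / s" "c \<in> A" "s \<in> A - p"
      using calculation(2) unfolding local_at_def by blast
    ultimately have "x ^ n = e * (c / s)" by simp
    then have "s * x ^ n = e * c" using nz[OF cs(3)] by simp
    moreover have xA: "x \<in> A" using x idealD(1)[OF p_id] by blast
    ultimately have "s * x ^ n \<in> q" using idealD(5)[OF q_id cs(2) e(1)] by simp
    then have "x ^ n \<in> q"
      using prime_idealD(3)[OF q(1), of s "x ^ n"] cs(3) q(2) subring_power[OF A(1) xA] by blast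
    then show "x \<in> q" using prime_ideal_power[OF A(1) q(1) xA] by blast
  qed
  moreover have "p \<noteq> {0}" using p(2) ab(3) by blast
  ultimately have "minimal_prime A p" using p(1) by (auto simp: minimal_prime_def)
  from z[OF this] have "r * z \<in> ?R" using R(2) p(3) subring_closed(4)[OF R(1)] by blast
  then show False using not_mult[of "r * z"] ab by simp
qed

section \<open>Homogeneous polynomials and evaluation\<close>

definition monomial_value :: "('i \<Rightarrow> 'a) \<Rightarrow> ('i::finite \<Rightarrow>\<^sub>0 nat) \<Rightarrow> 'a::comm_ring_1" where
  "monomial_value \<xi> m = (\<Prod>i\<in>UNIV. \<xi> i ^ Poly_Mapping.lookup m i)"

definition total_degree :: "('i::finite \<Rightarrow>\<^sub>0 nat) \<Rightarrow> nat" where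
  "total_degree m = (\<Sum>i\<in>UNIV. Poly_Mapping.lookup m i)"

lemma monomial_value_add: "monomial_value \<xi> (m + n) = monomial_value \<xi> m * monomial_value \<xi> n"
  by (simp add: monomial_value_def lookup_add power_add prod.distrib)

lemma monomial_value_0 [simp]: "monomial_value \<xi> 0 = 1"
  by (simp add: monomial_value_def)

lemma monomial_value_single: "monomial_value \<xi> (Poly_Mapping.single i d) = \<xi> i ^ d"
proof -
  have "monomial_value \<xi> (Poly_Mapping.single i d) = (\<Prod>j\<in>UNIV. if j = i then \<xi> j ^ d else 1)"
    unfolding monomial_value_def by (intro prod.cong) (auto simp: lookup_single when_def)
  then show ?thesis by simp
qed

lemma total_degree_add: "total_degree (m + n) = total_degree m + total_degree n"
  by (simp add: total_degree_def lookup_add sum.distrib)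

lemma total_degree_single: "total_degree (Poly_Mapping.single i d) = d"
proof -
  have "total_degree (Poly_Mapping.single i d) = (\<Sum>j\<in>UNIV. if j = i then d else 0)"
    unfolding total_degree_def by (intro sum.cong) (auto simp: lookup_single when_def)
  then show ?thesis by simp
qed

lemma poly_mapping_decompose:
  fixes F :: "'a \<Rightarrow>\<^sub>0 'b::comm_monoid_add"
  shows "F = (\<Sum>m\<in>Poly_Mapping.keys F. Poly_Mapping.single m (Poly_Mapping.lookup F m))"
proof (rule poly_mapping_eqI)
  fix k
  have "Poly_Mapping.lookup (\<Sum>m\<in>Poly_Mapping.keys F. Poly_Mapping.single m (Poly_Mapping.lookup F m)) k =
      (\<Sum>m\<in>Poly_Mapping.keys F. if m = k then Poly_Mapping.lookup F k else 0)"
    unfolding lookup_sum by (intro sum.cong) (auto simp: lookup_single when_def)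
  also have "\<dots> = Poly_Mapping.lookup F k"
    by (simp add: in_keys_iff)
  finally show "Poly_Mapping.lookup F k =
    Poly_Mapping.lookup (\<Sum>m\<in>Poly_Mapping.keys F. Poly_Mapping.single m (Poly_Mapping.lookup F m)) k" by simp
qed

text \<open>Used for \<iota> itself and for \<open>\<lambda>c. [:\<iota> c:]\<close> into the
  polynomials over the function field. The second target is not a field, hence the
  generality.\<close>

locale coeff_hom =
  fixes h :: "'k::comm_ring_1 \<Rightarrow> 'a::comm_ring_1"
  assumes h_add: "h (a + b) = h a + h b" and h_mult: "h (a * b) = h a * h b" and h_one: "h 1 = 1"
begin

lemma h_zero: "h 0 = 0"
  using h_add[of 0 0] by (metis add_0 add_cancel_left_left)

lemma eval_at_superset:
  assumes "finite S" "Poly_Mapping.keys F \<subseteq> S"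
  shows "eval_at h \<xi> F = (\<Sum>m\<in>S. h (Poly_Mapping.lookup F m) * monomial_value \<xi> m)"
  unfolding eval_at_def monomial_value_def
  using assms by (intro sum.mono_neutral_left) (auto simp: in_keys_iff h_zero)

lemma eval_at_add: "eval_at h \<xi> (F + G) = eval_at h \<xi> F + eval_at h \<xi> G"
  using keys_add[of F G]
  by (simp add: eval_at_superset[of "Poly_Mapping.keys F \<union> Poly_Mapping.keys G"] lookup_add h_add
      distrib_right sum.distrib)

lemma eval_at_single: "eval_at h \<xi> (Poly_Mapping.single m c) = h c * monomial_value \<xi> m"
  by (subst eval_at_superset[of "{m}"]) auto

lemma eval_at_0: "eval_at h \<xi> 0 = 0"
  by (simp add: eval_at_def)

lemma eval_at_sum: "eval_at h \<xi> (sum f S) = (\<Sum>x\<in>S. eval_at h \<xi> (f x))"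
  by (induction S rule: infinite_finite_induct) (auto simp: eval_at_0 eval_at_add)

lemma eval_at_1: "eval_at h \<xi> 1 = 1"
  using eval_at_single[of \<xi> 0 1] by (simp add: h_one)

lemma eval_at_monomials:
  "eval_at h \<xi> F = (\<Sum>m\<in>Poly_Mapping.keys F. h (Poly_Mapping.lookup F m) * monomial_value \<xi> m)"
  by (rule eval_at_superset) auto

lemma eval_at_mult: "eval_at h \<xi> (F * G) = eval_at h \<xi> F * eval_at h \<xi> G"
proof -
  let ?s = "\<lambda>F m. Poly_Mapping.single m (Poly_Mapping.lookup F m)"
  have "F * G = (\<Sum>m\<in>Poly_Mapping.keys F. ?s F m) * (\<Sum>n\<in>Poly_Mapping.keys G. ?s G n)"
    using poly_mapping_decompose[of F] poly_mapping_decompose[of G] by simp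
  also have "\<dots> = (\<Sum>m\<in>Poly_Mapping.keys F. \<Sum>n\<in>Poly_Mapping.keys G. ?s F m * ?s G n)"
    by (simp add: sum_product)
  finally have "eval_at h \<xi> (F * G) = (\<Sum>m\<in>Poly_Mapping.keys F. \<Sum>n\<in>Poly_Mapping.keys G.
      (h (Poly_Mapping.lookup F m) * monomial_value \<xi> m) * (h (Poly_Mapping.lookup G n) * monomial_value \<xi> n))"
    by (simp add: eval_at_sum mult_single eval_at_single h_mult monomial_value_add ac_simps)
  then show ?thesis by (simp add: eval_at_monomials sum_product)
qed

lemma eval_at_minus: "eval_at h \<xi> (- F) = - eval_at h \<xi> F"
  using eval_at_add[of \<xi> F "- F"] eval_at_0[of \<xi>] by (simp add: eq_neg_iff_add_eq_0 add.commute)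

lemma eval_at_diff: "eval_at h \<xi> (F - G) = eval_at h \<xi> F - eval_at h \<xi> G"
  using eval_at_add[of \<xi> F "- G"] by (simp add: eval_at_minus)

end

lemma homogeneous_iff: "homogeneous d F \<longleftrightarrow> (\<forall>m\<in>Poly_Mapping.keys F. total_degree m = d)"
  by (simp add: homogeneous_def total_degree_def)

lemma homogeneous_0: "homogeneous d 0"
  by (simp add: homogeneous_def)

lemma homogeneous_single: "total_degree m = d \<Longrightarrow> homogeneous d (Poly_Mapping.single m c)"
  by (auto simp: homogeneous_iff)

lemma homogeneous_1: "homogeneous 0 (1 :: ('i::finite, 'k::comm_ring_1) mpoly)"
  by (auto simp: homogeneous_iff total_degree_def)

lemma homogeneous_add: "homogeneous d F \<Longrightarrow> homogeneous d G \<Longrightarrow> homogeneous d (F + G)"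
  using keys_add[of F G] by (auto simp: homogeneous_iff)

lemma homogeneous_minus: "homogeneous d F \<Longrightarrow> homogeneous d (- F :: ('i::finite, 'k::comm_ring_1) mpoly)"
  by (auto simp: homogeneous_iff in_keys_iff)

lemma homogeneous_diff:
  "homogeneous d F \<Longrightarrow> homogeneous d G \<Longrightarrow> homogeneous d (F - G :: ('i::finite, 'k::comm_ring_1) mpoly)"
  using homogeneous_add[of d F "- G"] homogeneous_minus[of d G] by simp

lemma homogeneous_mult:
  "homogeneous d F \<Longrightarrow> homogeneous e G \<Longrightarrow> homogeneous (d + e) (F * G :: ('i::finite, 'k::comm_ring_1) mpoly)"
  using keys_mult[of F G] by (fastforce simp: homogeneous_iff total_degree_add)

lemma homogeneous_sum:
  "(\<And>x. x \<in> S \<Longrightarrow> homogeneous d (f x)) \<Longrightarrow> homogeneous d (sum f S :: ('i::finite, 'k::comm_ring_1) mpoly)"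
  by (induction S rule: infinite_finite_induct) (auto simp: homogeneous_0 homogeneous_add)

definition var_power :: "'i \<Rightarrow> nat \<Rightarrow> ('i::finite, 'k::comm_ring_1) mpoly" where
  "var_power i d = Poly_Mapping.single (Poly_Mapping.single i d) 1"

lemma homogeneous_var_power: "homogeneous d (var_power i d)"
  by (simp add: var_power_def homogeneous_single total_degree_single)

lemma var_power_0: "var_power i 0 = 1"
  by (simp add: var_power_def)

lemma var_power_Suc: "var_power i (Suc d) = var_power i 1 * var_power i d"
  by (simp add: var_power_def mult_single flip: single_add)

lemma (in coeff_hom) eval_at_var_power: "eval_at h \<xi> (var_power i d) = \<xi> i ^ d"
  by (simp add: var_power_def eval_at_single h_one monomial_value_single)

definition component :: "nat \<Rightarrow> ('i::finite, 'k::comm_ring_1) mpoly \<Rightarrow> ('i, 'k) mpoly" where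
  "component d F = (\<Sum>m\<in>{m \<in> Poly_Mapping.keys F. total_degree m = d}. Poly_Mapping.single m (Poly_Mapping.lookup F m))"

lemma homogeneous_component: "homogeneous d (component d F)"
  unfolding component_def by (intro homogeneous_sum homogeneous_single) auto

lemma sum_components: "F = (\<Sum>d\<in>total_degree ` Poly_Mapping.keys F. component d F)"
  unfolding component_def by (subst sum.image_gen[symmetric]) (auto simp: poly_mapping_decompose[symmetric])

section \<open>Ideals and prime ideals of a type regarded as a ring\<close>

lemma ideal_of_type_iff:
  fixes P :: "'a::comm_ring_1 set"
  shows "ideal P ring_of_type_algebra \<longleftrightarrow>
    0 \<in> P \<and> (\<forall>a\<in>P. \<forall>b\<in>P. a + b \<in> P) \<and> (\<forall>r. \<forall>a\<in>P. r * a \<in> P)"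
proof
  interpret R: cring "ring_of_type_algebra :: 'a ring" by rule
  note ops = ring_of_type_algebra_def
  {
    assume "ideal P ring_of_type_algebra"
    then interpret ideal P "ring_of_type_algebra :: 'a ring" .
    show "0 \<in> P \<and> (\<forall>a\<in>P. \<forall>b\<in>P. a + b \<in> P) \<and> (\<forall>r. \<forall>a\<in>P. r * a \<in> P)"
      using zero_closed a_closed I_l_closed by (simp add: ops)
  }
  assume P: "0 \<in> P \<and> (\<forall>a\<in>P. \<forall>b\<in>P. a + b \<in> P) \<and> (\<forall>r. \<forall>a\<in>P. r * a \<in> P)"
  have minus: "- a \<in> P" if "a \<in> P" for a using P that by (metis mult_minus1)
  have inv: "inv\<^bsub>add_monoid (ring_of_type_algebra :: 'a ring)\<^esub> a = - a" for a
    using R.minus_equality[of "- a" a] by (simp add: ops a_inv_def)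
  show "ideal P ring_of_type_algebra"
  proof (rule idealI)
    show "ring (ring_of_type_algebra :: 'a ring)" by rule
    show "subgroup P (add_monoid (ring_of_type_algebra :: 'a ring))"
    proof (rule subgroup.intro)
      show "inv\<^bsub>add_monoid (ring_of_type_algebra :: 'a ring)\<^esub> x \<in> P" if "x \<in> P" for x
        unfolding inv using minus[OF that] .
    qed (use P in \<open>auto simp: ops\<close>)
    fix a x :: 'a assume "a \<in> P"
    then show "x \<otimes>\<^bsub>ring_of_type_algebra\<^esub> a \<in> P" "a \<otimes>\<^bsub>ring_of_type_algebra\<^esub> x \<in> P"
      using P by (simp_all add: ops mult.commute[of a x])
  qed
qed

lemma primeideal_of_type_iff:
  fixes P :: "'a::comm_ring_1 set"
  shows "primeideal P ring_of_type_algebra \<longleftrightarrow>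
    ideal P ring_of_type_algebra \<and> 1 \<notin> P \<and> (\<forall>a b. a * b \<in> P \<longrightarrow> a \<in> P \<or> b \<in> P)"
proof -
  have cring: "cring (ring_of_type_algebra :: 'a ring)" by rule
  have "P = UNIV \<longleftrightarrow> 1 \<in> P" if "ideal P ring_of_type_algebra"
    using that unfolding ideal_of_type_iff by (metis UNIV_I UNIV_eq_I mult.right_neutral)
  then show ?thesis
    unfolding primeideal_def primeideal_axioms_def using cring by (auto simp: ring_of_type_algebra_def)
qed

lemma genideal_of_type_least:
  assumes "ideal J ring_of_type_algebra" "S \<subseteq> J"
  shows "genideal ring_of_type_algebra S \<subseteq> J"
  using assms by (auto simp: genideal_def)

lemma genideal_of_type_ideal:
  fixes S :: "'a::comm_ring_1 set"
  shows "ideal (genideal ring_of_type_algebra S) ring_of_type_algebra" "S \<subseteq> genideal ring_of_type_algebra S"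
proof -
  interpret R: cring "ring_of_type_algebra :: 'a ring" by rule
  show "ideal (genideal ring_of_type_algebra S) ring_of_type_algebra"
    by (rule R.genideal_ideal) (simp add: ring_of_type_algebra_def)
  show "S \<subseteq> genideal ring_of_type_algebra S"
    by (rule R.genideal_self) (simp add: ring_of_type_algebra_def)
qed

section \<open>Affine charts of a projective variety\<close>

text \<open>Gauss's lemma: the polynomials with coefficients in a prime \<open>q\<close> form a
  prime ideal. If \<open>i\<close> and \<open>k\<close> are the first indices with a coefficient
  outside \<open>q\<close>, then modulo \<open>q\<close> the coefficient of the product at i + k is
  the product of these two. It serves to show that homogenising a prime of a chart gives a
  prime.\<close>

lemma coefficients_prime:
  assumes A: "is_subring A" "is_prime_ideal A q"
    and p: "\<forall>i. coeff p i \<in> A" and r: "\<forall>i. coeff r i \<in> A" and pr: "\<forall>i. coeff (p * r) i \<in> q"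
  shows "(\<forall>i. coeff p i \<in> q) \<or> (\<forall>i. coeff r i \<in> q)"
proof (rule ccontr)
  note q = prime_idealD(1)[OF A(2)]
  assume "\<not> ?thesis"
  then have ex: "\<exists>i. coeff p i \<notin> q" "\<exists>k. coeff r k \<notin> q" by auto
  define i where "i = (LEAST i. coeff p i \<notin> q)"
  define k where "k = (LEAST k. coeff r k \<notin> q)"
  have i: "coeff p i \<notin> q" "\<And>l. l < i \<Longrightarrow> coeff p l \<in> q"
    unfolding i_def using LeastI_ex[OF ex(1)] not_less_Least by blast+
  have k: "coeff r k \<notin> q" "\<And>l. l < k \<Longrightarrow> coeff r l \<in> q"
    unfolding k_def using LeastI_ex[OF ex(2)] not_less_Least by blast+
  have q_sum: "sum f S \<in> q" if "\<And>x. x \<in> S \<Longrightarrow> f x \<in> q" for f and S :: "nat set"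
    using that by (induction S rule: infinite_finite_induct) (auto intro: idealD(2,3)[OF q])
  have "(\<Sum>l\<in>{..i + k} - {i}. coeff p l * coeff r (i + k - l)) \<in> q"
  proof (rule q_sum)
    fix l assume "l \<in> {..i + k} - {i}"
    then consider "l < i" | "i + k - l < k" by fastforce
    then show "coeff p l * coeff r (i + k - l) \<in> q"
      by cases (use i k p r idealD(4,5)[OF q] in blast)+
  qed
  moreover have "coeff (p * r) (i + k) =
      coeff p i * coeff r k + (\<Sum>l\<in>{..i + k} - {i}. coeff p l * coeff r (i + k - l))"
    unfolding coeff_mult by (subst sum.remove[of _ i]) auto
  ultimately have "coeff p i * coeff r k \<in> q"
    using pr ideal_diff[OF A(1) q] by (metis add_diff_cancel_right')
  then show False using prime_idealD(3)[OF A(2)] p r i(1) k(1) by blast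
qed

lemma subring_prod: "is_subring R \<Longrightarrow> (\<And>x. x \<in> S \<Longrightarrow> f x \<in> R) \<Longrightarrow> prod f S \<in> R"
  by (induction S rule: infinite_finite_induct) (auto simp: subring_closed)

locale variety =
  fixes I :: "('i::finite, 'k::field) mpoly set" and \<iota> :: "'k \<Rightarrow> 'K::field" and \<xi> :: "'i \<Rightarrow> 'K"
  assumes projective_variety: "projective_variety I" and function_field: "function_field I \<iota> \<xi>"
begin

sublocale field_embedding \<iota>
  using function_field by unfold_locales (simp add: function_field_def)

sublocale coeff_hom \<iota>
  by unfold_locales (simp_all add: map_add map_mult)

abbreviation ev :: "('i, 'k) mpoly \<Rightarrow> 'K" where "ev \<equiv> eval_at \<iota> \<xi>"

lemma mem_I_iff: "homogeneous d F \<Longrightarrow> F \<in> I \<longleftrightarrow> ev F = 0"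
  using function_field unfolding function_field_def by blast

lemma pointD:
  assumes "P \<in> points I"
  shows "ideal P ring_of_type_algebra" "0 \<in> P" "a \<in> P \<Longrightarrow> b \<in> P \<Longrightarrow> a + b \<in> P" "a \<in> P \<Longrightarrow> r * a \<in> P"
    "1 \<notin> P" "a * b \<in> P \<Longrightarrow> a \<in> P \<or> b \<in> P" "I \<subseteq> P"
proof -
  have "primeideal P ring_of_type_algebra" "I \<subseteq> P" using assms by (auto simp: points_def)
  then show "ideal P ring_of_type_algebra" "1 \<notin> P" "a * b \<in> P \<Longrightarrow> a \<in> P \<or> b \<in> P" "I \<subseteq> P"
    by (auto simp: primeideal_of_type_iff)
  then show "0 \<in> P" "a \<in> P \<Longrightarrow> b \<in> P \<Longrightarrow> a + b \<in> P" "a \<in> P \<Longrightarrow> r * a \<in> P"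
    by (auto simp: ideal_of_type_iff)
qed

lemma point_subset:
  assumes "P \<in> points I" "Q \<in> points I" "\<And>d F. homogeneous d F \<Longrightarrow> F \<in> P \<Longrightarrow> F \<in> Q"
  shows "P \<subseteq> Q"
proof -
  have "P = genideal ring_of_type_algebra {F \<in> P. \<exists>d. homogeneous d F}"
    using assms(1) by (simp add: points_def homogeneous_ideal_def)
  also have "\<dots> \<subseteq> Q"
    using assms by (intro genideal_of_type_least pointD(1)) auto
  finally show ?thesis .
qed

lemma I_point: "I \<in> points I"
  using projective_variety by (auto simp: projective_variety_def points_def)

definition in_chart :: "'i \<Rightarrow> ('i, 'k) mpoly set \<Rightarrow> bool" where
  "in_chart j P \<longleftrightarrow> var_power j 1 \<notin> P"

lemma point_in_chart: "P \<in> points I \<Longrightarrow> \<exists>j. in_chart j P"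
  by (simp add: points_def relevant_def in_chart_def var_power_def)

lemma in_chart_mono: "P \<subseteq> Q \<Longrightarrow> in_chart j Q \<Longrightarrow> in_chart j P"
  by (auto simp: in_chart_def)

lemma in_chart_I: "in_chart j I \<longleftrightarrow> \<xi> j \<noteq> 0"
  using mem_I_iff[OF homogeneous_var_power, of j 1] eval_at_var_power[of \<xi> j 1] by (simp add: in_chart_def)

lemma in_chart_nonzero: "P \<in> points I \<Longrightarrow> in_chart j P \<Longrightarrow> \<xi> j \<noteq> 0"
  using in_chart_mono[OF pointD(7)] in_chart_I by blast

lemma mult_var_power_mem:
  assumes "P \<in> points I" "in_chart j P" "var_power j d * F \<in> P"
  shows "F \<in> P"
  using assms(3)
proof (induction d)
  case (Suc d)
  then have "var_power j 1 * (var_power j d * F) \<in> P"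
    by (simp add: var_power_Suc[of j d] mult.assoc)
  then show ?case using Suc.IH pointD(6)[OF assms(1)] assms(2) by (auto simp: in_chart_def)
qed (simp add: var_power_0)

text \<open>For \<open>\<xi> j \<noteq> 0\<close> this is the coordinate ring of the affine open set
  where x_j does not vanish, realised inside the function field by dehomogenising.\<close>

definition chart :: "'i \<Rightarrow> 'K set" where
  "chart j = {ev F / \<xi> j ^ d | d F. homogeneous d F}"

definition chart_ideal :: "'i \<Rightarrow> ('i, 'k) mpoly set \<Rightarrow> 'K set" where
  "chart_ideal j P = {ev F / \<xi> j ^ d | d F. homogeneous d F \<and> F \<in> P}"

lemma chartI: "homogeneous d F \<Longrightarrow> ev F / \<xi> j ^ d \<in> chart j"
  unfolding chart_def by blast

lemma chart_subring:
  assumes "\<xi> j \<noteq> 0"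
  shows "is_subring (chart j)"
  unfolding is_subring_def
proof (intro conjI ballI)
  show "1 \<in> chart j" using chartI[OF homogeneous_1, of j] by (simp add: eval_at_1)
  fix a b assume "a \<in> chart j" "b \<in> chart j"
  then obtain d F e G where F: "homogeneous d F" "a = ev F / \<xi> j ^ d" and G: "homogeneous e G" "b = ev G / \<xi> j ^ e"
    unfolding chart_def by blast
  have "a - b = ev (F * var_power j e - var_power j d * G) / \<xi> j ^ (d + e)"
    using assms by (simp add: F G eval_at_diff eval_at_mult eval_at_var_power field_simps power_add)
  moreover have "homogeneous (d + e) (F * var_power j e - var_power j d * G)"
    by (intro homogeneous_diff homogeneous_mult homogeneous_var_power F G)
  ultimately show "a - b \<in> chart j" using chartI by simp
  have "a * b = ev (F * G) / \<xi> j ^ (d + e)"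
    using assms by (simp add: F G eval_at_mult power_add)
  then show "a * b \<in> chart j" using chartI[OF homogeneous_mult[OF F(1) G(1)]] by simp
qed

lemma constant_in_chart: "\<iota> c \<in> chart j"
  using chartI[OF homogeneous_single[of 0 0 c], of j] by (simp add: eval_at_single total_degree_def)

text \<open>The chart is generated over the constants by the quotients
  \<open>\<xi> i / \<xi> j\<close>, so the basis theorem is applied one coordinate at a time,
  starting from the field of constants. Keeping each intermediate ring inside \<open>chart j\<close>
  leaves only the inclusion of the chart in the last ring; there homogeneity distributes the
  denominator over the factors of each monomial.\<close>

lemma chart_noetherian:
  assumes "\<xi> j \<noteq> 0"
  shows "noetherian (chart j)"
proof -
  have "\<exists>R. is_subring R \<and> noetherian R \<and> range \<iota> \<subseteq> R \<and> R \<subseteq> chart j \<and> (\<forall>i\<in>S. \<xi> i / \<xi> j \<in> R)"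
    if "finite S" for S
    using that
  proof (induction S)
    case empty
    have "is_subring (range \<iota>)"
      unfolding is_subring_def using range_diff range_mult map_one by (metis rangeI)
    moreover have "noetherian (range \<iota>)"
    proof (rule noetherian_field[OF calculation])
      fix a assume "a \<in> range \<iota>"
      then show "inverse a \<in> range \<iota>" by (auto simp flip: map_inverse)
    qed
    ultimately show ?case using constant_in_chart by (intro exI[of _ "range \<iota>"]) auto
  next
    case (insert i S)
    then obtain R where R: "is_subring R" "noetherian R" "range \<iota> \<subseteq> R" "R \<subseteq> chart j" "\<forall>i\<in>S. \<xi> i / \<xi> j \<in> R"
      by blast
    have "\<xi> i / \<xi> j \<in> chart j"
      using chartI[OF homogeneous_var_power[of 1 i], of j] by (simp add: eval_at_var_power)
    then have "adjoin R (\<xi> i / \<xi> j) \<subseteq> chart j"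
      by (rule adjoin_least[OF chart_subring[OF assms] R(4)])
    then show ?case
      using adjoin_subring[OF R(1), of "\<xi> i / \<xi> j"] noetherian_adjoin[OF R(1,2), of "\<xi> i / \<xi> j"] R
      by (intro exI[of _ "adjoin R (\<xi> i / \<xi> j)"]) auto
  qed
  from this[of UNIV] obtain R where R: "is_subring R" "noetherian R" "range \<iota> \<subseteq> R" "R \<subseteq> chart j" "\<And>i. \<xi> i / \<xi> j \<in> R"
    by auto
  have "chart j \<subseteq> R"
  proof
    fix z assume "z \<in> chart j"
    then obtain d F where F: "homogeneous d F" "z = ev F / \<xi> j ^ d" unfolding chart_def by blast
    have mon: "monomial_value \<xi> m / \<xi> j ^ d = (\<Prod>i\<in>UNIV. (\<xi> i / \<xi> j) ^ Poly_Mapping.lookup m i)"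
      if "m \<in> Poly_Mapping.keys F" for m
    proof -
      have "d = (\<Sum>i\<in>UNIV. Poly_Mapping.lookup m i)"
        using F(1) that by (auto simp: homogeneous_def)
      then show ?thesis
        by (simp add: monomial_value_def power_sum power_divide prod_dividef)
    qed
    have "z = (\<Sum>m\<in>Poly_Mapping.keys F. \<iota> (Poly_Mapping.lookup F m) *
        (\<Prod>i\<in>UNIV. (\<xi> i / \<xi> j) ^ Poly_Mapping.lookup m i))"
      unfolding F(2) eval_at_monomials sum_divide_distrib
      by (intro sum.cong refl) (simp only: times_divide_eq_right[symmetric] mon)
    also have "\<dots> \<in> R"
      using R by (intro subring_sum subring_closed(4) subring_prod subring_power) auto
    finally show "z \<in> R" .
  qed
  then show ?thesis using R(2,4) by (metis subset_antisym)
qed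

lemma chart_fractions:
  assumes "\<xi> j \<noteq> 0"
  shows "\<exists>a\<in>chart j. \<exists>b\<in>chart j. b \<noteq> 0 \<and> z = a / b"
proof -
  obtain d F G where FG: "homogeneous d F" "homogeneous d G" "G \<notin> I" "z = ev F / ev G"
    using function_field unfolding function_field_def by blast
  then have "ev G \<noteq> 0" using mem_I_iff by blast
  then have "ev G / \<xi> j ^ d \<noteq> 0" "z = (ev F / \<xi> j ^ d) / (ev G / \<xi> j ^ d)"
    using assms FG(4) by auto
  then show ?thesis using chartI FG(1,2) by blast
qed

text \<open>A chart element has many representations. If F/x_j^d and G/x_j^e have the same value,
  then F x_j^e - x_j^d G vanishes at \<xi>, so it lies in \<open>I\<close> and hence in
  \<open>P\<close>; as x_j is not in the prime \<open>P\<close>, its power can be cancelled.\<close>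

lemma chart_ideal_mem_iff:
  assumes P: "P \<in> points I" "in_chart j P" and F: "homogeneous d F"
  shows "ev F / \<xi> j ^ d \<in> chart_ideal j P \<longleftrightarrow> F \<in> P"
proof
  assume "ev F / \<xi> j ^ d \<in> chart_ideal j P"
  then obtain e G where G: "homogeneous e G" "G \<in> P" "ev F / \<xi> j ^ d = ev G / \<xi> j ^ e"
    unfolding chart_ideal_def by blast
  let ?H = "F * var_power j e - var_power j d * G"
  have "ev ?H = 0"
    using G(3) in_chart_nonzero[OF P]
    by (simp add: eval_at_diff eval_at_mult eval_at_var_power field_simps)
  moreover have "homogeneous (d + e) ?H"
    by (intro homogeneous_diff homogeneous_mult homogeneous_var_power F G)
  ultimately have "?H \<in> P" using mem_I_iff pointD(7)[OF P(1)] by blast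
  then have "?H + var_power j d * G \<in> P"
    using pointD(3,4)[OF P(1)] G(2) by blast
  then have "var_power j e * F \<in> P" by (simp add: mult.commute)
  then show "F \<in> P" by (rule mult_var_power_mem[OF P])
qed (use F in \<open>auto simp: chart_ideal_def\<close>)

lemma chart_ideal_prime:
  assumes P: "P \<in> points I" "in_chart j P"
  shows "is_prime_ideal (chart j) (chart_ideal j P)"
proof -
  note nz = in_chart_nonzero[OF P] and mem = chart_ideal_mem_iff[OF P]
  have id: "is_ideal (chart j) (chart_ideal j P)"
    unfolding is_ideal_def
  proof (intro conjI ballI)
    show "chart_ideal j P \<subseteq> chart j" unfolding chart_ideal_def chart_def by blast
    show "0 \<in> chart_ideal j P"
      using mem[OF homogeneous_0, of 0] pointD(2)[OF P(1)] by (simp add: eval_at_0)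
    fix a b assume "a \<in> chart_ideal j P" "b \<in> chart_ideal j P"
    then obtain d F e G where F: "homogeneous d F" "F \<in> P" "a = ev F / \<xi> j ^ d"
      and G: "homogeneous e G" "G \<in> P" "b = ev G / \<xi> j ^ e"
      unfolding chart_ideal_def by blast
    let ?H = "var_power j e * F + var_power j d * G"
    have "a + b = ev ?H / \<xi> j ^ (d + e)"
      using nz by (simp add: F G eval_at_add eval_at_mult eval_at_var_power field_simps power_add)
    moreover have "homogeneous (e + d) (var_power j e * F)" "homogeneous (d + e) (var_power j d * G)"
      by (intro homogeneous_mult homogeneous_var_power F G)+
    then have "homogeneous (d + e) ?H" by (simp add: add.commute homogeneous_add)
    moreover have "?H \<in> P" using pointD(3,4)[OF P(1)] F G by blast
    ultimately show "a + b \<in> chart_ideal j P" using mem by simp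
  next
    fix r a assume "r \<in> chart j" "a \<in> chart_ideal j P"
    then obtain d F e G where F: "homogeneous d F" "r = ev F / \<xi> j ^ d"
      and G: "homogeneous e G" "G \<in> P" "a = ev G / \<xi> j ^ e"
      unfolding chart_def chart_ideal_def by blast
    have "r * a = ev (F * G) / \<xi> j ^ (d + e)"
      by (simp add: F G eval_at_mult power_add)
    then show "r * a \<in> chart_ideal j P"
      using mem[OF homogeneous_mult[OF F(1) G(1)]] pointD(4)[OF P(1) G(2)] by simp
  qed
  show ?thesis
    unfolding is_prime_ideal_def
  proof (intro conjI ballI impI id)
    show "1 \<notin> chart_ideal j P"
      using mem[OF homogeneous_1] pointD(5)[OF P(1)] by (simp add: eval_at_1)
    fix a b assume "a \<in> chart j" "b \<in> chart j" and ab: "a * b \<in> chart_ideal j P"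
    then obtain d F e G where F: "homogeneous d F" "a = ev F / \<xi> j ^ d" and G: "homogeneous e G" "b = ev G / \<xi> j ^ e"
      unfolding chart_def by blast
    have "a * b = ev (F * G) / \<xi> j ^ (d + e)"
      by (simp add: F G eval_at_mult power_add)
    then have "F * G \<in> P" using ab mem[OF homogeneous_mult[OF F(1) G(1)]] by simp
    then show "a \<in> chart_ideal j P \<or> b \<in> chart_ideal j P"
      using pointD(6)[OF P(1)] mem[OF F(1)] mem[OF G(1)] F G by blast
  qed
qed

text \<open>Numerator and denominator of equal degree d are both divided by the d-th power of
  \<open>\<xi> j\<close>. Conversely, multiplying crosswise by powers of x_j makes two degrees equal
  and keeps the denominator outside \<open>P\<close>.\<close>

lemma local_ring_eq:
  assumes P: "P \<in> points I" "in_chart j P"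
  shows "local_ring \<iota> \<xi> P = local_at (chart j) (chart_ideal j P)"
proof (intro equalityI subsetI)
  note nz = in_chart_nonzero[OF P] and mem = chart_ideal_mem_iff[OF P]
  {
    fix z assume "z \<in> local_ring \<iota> \<xi> P"
    then obtain d F G where FG: "homogeneous d F" "homogeneous d G" "G \<notin> P" "z = ev F / ev G"
      unfolding local_ring_def by blast
    have "z = (ev F / \<xi> j ^ d) / (ev G / \<xi> j ^ d)" using nz FG(4) by simp
    moreover have "ev G / \<xi> j ^ d \<in> chart j - chart_ideal j P"
      using mem[OF FG(2)] FG(3) chartI[OF FG(2)] by blast
    ultimately show "z \<in> local_at (chart j) (chart_ideal j P)"
      using chartI[OF FG(1)] unfolding local_at_def by blast
  next
    fix z assume "z \<in> local_at (chart j) (chart_ideal j P)"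
    then obtain a s where z: "z = a / s" "a \<in> chart j" "s \<in> chart j" "s \<notin> chart_ideal j P"
      unfolding local_at_def by blast
    then obtain d F e G where F: "homogeneous d F" "a = ev F / \<xi> j ^ d" and G: "homogeneous e G" "s = ev G / \<xi> j ^ e"
      unfolding chart_def by blast
    have "G \<notin> P" using mem[OF G(1)] G(2) z(4) by simp
    then have "var_power j d * G \<notin> P" using mult_var_power_mem[OF P] by blast
    moreover have "z = ev (F * var_power j e) / ev (var_power j d * G)"
      using nz by (simp add: z(1) F G eval_at_mult eval_at_var_power field_simps)
    moreover have "homogeneous (d + e) (F * var_power j e)" "homogeneous (d + e) (var_power j d * G)"
      by (intro homogeneous_mult homogeneous_var_power F G)+
    ultimately show "z \<in> local_ring \<iota> \<xi> P"
      unfolding local_ring_def by blast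
  }
qed

lemma chart_ideal_subset_iff:
  assumes P: "P \<in> points I" "in_chart j P" and Q: "Q \<in> points I" "in_chart j Q"
  shows "chart_ideal j P \<subseteq> chart_ideal j Q \<longleftrightarrow> P \<subseteq> Q"
proof
  assume "P \<subseteq> Q"
  then show "chart_ideal j P \<subseteq> chart_ideal j Q" unfolding chart_ideal_def by blast
next
  assume sub: "chart_ideal j P \<subseteq> chart_ideal j Q"
  show "P \<subseteq> Q"
  proof (rule point_subset[OF P(1) Q(1)])
    fix d F assume "homogeneous d F" "F \<in> P"
    then show "F \<in> Q" using chart_ideal_mem_iff[OF P] chart_ideal_mem_iff[OF Q] sub by blast
  qed
qed

lemma chart_ideal_I:
  assumes "\<xi> j \<noteq> 0"
  shows "chart_ideal j I = {0}"
proof -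
  have "ev F = 0" if "homogeneous d F" "F \<in> I" for d F using that mem_I_iff by blast
  then have "chart_ideal j I \<subseteq> {0}" unfolding chart_ideal_def by auto
  moreover have "0 \<in> chart_ideal j I"
    using chart_ideal_prime[OF I_point] in_chart_I assms by (auto simp: is_prime_ideal_def is_ideal_def)
  ultimately show ?thesis by blast
qed

text \<open>
  Dehomogenisation graded by powers of a variable \<open>t\<close>: the homogeneous part \<open>F\<^sub>d\<close> is sent to
  \<open>(F\<^sub>d(\<xi>) / \<xi>\<^sub>j\<^sup>d) t\<^sup>d\<close>.
\<close>

definition graded_eval :: "'i \<Rightarrow> ('i, 'k) mpoly \<Rightarrow> 'K poly" where
  "graded_eval j = eval_at (\<lambda>c. [:\<iota> c:]) (\<lambda>i. [:0, \<xi> i / \<xi> j:])"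

sublocale graded: coeff_hom "\<lambda>c. [:\<iota> c:]"
  by unfold_locales (simp_all add: map_add map_mult one_pCons)

lemma graded_eval_homogeneous:
  assumes F: "homogeneous d F"
  shows "graded_eval j F = monom (ev F / \<xi> j ^ d) d"
proof -
  have mon: "monomial_value (\<lambda>i. [:0, \<xi> i / \<xi> j:]) m = monom (monomial_value \<xi> m / \<xi> j ^ d) d"
    if "m \<in> Poly_Mapping.keys F" for m
  proof -
    have d: "d = (\<Sum>i\<in>UNIV. Poly_Mapping.lookup m i)"
      using F that by (auto simp: homogeneous_def)
    have "[:0, c:] ^ n = monom (c ^ n) n" for c :: 'K and n
    proof -
      have "[:0, c:] = monom c 1" by (simp add: monom_altdef)
      then show ?thesis by (simp add: monom_power)
    qed
    moreover have "(\<Prod>i\<in>S. monom (c i) (n i)) = monom (\<Prod>i\<in>S. c i) (\<Sum>i\<in>S. n i)"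
      for c :: "'i \<Rightarrow> 'K" and n S
      by (induction S rule: infinite_finite_induct) (auto simp: mult_monom)
    ultimately show ?thesis
      by (simp add: monomial_value_def d power_sum power_divide prod_dividef)
  qed
  have "graded_eval j F = (\<Sum>m\<in>Poly_Mapping.keys F. monom (\<iota> (Poly_Mapping.lookup F m) * monomial_value \<xi> m / \<xi> j ^ d) d)"
    unfolding graded_eval_def graded.eval_at_monomials
    by (intro sum.cong) (auto simp: mon smult_monom)
  also have "\<dots> = monom (ev F / \<xi> j ^ d) d"
    by (simp add: eval_at_monomials sum_divide_distrib monom_sum)
  finally show ?thesis .
qed

lemma coeff_graded_eval: "coeff (graded_eval j F) n = ev (component n F) / \<xi> j ^ n"
proof -
  have "graded_eval j F = (\<Sum>d\<in>total_degree ` Poly_Mapping.keys F. graded_eval j (component d F))"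
    by (subst sum_components[of F]) (simp add: graded_eval_def graded.eval_at_sum)
  also have "\<dots> = (\<Sum>d\<in>total_degree ` Poly_Mapping.keys F. monom (ev (component d F) / \<xi> j ^ d) d)"
    by (intro sum.cong graded_eval_homogeneous homogeneous_component) simp
  finally have "coeff (graded_eval j F) n =
      (\<Sum>d\<in>total_degree ` Poly_Mapping.keys F. if d = n then ev (component n F) / \<xi> j ^ n else 0)"
    by (simp add: coeff_sum if_distrib cong: if_cong)
  moreover have "component n F = 0" if "n \<notin> total_degree ` Poly_Mapping.keys F"
  proof -
    have "{m \<in> Poly_Mapping.keys F. total_degree m = n} = {}" using that by auto
    then show ?thesis by (simp only: component_def sum.empty)
  qed
  ultimately show ?thesis by (auto simp: eval_at_0)
qed

text \<open>For homogeneous F, membership in \<open>Q\<close> is dictated by the dehomogenisation;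
  for other F it is imposed on each homogeneous part. The variable of \<open>graded_eval\<close>
  keeps these parts apart: \<open>Q\<close> is the preimage of the polynomials with coefficients in
  \<open>q\<close>, which is prime by \<open>coefficients_prime\<close>, and it contains the
  homogeneous parts of its members.\<close>

lemma point_of_prime:
  assumes j: "\<xi> j \<noteq> 0" and q: "is_prime_ideal (chart j) q"
  obtains Q where "Q \<in> points I" "in_chart j Q" "chart_ideal j Q = q"
proof -
  note A = chart_subring[OF j] and q_id = prime_idealD(1)[OF q]
  define Q where "Q = {F. \<forall>n. coeff (graded_eval j F) n \<in> q}"
  have coeff_A: "coeff (graded_eval j F) n \<in> chart j" for F n
    unfolding coeff_graded_eval by (rule chartI[OF homogeneous_component])
  have hom: "F \<in> Q \<longleftrightarrow> ev F / \<xi> j ^ d \<in> q" if "homogeneous d F" for d F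
    using idealD(2)[OF q_id] by (auto simp: Q_def graded_eval_homogeneous[OF that])
  have q_sum: "sum f S \<in> q" if "\<And>x. x \<in> S \<Longrightarrow> f x \<in> q" for f and S :: "nat set"
    using that by (induction S rule: infinite_finite_induct) (auto intro: idealD(2,3)[OF q_id])
  have ideal: "ideal Q ring_of_type_algebra"
    unfolding ideal_of_type_iff
  proof (intro conjI ballI allI)
    show "0 \<in> Q" using idealD(2)[OF q_id] by (simp add: Q_def graded_eval_def graded.eval_at_0)
    show "a + b \<in> Q" if "a \<in> Q" "b \<in> Q" for a b
      using that idealD(3)[OF q_id] by (simp add: Q_def graded_eval_def graded.eval_at_add)
    show "r * a \<in> Q" if "a \<in> Q" for r a
    proof -
      have "coeff (graded_eval j r * graded_eval j a) n \<in> q" for n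
        unfolding coeff_mult using that coeff_A by (intro q_sum idealD(4)[OF q_id]) (auto simp: Q_def)
      then show ?thesis by (simp add: Q_def graded_eval_def graded.eval_at_mult)
    qed
  qed
  have one: "1 \<notin> Q"
    using hom[OF homogeneous_1] prime_idealD(2)[OF q] by (simp add: eval_at_1)
  have prime: "primeideal Q ring_of_type_algebra"
    unfolding primeideal_of_type_iff
  proof (intro conjI allI impI ideal one)
    fix a b assume "a * b \<in> Q"
    then have "\<forall>n. coeff (graded_eval j a * graded_eval j b) n \<in> q"
      by (simp add: Q_def graded_eval_def graded.eval_at_mult)
    then show "a \<in> Q \<or> b \<in> Q"
      using coefficients_prime[OF A q, of "graded_eval j a" "graded_eval j b"] coeff_A by (simp add: Q_def)
  qed
  have "Q = genideal ring_of_type_algebra {F \<in> Q. \<exists>d. homogeneous d F}" (is "Q = ?G")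
  proof (rule antisym)
    show "?G \<subseteq> Q" by (rule genideal_of_type_least[OF ideal]) auto
    show "Q \<subseteq> ?G"
    proof
      fix F assume F: "F \<in> Q"
      note G = genideal_of_type_ideal[of "{F \<in> Q. \<exists>d. homogeneous d F}"]
      have comp: "component d F \<in> ?G" for d
      proof -
        have "component d F \<in> Q"
          unfolding hom[OF homogeneous_component] coeff_graded_eval[symmetric] using F by (simp add: Q_def)
        then show ?thesis using homogeneous_component G(2) by blast
      qed
      have G_sum: "sum f S \<in> ?G" if "\<And>x. x \<in> S \<Longrightarrow> f x \<in> ?G" for f and S :: "nat set"
        using that G(1)[unfolded ideal_of_type_iff]
        by (induction S rule: infinite_finite_induct) auto
      have "(\<Sum>d\<in>total_degree ` Poly_Mapping.keys F. component d F) \<in> ?G" by (rule G_sum) (rule comp)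
      then show "F \<in> ?G" by (simp only: sum_components[symmetric])
    qed
  qed
  then have homid: "homogeneous_ideal Q" using ideal by (simp add: homogeneous_ideal_def)
  have var: "in_chart j Q"
    using hom[OF homogeneous_var_power, of j 1] prime_idealD(2)[OF q] j
    by (simp add: in_chart_def eval_at_var_power)
  then have rel: "relevant Q" by (auto simp: relevant_def in_chart_def var_power_def)
  have "I \<subseteq> Q"
  proof -
    have "I = genideal ring_of_type_algebra {F \<in> I. \<exists>d. homogeneous d F}"
      using I_point by (simp add: points_def homogeneous_ideal_def)
    also have "\<dots> \<subseteq> Q"
      using hom mem_I_iff idealD(2)[OF q_id] by (intro genideal_of_type_least ideal) auto
    finally show ?thesis .
  qed
  then have "Q \<in> points I" using prime homid rel by (simp add: points_def)
  moreover have "chart_ideal j Q = q"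
  proof (intro equalityI subsetI)
    fix z assume "z \<in> q"
    then obtain d F where "homogeneous d F" "z = ev F / \<xi> j ^ d"
      using idealD(1)[OF q_id] unfolding chart_def by blast
    then show "z \<in> chart_ideal j Q" using hom \<open>z \<in> q\<close> unfolding chart_ideal_def by blast
  qed (use hom in \<open>auto simp: chart_ideal_def\<close>)
  ultimately show ?thesis using that var by blast
qed

text \<open>Points of the chart and primes of its ring correspond with inclusions preserved, and
  \<open>I\<close> corresponds to the zero ideal. So a nonzero prime below would give a point
  strictly between \<open>I\<close> and \<open>P\<close>.\<close>

lemma height_one_minimal_prime:
  assumes P: "P \<in> height_one I" "in_chart j P"
  shows "minimal_prime (chart j) (chart_ideal j P)"
proof -
  have pt: "P \<in> points I" "P \<noteq> I" and min: "\<And>Q. Q \<in> points I \<Longrightarrow> Q \<subseteq> P \<Longrightarrow> Q = I \<or> Q = P"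
    using P(1) by (auto simp: height_one_def)
  note j = in_chart_nonzero[OF pt(1) P(2)]
  have I_chart: "in_chart j I" using j in_chart_I by blast
  show ?thesis
    unfolding minimal_prime_def
  proof (intro conjI allI impI)
    show "is_prime_ideal (chart j) (chart_ideal j P)" by (rule chart_ideal_prime[OF pt(1) P(2)])
    show "chart_ideal j P \<noteq> {0}"
      using chart_ideal_subset_iff[OF pt(1) P(2) I_point I_chart] chart_ideal_I[OF j] pt(2) pointD(7)[OF pt(1)]
      by blast
    fix q assume q: "is_prime_ideal (chart j) q" "q \<subseteq> chart_ideal j P" "q \<noteq> {0}"
    obtain Q where Q: "Q \<in> points I" "in_chart j Q" "chart_ideal j Q = q"
      by (rule point_of_prime[OF j q(1)])
    then have "Q \<subseteq> P" using chart_ideal_subset_iff[OF Q(1,2) pt(1) P(2)] q(2) by blast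
    then have "Q = I \<or> Q = P" using min Q(1) by blast
    then show "q = chart_ideal j P" using Q(3) q(3) chart_ideal_I[OF j] by blast
  qed
qed

text \<open>Height one concerns all points below \<open>Q\<close>, not only those of the chart; but
  a point contained in \<open>Q\<close> cannot contain x_j either, so it belongs to the same
  chart.\<close>

lemma minimal_prime_height_one:
  assumes j: "\<xi> j \<noteq> 0" and q: "minimal_prime (chart j) q"
  obtains Q where "Q \<in> height_one I" "in_chart j Q" "chart_ideal j Q = q"
proof -
  have prime: "is_prime_ideal (chart j) q" using q by (simp add: minimal_prime_def)
  obtain Q where Q: "Q \<in> points I" "in_chart j Q" "chart_ideal j Q = q"
    by (rule point_of_prime[OF j prime])
  have I_chart: "in_chart j I" using j in_chart_I by blast
  have "Q \<noteq> I" using Q(3) chart_ideal_I[OF j] q by (auto simp: minimal_prime_def)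
  moreover have "R = I \<or> R = Q" if R: "R \<in> points I" "R \<subseteq> Q" for R
  proof -
    have R_chart: "in_chart j R" using in_chart_mono[OF R(2) Q(2)] .
    have "chart_ideal j R \<subseteq> q" using chart_ideal_subset_iff[OF R(1) R_chart Q(1,2)] R(2) Q(3) by blast
    then have "chart_ideal j R = {0} \<or> chart_ideal j R = q"
      using q chart_ideal_prime[OF R(1) R_chart] unfolding minimal_prime_def by blast
    then show ?thesis
      using chart_ideal_subset_iff[OF R(1) R_chart I_point I_chart] chart_ideal_I[OF j] pointD(7)[OF R(1)]
        chart_ideal_subset_iff[OF Q(1,2) R(1) R_chart] Q(3) R(2) by blast
  qed
  ultimately show ?thesis using that Q by (auto simp: height_one_def)
qed

end

section \<open>Global functions and divisors of functions\<close>

context variety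
begin

definition form_values :: "nat \<Rightarrow> 'K set" where
  "form_values d = {ev F | F. homogeneous d F}"

lemma form_values_add: "a \<in> form_values d \<Longrightarrow> b \<in> form_values d \<Longrightarrow> a + b \<in> form_values d"
  unfolding form_values_def using eval_at_add homogeneous_add by (smt (verit, best) mem_Collect_eq)

lemma form_values_0: "0 \<in> form_values d"
  unfolding form_values_def using eval_at_0 homogeneous_0 by (metis (mono_tags, lifting) mem_Collect_eq)

lemma form_values_scale: "a \<in> form_values d \<Longrightarrow> \<iota> c * a \<in> form_values d"
proof -
  assume "a \<in> form_values d"
  then obtain F where F: "homogeneous d F" "a = ev F" unfolding form_values_def by blast
  have "homogeneous (0 + d) (Poly_Mapping.single 0 c * F)"
    by (intro homogeneous_mult homogeneous_single F) (simp add: total_degree_def)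
  moreover have "\<iota> c * a = ev (Poly_Mapping.single 0 c * F)"
    by (simp add: F eval_at_mult eval_at_single)
  ultimately show ?thesis unfolding form_values_def by auto
qed

lemma form_values_sum: "(\<And>x. x \<in> S \<Longrightarrow> f x \<in> form_values d) \<Longrightarrow> sum f S \<in> form_values d"
  by (induction S rule: infinite_finite_induct) (auto intro: form_values_0 form_values_add)

lemma finite_monomials_of_degree: "finite {m :: 'i \<Rightarrow>\<^sub>0 nat. total_degree m = d}"
proof (rule finite_imageD)
  have "Poly_Mapping.lookup m i \<le> total_degree m" for m and i :: 'i
    unfolding total_degree_def by (rule member_le_sum) auto
  then have "Poly_Mapping.lookup ` {m :: 'i \<Rightarrow>\<^sub>0 nat. total_degree m = d} \<subseteq> PiE UNIV (\<lambda>_. {..d})"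
    by auto
  then show "finite (Poly_Mapping.lookup ` {m :: 'i \<Rightarrow>\<^sub>0 nat. total_degree m = d})"
    by (rule finite_subset) (auto intro: finite_PiE)
  show "inj_on Poly_Mapping.lookup {m :: 'i \<Rightarrow>\<^sub>0 nat. total_degree m = d}"
    by (rule inj_onI) (simp only: poly_mapping_eq_iff)
qed

text \<open>
  In large degree \<open>d\<close> every monomial is divisible by a high power of some \<open>x\<^sub>j\<close>, so a global function
  \<open>z\<close> maps the values of forms of degree \<open>d\<close> to themselves.
\<close>

lemma global_function_acts:
  assumes z: "\<And>j. \<xi> j \<noteq> 0 \<Longrightarrow> z \<in> chart j"
  obtains d where "\<And>v. v \<in> form_values d \<Longrightarrow> z * v \<in> form_values d"
proof -
  have "\<exists>n F. \<xi> j \<noteq> 0 \<longrightarrow> homogeneous n F \<and> z = ev F / \<xi> j ^ n" for j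
    using z[of j] unfolding chart_def by blast
  then obtain n F where F: "\<And>j. \<xi> j \<noteq> 0 \<Longrightarrow> homogeneous (n j) (F j) \<and> z = ev (F j) / \<xi> j ^ n j"
    by metis
  \<comment> \<open>The sum bounds every \<open>n j\<close>, and \<open>Suc\<close> makes N
    positive, so that where \<open>\<xi> j = 0\<close> a monomial with exponent at least N in x_j
    has value 0. The degree is the number of variables times N because exponents that are all below
    N cannot add up to it.\<close>
  define N where "N = Suc (\<Sum>j\<in>UNIV. n j)"
  define d where "d = card (UNIV :: 'i set) * N"
  have n_le: "n j \<le> N" for j
    unfolding N_def using member_le_sum[of j UNIV n] by simp
  have mon: "z * monomial_value \<xi> m \<in> form_values d" if m: "total_degree m = d" for m
  proof -
    have "\<exists>j. N \<le> Poly_Mapping.lookup m j"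
    proof (rule ccontr)
      assume "\<not> ?thesis"
      then have "total_degree m < (\<Sum>j::'i\<in>UNIV. N)"
        unfolding total_degree_def by (intro sum_strict_mono) (auto simp: not_le)
      then show False using m by (simp add: d_def)
    qed
    then obtain j where j: "N \<le> Poly_Mapping.lookup m j" by blast
    show ?thesis
    proof (cases "\<xi> j = 0")
      case True
      have "Poly_Mapping.lookup m j \<noteq> 0" using j by (simp add: N_def)
      then have "\<xi> j ^ Poly_Mapping.lookup m j = 0" using True by simp
      then have "monomial_value \<xi> m = 0"
        unfolding monomial_value_def by (intro prod_zero) auto
      then show ?thesis using form_values_0 by simp
    next
      case False
      define m' where "m' = m - Poly_Mapping.single j (n j)"
      have m': "m = m' + Poly_Mapping.single j (n j)"
        using n_le[of j] j by (intro poly_mapping_eqI) (auto simp: m'_def lookup_add lookup_minus lookup_single when_def)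
      then have deg: "d = total_degree m' + n j"
        using m by (simp add: total_degree_add total_degree_single)
      have "z * monomial_value \<xi> m = ev (F j * Poly_Mapping.single m' 1)"
        using F[OF False] False
        by (simp add: m' monomial_value_add monomial_value_single eval_at_mult eval_at_single)
      moreover have "homogeneous (n j + total_degree m') (F j * Poly_Mapping.single m' 1)"
        using F[OF False] by (intro homogeneous_mult homogeneous_single) auto
      ultimately show ?thesis unfolding form_values_def by (auto simp: deg add.commute)
    qed
  qed
  have "z * v \<in> form_values d" if v: "v \<in> form_values d" for v
  proof -
    obtain G where G: "homogeneous d G" "v = ev G" using v unfolding form_values_def by blast
    have "z * v = (\<Sum>m\<in>Poly_Mapping.keys G. \<iota> (Poly_Mapping.lookup G m) * (z * monomial_value \<xi> m))"
      by (simp add: G(2) eval_at_monomials sum_distrib_left ac_simps)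
    also have "\<dots> \<in> form_values d"
      using G(1) by (intro form_values_sum form_values_scale mon) (auto simp: homogeneous_iff)
    finally show ?thesis .
  qed
  then show ?thesis by (rule that)
qed

end

section \<open>Global functions over an algebraically closed field\<close>

locale variety_alg_closed = variety I \<iota> \<xi>
  for I :: "('i::finite, 'k::alg_closed_field) mpoly set" and \<iota> :: "'k \<Rightarrow> 'K::field" and \<xi> :: "'i \<Rightarrow> 'K"
begin

text \<open>For a nonzero v among the values of forms, all z^n v lie in a space spanned by finitely
  many elements and hence satisfy a linear relation over the constants. Cancelling v leaves an
  algebraic equation for z over an algebraically closed field.\<close>

lemma global_function_constant:
  assumes z: "\<And>j. \<xi> j \<noteq> 0 \<Longrightarrow> z \<in> chart j"
  shows "z \<in> range \<iota>"
proof -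
  interpret vs: vector_space "\<lambda>c x. \<iota> c * x"
    by unfold_locales (simp_all add: algebra_simps map_add map_mult)
  obtain d where d: "\<And>v. v \<in> form_values d \<Longrightarrow> z * v \<in> form_values d"
    using global_function_acts[OF z] by blast
  define B where "B = monomial_value \<xi> ` {m. total_degree m = d}"
  have B: "finite B" unfolding B_def using finite_monomials_of_degree by blast
  have span: "form_values d \<subseteq> vs.span B"
  proof
    fix v assume "v \<in> form_values d"
    then obtain F where F: "homogeneous d F" "v = ev F" unfolding form_values_def by blast
    show "v \<in> vs.span B"
      unfolding F(2) eval_at_monomials using F(1)
      by (intro vs.span_sum vs.span_scale vs.span_base) (auto simp: B_def homogeneous_iff)
  qed
  obtain j where "in_chart j I" using point_in_chart[OF I_point] by blast
  then have j: "\<xi> j \<noteq> 0" using in_chart_I by blast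
  define v where "v = \<xi> j ^ d"
  have "v \<noteq> 0" using j by (simp add: v_def)
  have "v \<in> form_values d"
    unfolding form_values_def v_def using homogeneous_var_power[of d j] eval_at_var_power[of \<xi> j d] by force
  then have zv: "z ^ n * v \<in> form_values d" for n
    by (induction n) (auto simp: mult.assoc d)
  define S where "S = (\<lambda>n. z ^ n * v) ` {..card B}"
  have "\<exists>p. p \<noteq> 0 \<and> poly (map_poly \<iota> p) z = 0"
  \<comment> \<open>The vectors are collected in a set, whose size gives dependence only if they are
    distinct. If two of them coincide, z^a = z^b is already an equation.\<close>
  proof (cases "inj_on (\<lambda>n. z ^ n * v) {..card B}")
    case False
    then obtain a b where ab: "a \<noteq> b" "z ^ a = z ^ b"
      using \<open>v \<noteq> 0\<close> by (auto simp: inj_on_def)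
    define p where "p = monom (1 :: 'k) a - monom 1 b"
    have "coeff p a = 1" using ab(1) by (simp add: p_def)
    then have "p \<noteq> 0" by auto
    moreover have "map_poly \<iota> p = monom 1 a - monom 1 b"
      by (intro poly_eqI) (simp add: p_def coeff_map_poly map_diff)
    then have "poly (map_poly \<iota> p) z = 0" using ab(2) by (simp add: poly_monom)
    ultimately show ?thesis by blast
  next
    case True
    then have "card S = Suc (card B)" by (simp add: S_def card_image)
    moreover have "S \<subseteq> vs.span B" using zv span by (auto simp: S_def)
    ultimately have "vs.dependent S"
      using vs.independent_span_bound[OF B, of S] by auto
    then obtain u w where u: "w \<in> S" "u w \<noteq> 0" "(\<Sum>x\<in>S. \<iota> (u x) * x) = 0"
      using vs.dependent_finite[of S] by (auto simp: S_def)
    define p where "p = (\<Sum>n\<le>card B. monom (u (z ^ n * v)) n)"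
    have coeff: "coeff p n = (if n \<le> card B then u (z ^ n * v) else 0)" for n
      by (simp add: p_def coeff_sum)
    obtain n where "n \<le> card B" "w = z ^ n * v" using u(1) by (auto simp: S_def)
    then have "coeff p n \<noteq> 0" using u(2) by (simp add: coeff)
    then have "p \<noteq> 0" by auto
    have "map_poly \<iota> p = (\<Sum>n\<le>card B. monom (\<iota> (u (z ^ n * v))) n)"
      by (intro poly_eqI) (simp add: coeff_map_poly coeff coeff_sum)
    then have "poly (map_poly \<iota> p) z * v = (\<Sum>n\<le>card B. \<iota> (u (z ^ n * v)) * (z ^ n * v))"
      by (simp add: poly_sum poly_monom sum_distrib_right mult.assoc)
    also have "\<dots> = 0"
      using u(3) True by (simp add: S_def sum.reindex)
    finally show ?thesis using \<open>p \<noteq> 0\<close> \<open>v \<noteq> 0\<close> by auto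
  qed
  then show ?thesis
    using algebraic_over_alg_closed[OF field_embedding_axioms] by blast
qed

end

section \<open>Valuations and divisors on a normal projective variety\<close>

locale normal_projective = variety_alg_closed I \<iota> \<xi>
  for I :: "('i::finite, 'k::alg_closed_field) mpoly set" and \<iota> :: "'k \<Rightarrow> 'K::field" and \<xi> :: "'i \<Rightarrow> 'K" +
  assumes normal: "normal_variety I \<iota> \<xi>"
begin

lemma height_one_point: "P \<in> height_one I \<Longrightarrow> P \<in> points I"
  by (simp add: height_one_def)

lemma chart_local_integrally_closed:
  assumes "\<xi> j \<noteq> 0" "is_prime_ideal (chart j) p"
  shows "integrally_closed (local_at (chart j) p)"
proof -
  obtain Q where Q: "Q \<in> points I" "in_chart j Q" "chart_ideal j Q = p"
    by (rule point_of_prime[OF assms])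
  then show ?thesis using normal local_ring_eq[OF Q(1,2)] unfolding normal_variety_def by metis
qed

lemma dvr_height_one:
  assumes P: "P \<in> height_one I"
  shows "dvr (local_ring \<iota> \<xi> P)"
proof -
  obtain j where j: "in_chart j P" using point_in_chart height_one_point[OF P] by blast
  note pt = height_one_point[OF P] and nz = in_chart_nonzero[OF height_one_point[OF P] j]
  have min: "minimal_prime (chart j) (chart_ideal j P)" by (rule height_one_minimal_prime[OF P j])
  then have "integrally_closed (local_at (chart j) (chart_ideal j P))"
    using chart_local_integrally_closed[OF nz] by (simp add: minimal_prime_def)
  then show ?thesis
    unfolding local_ring_eq[OF pt j]
    by (rule dvr_local_at_minimal_prime[OF chart_subring[OF nz] chart_noetherian[OF nz] min _ chart_fractions[OF nz]])
qed

abbreviation val :: "('i, 'k) mpoly set \<Rightarrow> 'K \<Rightarrow> int" where "val P \<equiv> valuation (local_ring \<iota> \<xi> P)"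

lemma val_mult: "P \<in> height_one I \<Longrightarrow> \<phi> \<noteq> 0 \<Longrightarrow> \<psi> \<noteq> 0 \<Longrightarrow> val P (\<phi> * \<psi>) = val P \<phi> + val P \<psi>"
  by (rule valuation_mult[OF dvr_height_one])

lemma val_constant:
  assumes P: "P \<in> height_one I" and c: "c \<noteq> 0"
  shows "val P (\<iota> c) = 0"
proof -
  obtain j where j: "in_chart j P" using point_in_chart height_one_point[OF P] by blast
  note pt = height_one_point[OF P] and nz = in_chart_nonzero[OF height_one_point[OF P] j]
  have "chart j \<subseteq> local_ring \<iota> \<xi> P"
    unfolding local_ring_eq[OF pt j]
    by (rule local_at_subring(2)[OF chart_subring[OF nz] chart_ideal_prime[OF pt j]])
  then have "\<iota> c \<in> local_ring \<iota> \<xi> P" "\<iota> (inverse c) \<in> local_ring \<iota> \<xi> P"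
    using constant_in_chart by blast+
  then have "\<iota> c \<in> units_in (local_ring \<iota> \<xi> P)"
    using c by (simp add: units_in_def map_inverse)
  then show ?thesis by (rule valuation_unit[OF dvr_height_one[OF P]])
qed

text \<open>Finitely many charts cover all points. On one of them write \<phi> = a/b: at a point
  whose prime does not contain a b the function is a unit of the local ring, and only finitely many
  primes of height one contain a b.\<close>

lemma finite_val_support:
  assumes "\<phi> \<noteq> 0"
  shows "finite {P \<in> height_one I. val P \<phi> \<noteq> 0}"
proof -
  have "finite {P \<in> height_one I. in_chart j P \<and> val P \<phi> \<noteq> 0}" for j
  proof (cases "\<xi> j = 0")
    case True
    then have "{P \<in> height_one I. in_chart j P \<and> val P \<phi> \<noteq> 0} = {}"
      using in_chart_nonzero height_one_point by blast
    then show ?thesis by (simp only: finite.emptyI)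
  next
    case False
    note A = chart_subring[OF False]
    obtain a b where ab: "a \<in> chart j" "b \<in> chart j" "b \<noteq> 0" "\<phi> = a / b"
      using chart_fractions[OF False] by blast
    have ab_mem: "a * b \<in> chart j" "a * b \<noteq> 0"
      using ab assms subring_closed(4)[OF A] by auto
    have "a * b \<in> chart_ideal j P" if P: "P \<in> height_one I" "in_chart j P" "val P \<phi> \<noteq> 0" for P
    proof (rule ccontr)
      assume not: "a * b \<notin> chart_ideal j P"
      note pt = height_one_point[OF P(1)]
      note p_id = prime_idealD(1)[OF chart_ideal_prime[OF pt P(2)]]
      have "a \<notin> chart_ideal j P" "b \<notin> chart_ideal j P"
        using not idealD(4,5)[OF p_id] ab by blast+
      then have "a / b \<in> local_ring \<iota> \<xi> P" "b / a \<in> local_ring \<iota> \<xi> P"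
        unfolding local_ring_eq[OF pt P(2)] local_at_def using ab by blast+
      then have "\<phi> \<in> units_in (local_ring \<iota> \<xi> P)"
        using assms ab by (simp add: units_in_def)
      then show False using valuation_unit[OF dvr_height_one[OF P(1)]] P(3) by blast
    qed
    then have "chart_ideal j ` {P \<in> height_one I. in_chart j P \<and> val P \<phi> \<noteq> 0} \<subseteq>
        {p. minimal_prime (chart j) p \<and> a * b \<in> p}"
      using height_one_minimal_prime by blast
    then have "finite (chart_ideal j ` {P \<in> height_one I. in_chart j P \<and> val P \<phi> \<noteq> 0})"
      by (rule finite_subset[OF _ finite_minimal_primes_containing[OF A chart_noetherian[OF False] ab_mem]])
    moreover have "inj_on (chart_ideal j) {P \<in> height_one I. in_chart j P \<and> val P \<phi> \<noteq> 0}"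
    proof (rule inj_onI, clarify)
      fix P Q assume P: "P \<in> height_one I" "in_chart j P" and Q: "Q \<in> height_one I" "in_chart j Q"
        and eq: "chart_ideal j P = chart_ideal j Q"
      note iff = chart_ideal_subset_iff[OF height_one_point[OF P(1)] P(2) height_one_point[OF Q(1)] Q(2)]
        chart_ideal_subset_iff[OF height_one_point[OF Q(1)] Q(2) height_one_point[OF P(1)] P(2)]
      show "P = Q" using iff eq by blast
    qed
    ultimately show ?thesis by (rule finite_imageD)
  qed
  then have "finite (\<Union>j. {P \<in> height_one I. in_chart j P \<and> val P \<phi> \<noteq> 0})" by simp
  then show ?thesis
  proof (rule rev_finite_subset)
    show "{P \<in> height_one I. val P \<phi> \<noteq> 0} \<subseteq> (\<Union>j. {P \<in> height_one I. in_chart j P \<and> val P \<phi> \<noteq> 0})"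
      using point_in_chart height_one_point by blast
  qed
qed

lemma div_zero_imp_constant:
  assumes "\<phi> \<noteq> 0" and div: "\<And>P. P \<in> height_one I \<Longrightarrow> val P \<phi> = 0"
  shows "\<phi> \<in> range \<iota>"
proof (rule global_function_constant)
  fix j assume j: "\<xi> j \<noteq> 0"
  show "\<phi> \<in> chart j"
  proof (rule algebraic_hartogs[OF chart_subring[OF j] chart_noetherian[OF j]
        chart_local_integrally_closed[OF j] chart_fractions[OF j]])
    fix p assume "minimal_prime (chart j) p"
    from minimal_prime_height_one[OF j this] obtain P
      where P: "P \<in> height_one I" "in_chart j P" "chart_ideal j P = p" by blast
    have "\<phi> \<in> units_in (local_ring \<iota> \<xi> P)"
      by (rule valuation_zero_imp_unit[OF dvr_height_one[OF P(1)] assms(1) div[OF P(1)]])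
    then show "\<phi> \<in> local_at (chart j) p"
      using local_ring_eq[OF height_one_point[OF P(1)] P(2)] P(3) by (simp add: units_in_def)
  qed
qed

end

section \<open>Closed forms modulo logarithmic forms\<close>

context field_embedding
begin

abbreviation Der :: "('K \<Rightarrow> 'K) set" where "Der \<equiv> derivations (range \<iota>) UNIV"

lemma DerD:
  assumes "\<theta> \<in> Der"
  shows "\<theta> (a + b) = \<theta> a + \<theta> b" "\<theta> (a * b) = \<theta> a * b + a * \<theta> b" "\<theta> (\<iota> c) = 0"
    "\<theta> 0 = 0" "\<theta> 1 = 0" "\<theta> (- a) = - \<theta> a" "\<theta> (a - b) = \<theta> a - \<theta> b"
    "a \<noteq> 0 \<Longrightarrow> \<theta> (inverse a) = - (\<theta> a * inverse a * inverse a)"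
proof -
  show add: "\<theta> (a + b) = \<theta> a + \<theta> b" and mult: "\<theta> (a * b) = \<theta> a * b + a * \<theta> b" and "\<theta> (\<iota> c) = 0" for a b c
    using derivationsD[OF assms] by auto
  show zero: "\<theta> 0 = 0" using add[of 0 0] by (metis add_0 add_cancel_left_left)
  show one: "\<theta> 1 = 0" using mult[of 1 1]
    by (simp only: mult_1_left mult_1_right) (metis add_cancel_left_left)
  show minus: "\<theta> (- a) = - \<theta> a" for a using add[of a "- a"] zero by (simp add: eq_neg_iff_add_eq_0 add.commute)
  show "\<theta> (a - b) = \<theta> a - \<theta> b" using add[of a "- b"] minus by simp
  show "\<theta> (inverse a) = - (\<theta> a * inverse a * inverse a)" if "a \<noteq> 0"
    using mult[of a "inverse a"] one that by (simp add: field_simps eq_neg_iff_add_eq_0)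
qed

lemma commutator_Der:
  assumes "\<theta> \<in> Der" "\<delta> \<in> Der"
  shows "(\<lambda>a. \<theta> (\<delta> a) - \<delta> (\<theta> a)) \<in> Der"
  using assms
  by (auto simp: derivations_UNIV_iff DerD[OF assms(1)] DerD[OF assms(2)] algebra_simps)

text \<open>Sets of pairs cannot be added by taking unions, since equal pairs would be counted once.
  Collecting the coefficients of each db turns a form into a coefficient function on a finite set,
  where addition and scaling are pointwise.\<close>

lemma forms_iff:
  "\<gamma> \<in> forms C UNIV \<longleftrightarrow>
    (\<exists>S f. finite S \<and> \<gamma> = (\<lambda>\<theta>. if \<theta> \<in> derivations C UNIV then \<Sum>b\<in>S. f b * \<theta> b else 0))"
proof
  assume "\<gamma> \<in> forms C UNIV"
  then obtain A where A: "finite A" "\<gamma> = form_of C UNIV A" by (auto simp: forms_def)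
  define f where "f = (\<lambda>b. \<Sum>x\<in>{x \<in> A. snd x = b}. fst x)"
  have "(\<Sum>(a, b)\<in>A. a * \<theta> b) = (\<Sum>b\<in>snd ` A. f b * \<theta> b)" for \<theta>
  proof -
    have "(\<Sum>(a, b)\<in>A. a * \<theta> b) = (\<Sum>b\<in>snd ` A. \<Sum>x\<in>{x \<in> A. snd x = b}. fst x * \<theta> (snd x))"
      using sum.image_gen[OF A(1), of "\<lambda>x. fst x * \<theta> (snd x)" snd] by (simp add: case_prod_unfold)
    also have "\<dots> = (\<Sum>b\<in>snd ` A. f b * \<theta> b)"
      unfolding f_def sum_distrib_right by (intro sum.cong) auto
    finally show ?thesis .
  qed
  then show "\<exists>S f. finite S \<and> \<gamma> = (\<lambda>\<theta>. if \<theta> \<in> derivations C UNIV then \<Sum>b\<in>S. f b * \<theta> b else 0)"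
    using A by (intro exI[of _ "snd ` A"] exI[of _ f]) (auto simp: form_of_def)
next
  assume "\<exists>S f. finite S \<and> \<gamma> = (\<lambda>\<theta>. if \<theta> \<in> derivations C UNIV then \<Sum>b\<in>S. f b * \<theta> b else 0)"
  then obtain S f where S: "finite S" "\<gamma> = (\<lambda>\<theta>. if \<theta> \<in> derivations C UNIV then \<Sum>b\<in>S. f b * \<theta> b else 0)"
    by blast
  have "inj_on (\<lambda>b. (f b, b)) S" by (auto simp: inj_on_def)
  then have "\<gamma> = form_of C UNIV ((\<lambda>b. (f b, b)) ` S)"
    by (simp add: form_of_def sum.reindex S(2) cong: if_cong)
  then show "\<gamma> \<in> forms C UNIV" using S(1) by (auto simp: forms_def)
qed

lemma forms_add:
  assumes "\<gamma> \<in> forms C UNIV" "\<delta> \<in> forms C UNIV"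
  shows "(\<lambda>\<theta>. \<gamma> \<theta> + \<delta> \<theta>) \<in> forms C UNIV"
proof -
  obtain S f where S: "finite S" "\<gamma> = (\<lambda>\<theta>. if \<theta> \<in> derivations C UNIV then \<Sum>b\<in>S. f b * \<theta> b else 0)"
    using assms(1) unfolding forms_iff by blast
  obtain T g where T: "finite T" "\<delta> = (\<lambda>\<theta>. if \<theta> \<in> derivations C UNIV then \<Sum>b\<in>T. g b * \<theta> b else 0)"
    using assms(2) unfolding forms_iff by blast
  define h where "h = (\<lambda>b. (if b \<in> S then f b else 0) + (if b \<in> T then g b else 0))"
  have "(\<Sum>b\<in>S. f b * \<theta> b) + (\<Sum>b\<in>T. g b * \<theta> b) = (\<Sum>b\<in>S \<union> T. h b * \<theta> b)" for \<theta>
  proof -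
    have "(\<Sum>b\<in>S. f b * \<theta> b) = (\<Sum>b\<in>S \<union> T. (if b \<in> S then f b else 0) * \<theta> b)"
      using S(1) T(1) by (intro sum.mono_neutral_cong_left) auto
    moreover have "(\<Sum>b\<in>T. g b * \<theta> b) = (\<Sum>b\<in>S \<union> T. (if b \<in> T then g b else 0) * \<theta> b)"
      using S(1) T(1) by (intro sum.mono_neutral_cong_left) auto
    ultimately show ?thesis by (simp only: h_def distrib_right sum.distrib)
  qed
  then show ?thesis
    unfolding forms_iff using S T by (intro exI[of _ "S \<union> T"] exI[of _ h]) (auto simp: fun_eq_iff)
qed

lemma forms_scale:
  assumes "\<gamma> \<in> forms C UNIV"
  shows "(\<lambda>\<theta>. c * \<gamma> \<theta>) \<in> forms C UNIV"
proof -
  obtain S f where S: "finite S" "\<gamma> = (\<lambda>\<theta>. if \<theta> \<in> derivations C UNIV then \<Sum>b\<in>S. f b * \<theta> b else 0)"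
    using assms(1) unfolding forms_iff by blast
  then show ?thesis
    unfolding forms_iff
    by (intro exI[of _ S] exI[of _ "\<lambda>b. c * f b"]) (auto simp: sum_distrib_left mult.assoc)
qed

lemma dlog_in_forms: "dlog C UNIV \<phi> \<in> forms C UNIV"
  unfolding dlog_def forms_def by auto

lemma closed_form_add:
  assumes "closed_form (range \<iota>) UNIV \<gamma>" "closed_form (range \<iota>) UNIV \<delta>"
  shows "closed_form (range \<iota>) UNIV (\<lambda>\<theta>. \<gamma> \<theta> + \<delta> \<theta>)"
  using assms unfolding closed_form_def
  by (auto simp: forms_add DerD(1) algebra_simps)

lemma closed_form_scale:
  assumes "closed_form (range \<iota>) UNIV \<gamma>"
  shows "closed_form (range \<iota>) UNIV (\<lambda>\<theta>. \<iota> c * \<gamma> \<theta>)"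
proof -
  have "\<theta> (\<iota> c * \<gamma> \<delta>) - \<delta> (\<iota> c * \<gamma> \<theta>) - \<iota> c * \<gamma> (\<lambda>a. \<theta> (\<delta> a) - \<delta> (\<theta> a)) = 0" if "\<theta> \<in> Der" "\<delta> \<in> Der" for \<theta> \<delta>
  proof -
    have "\<theta> (\<iota> c * \<gamma> \<delta>) - \<delta> (\<iota> c * \<gamma> \<theta>) - \<iota> c * \<gamma> (\<lambda>a. \<theta> (\<delta> a) - \<delta> (\<theta> a)) =
        \<iota> c * (\<theta> (\<gamma> \<delta>) - \<delta> (\<gamma> \<theta>) - \<gamma> (\<lambda>a. \<theta> (\<delta> a) - \<delta> (\<theta> a)))"
      by (simp add: DerD(2,3)[OF that(1)] DerD(2,3)[OF that(2)] right_diff_distrib)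
    then show ?thesis using assms that by (simp add: closed_form_def)
  qed
  then show ?thesis using assms by (simp add: closed_form_def forms_scale)
qed

lemma closed_form_zero: "closed_form (range \<iota>) UNIV (\<lambda>\<theta>. 0)"
proof -
  have "(\<lambda>\<theta>. 0) \<in> forms (range \<iota>) UNIV"
    using forms_scale[OF dlog_in_forms, of 0 "range \<iota>" 1] by simp
  then show ?thesis by (auto simp: closed_form_def DerD(4))
qed

lemma closed_form_dlog:
  assumes "\<phi> \<noteq> 0"
  shows "closed_form (range \<iota>) UNIV (dlog_K \<iota> \<phi>)"
proof -
  have "\<theta> (inverse \<phi> * \<delta> \<phi>) - \<delta> (inverse \<phi> * \<theta> \<phi>) - inverse \<phi> * (\<theta> (\<delta> \<phi>) - \<delta> (\<theta> \<phi>)) = 0"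
    if "\<theta> \<in> Der" "\<delta> \<in> Der" for \<theta> \<delta>
    by (simp add: DerD(2,8)[OF that(1)] DerD(2,8)[OF that(2)] assms algebra_simps)
  then show ?thesis
    by (auto simp: closed_form_def dlog_in_forms dlog_apply commutator_Der)
qed

lemma dlog_mult:
  "\<phi> \<noteq> 0 \<Longrightarrow> \<psi> \<noteq> 0 \<Longrightarrow> dlog_K \<iota> (\<phi> * \<psi>) \<theta> = dlog_K \<iota> \<phi> \<theta> + dlog_K \<iota> \<psi> \<theta>"
  by (auto simp: dlog_apply DerD(2) field_simps)

lemma dlog_one: "dlog_K \<iota> 1 \<theta> = 0"
  by (simp add: dlog_apply DerD(5))

lemma dlog_inverse: "\<phi> \<noteq> 0 \<Longrightarrow> dlog_K \<iota> (inverse \<phi>) \<theta> = - dlog_K \<iota> \<phi> \<theta>"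
  using dlog_mult[of \<phi> "inverse \<phi>" \<theta>] dlog_one[of \<theta>] by (simp add: eq_neg_iff_add_eq_0 add.commute)

lemma dlog_power: "\<phi> \<noteq> 0 \<Longrightarrow> dlog_K \<iota> (\<phi> ^ n) \<theta> = of_nat n * dlog_K \<iota> \<phi> \<theta>"
  by (induction n) (simp_all add: dlog_one dlog_mult algebra_simps)

lemma dlog_powi: "\<phi> \<noteq> 0 \<Longrightarrow> dlog_K \<iota> (\<phi> powi n) \<theta> = of_int n * dlog_K \<iota> \<phi> \<theta>"
  by (auto simp: power_int_def dlog_power dlog_inverse)

lemma dlog_constant: "dlog_K \<iota> (\<iota> c) \<theta> = 0"
  by (simp add: dlog_apply DerD(3))

end

section \<open>Groups of closed forms and torsion subgroups\<close>

lemma (in field_embedding) closed_forms_comm_group: "comm_group (closed_forms \<iota>)"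
proof (rule comm_groupI)
  fix \<gamma> assume \<gamma>: "\<gamma> \<in> carrier (closed_forms \<iota>)"
  then have "(\<lambda>\<theta>. - \<gamma> \<theta>) \<in> carrier (closed_forms \<iota>)"
    using closed_form_scale[of \<gamma> "- 1"] by (simp add: closed_forms_def map_minus)
  then show "\<exists>\<delta>\<in>carrier (closed_forms \<iota>). \<delta> \<otimes>\<^bsub>closed_forms \<iota>\<^esub> \<gamma> = \<one>\<^bsub>closed_forms \<iota>\<^esub>"
    by (intro bexI[of _ "\<lambda>\<theta>. - \<gamma> \<theta>"]) (simp_all add: closed_forms_def)
qed (auto simp: closed_forms_def closed_form_add closed_form_zero algebra_simps)

lemma (in field_embedding) dlog_forms_subgroup: "subgroup (dlog_forms \<iota>) (closed_forms \<iota>)"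
proof -
  interpret comm_group "closed_forms \<iota>" by (rule closed_forms_comm_group)
  show ?thesis
  proof (rule subgroupI)
    show "dlog_forms \<iota> \<subseteq> carrier (closed_forms \<iota>)"
      using closed_form_dlog by (auto simp: dlog_forms_def closed_forms_def)
    show "dlog_forms \<iota> \<noteq> {}" by (auto simp: dlog_forms_def intro: exI[of _ 1])
    fix \<gamma> assume "\<gamma> \<in> dlog_forms \<iota>"
    then obtain \<phi> where \<phi>: "\<phi> \<noteq> 0" "\<gamma> = dlog_K \<iota> \<phi>" by (auto simp: dlog_forms_def)
    then have "inv\<^bsub>closed_forms \<iota>\<^esub> \<gamma> = dlog_K \<iota> (inverse \<phi>)"
      by (intro inv_equality) (auto simp: closed_forms_def dlog_inverse closed_form_dlog)
    then show "inv\<^bsub>closed_forms \<iota>\<^esub> \<gamma> \<in> dlog_forms \<iota>" using \<phi>(1) unfolding dlog_forms_def by auto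
    fix \<delta> assume "\<delta> \<in> dlog_forms \<iota>"
    then obtain \<psi> where \<psi>: "\<psi> \<noteq> 0" "\<delta> = dlog_K \<iota> \<psi>" by (auto simp: dlog_forms_def)
    have "\<gamma> \<otimes>\<^bsub>closed_forms \<iota>\<^esub> \<delta> = dlog_K \<iota> (\<phi> * \<psi>)"
      by (simp add: \<phi> \<psi> closed_forms_def dlog_mult fun_eq_iff)
    then show "\<gamma> \<otimes>\<^bsub>closed_forms \<iota>\<^esub> \<delta> \<in> dlog_forms \<iota>" using \<phi>(1) \<psi>(1) unfolding dlog_forms_def by auto
  qed
qed

lemma (in field_embedding) form_class_eq_iff:
  "form_class \<iota> \<gamma> = form_class \<iota> \<delta> \<longleftrightarrow> (\<exists>\<psi>. \<psi> \<noteq> 0 \<and> \<gamma> = (\<lambda>\<theta>. dlog_K \<iota> \<psi> \<theta> + \<delta> \<theta>))"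
proof -
  have cls: "form_class \<iota> \<gamma> = {\<lambda>\<theta>. dlog_K \<iota> \<psi> \<theta> + \<gamma> \<theta> | \<psi>. \<psi> \<noteq> 0}" for \<gamma>
    by (auto simp: form_class_def r_coset_def dlog_forms_def closed_forms_def)
  show ?thesis
  proof
    assume "form_class \<iota> \<gamma> = form_class \<iota> \<delta>"
    moreover have "\<gamma> \<in> form_class \<iota> \<gamma>"
      unfolding cls by (intro CollectI exI[of _ 1]) (simp add: dlog_one)
    ultimately show "\<exists>\<psi>. \<psi> \<noteq> 0 \<and> \<gamma> = (\<lambda>\<theta>. dlog_K \<iota> \<psi> \<theta> + \<delta> \<theta>)" unfolding cls by blast
  next
    assume "\<exists>\<psi>. \<psi> \<noteq> 0 \<and> \<gamma> = (\<lambda>\<theta>. dlog_K \<iota> \<psi> \<theta> + \<delta> \<theta>)"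
    then obtain \<psi> where \<psi>: "\<psi> \<noteq> 0" "\<gamma> = (\<lambda>\<theta>. dlog_K \<iota> \<psi> \<theta> + \<delta> \<theta>)" by blast
    show "form_class \<iota> \<gamma> = form_class \<iota> \<delta>"
    proof (intro equalityI subsetI)
      fix \<epsilon> assume "\<epsilon> \<in> form_class \<iota> \<gamma>"
      then obtain \<chi> where "\<chi> \<noteq> 0" "\<epsilon> = (\<lambda>\<theta>. dlog_K \<iota> \<chi> \<theta> + \<gamma> \<theta>)" unfolding cls by blast
      then have "\<chi> * \<psi> \<noteq> 0" "\<epsilon> = (\<lambda>\<theta>. dlog_K \<iota> (\<chi> * \<psi>) \<theta> + \<delta> \<theta>)"
        using \<psi> by (auto simp: dlog_mult algebra_simps)
      then show "\<epsilon> \<in> form_class \<iota> \<delta>" unfolding cls by blast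
    next
      fix \<epsilon> assume "\<epsilon> \<in> form_class \<iota> \<delta>"
      then obtain \<chi> where "\<chi> \<noteq> 0" "\<epsilon> = (\<lambda>\<theta>. dlog_K \<iota> \<chi> \<theta> + \<delta> \<theta>)" unfolding cls by blast
      then have "\<chi> * inverse \<psi> \<noteq> 0" "\<epsilon> = (\<lambda>\<theta>. dlog_K \<iota> (\<chi> * inverse \<psi>) \<theta> + \<gamma> \<theta>)"
        using \<psi> by (auto simp: dlog_mult dlog_inverse algebra_simps)
      then show "\<epsilon> \<in> form_class \<iota> \<gamma>" unfolding cls by blast
    qed
  qed
qed

lemma torsion_subgroup_comm_group:
  assumes "comm_group G"
  shows "comm_group (torsion_subgroup G)"
proof -
  interpret comm_group G by fact
  let ?T = "{x \<in> carrier G. \<exists>n::nat. n > 0 \<and> x [^]\<^bsub>G\<^esub> n = \<one>\<^bsub>G\<^esub>}"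
  have "subgroup ?T G"
  proof (rule subgroupI)
    have "\<one>\<^bsub>G\<^esub> \<in> ?T" by (auto intro!: exI[of _ "1::nat"])
    then show "?T \<noteq> {}" by blast
    show "inv\<^bsub>G\<^esub> x \<in> ?T" if "x \<in> ?T" for x
      using that by (auto simp: nat_pow_inv)
    show "x \<otimes>\<^bsub>G\<^esub> y \<in> ?T" if xy: "x \<in> ?T" "y \<in> ?T" for x y
    proof -
      obtain m n :: nat where mn: "m > 0" "n > 0" "x [^]\<^bsub>G\<^esub> m = \<one>\<^bsub>G\<^esub>" "y [^]\<^bsub>G\<^esub> n = \<one>\<^bsub>G\<^esub>" "x \<in> carrier G" "y \<in> carrier G"
        using xy by blast
      have "x [^]\<^bsub>G\<^esub> (m * n) = \<one>\<^bsub>G\<^esub>" "y [^]\<^bsub>G\<^esub> (m * n) = \<one>\<^bsub>G\<^esub>"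
        using mn nat_pow_pow nat_pow_one by (metis mult.commute)+
      then have "(x \<otimes>\<^bsub>G\<^esub> y) [^]\<^bsub>G\<^esub> (m * n) = \<one>\<^bsub>G\<^esub>"
        using mn by (simp add: nat_pow_distrib)
      moreover have "m * n > 0" using mn by simp
      ultimately show ?thesis using mn(5,6) by blast
    qed
  qed auto
  then interpret T: group "torsion_subgroup G"
    unfolding torsion_subgroup_def by (rule subgroup_imp_group)
  show ?thesis
    by (rule T.group_comm_groupI) (simp add: torsion_subgroup_def m_comm)
qed

lemma subgroup_comm_group:
  assumes "comm_group G" "subgroup H G"
  shows "comm_group (G\<lparr>carrier := H\<rparr>)"
proof -
  interpret comm_group G by fact
  interpret H: group "G\<lparr>carrier := H\<rparr>" by (rule subgroup_imp_group[OF assms(2)])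
  show ?thesis
    by (rule H.group_comm_groupI) (use subgroup.subset[OF assms(2)] in \<open>auto intro!: m_comm\<close>)
qed

section \<open>The residue isomorphism\<close>

locale residue_setting = normal_projective I \<iota> \<xi>
  for I :: "('i::finite, 'k::{alg_closed_field, field_char_0}) mpoly set"
    and \<iota> :: "'k \<Rightarrow> 'K::field_char_0" and \<xi> :: "'i \<Rightarrow> 'K"
begin

lemma map_of_nat: "\<iota> (of_nat n) = of_nat n"
  by (induction n) (simp_all add: map_add)

lemma map_of_int: "\<iota> (of_int n) = of_int n"
  by (cases n) (simp_all add: map_of_nat map_diff map_minus map_add)

lemma map_of_rat: "\<iota> (of_rat c) = of_rat c"
  by (cases c) (simp add: of_rat_rat divide_inverse map_mult map_inverse map_of_int)

lemma dlog_zero_imp_constant: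
  assumes "\<phi> \<noteq> 0" "\<And>\<theta>. dlog_K \<iota> \<phi> \<theta> = 0"
  shows "\<phi> \<in> range \<iota>"
proof (rule ccontr)
  assume "\<phi> \<notin> range \<iota>"
  then obtain \<theta> where "\<theta> \<in> Der" "\<theta> \<phi> = 1"
    using exists_derivation_nonzero[OF field_embedding_axioms] by metis
  then show False using assms(1) assms(2)[of \<theta>] by (simp add: dlog_apply)
qed

lemma val_one: "P \<in> height_one I \<Longrightarrow> val P 1 = 0"
  using val_constant[of P 1] by simp

lemma val_inverse: "P \<in> height_one I \<Longrightarrow> \<phi> \<noteq> 0 \<Longrightarrow> val P (inverse \<phi>) = - val P \<phi>"
  using val_mult[of P \<phi> "inverse \<phi>"] val_one by simp

lemma val_power: "P \<in> height_one I \<Longrightarrow> \<phi> \<noteq> 0 \<Longrightarrow> val P (\<phi> ^ n) = int n * val P \<phi>"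
  by (induction n) (simp_all add: val_one val_mult algebra_simps)

lemma val_powi: "P \<in> height_one I \<Longrightarrow> \<phi> \<noteq> 0 \<Longrightarrow> val P (\<phi> powi n) = n * val P \<phi>"
  by (auto simp: power_int_def val_power val_inverse)

text \<open>Functions with equal logarithmic derivative differ by a constant factor, and nonzero
  constants are units at every point.\<close>

lemma val_eq_of_dlog_eq:
  assumes "P \<in> height_one I" "\<phi> \<noteq> 0" "\<psi> \<noteq> 0" "\<And>\<theta>. dlog_K \<iota> \<phi> \<theta> = dlog_K \<iota> \<psi> \<theta>"
  shows "val P \<phi> = val P \<psi>"
proof -
  have "\<phi> * inverse \<psi> \<in> range \<iota>"
    using assms by (intro dlog_zero_imp_constant) (auto simp: dlog_mult dlog_inverse)
  then obtain c where c: "\<phi> * inverse \<psi> = \<iota> c" by blast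
  then have "c \<noteq> 0" using assms(2,3) by auto
  then have "val P (\<phi> * inverse \<psi>) = 0" unfolding c by (rule val_constant[OF assms(1)])
  then show ?thesis using assms by (simp add: val_mult val_inverse)
qed

definition rat_dlog :: "rat \<Rightarrow> 'K \<Rightarrow> 'K form" where
  "rat_dlog c \<phi> = (\<lambda>\<theta>. of_rat c * dlog_K \<iota> \<phi> \<theta>)"

text \<open>Clearing the denominators b and b' shows that \<phi>^(a b') and \<psi>^(a' b) have the
  same dlog, hence the same valuation. This is what makes the description in \<open>residue\<close>
  denote a unique value.\<close>

lemma rat_dlog_val:
  assumes P: "P \<in> height_one I" and nz: "\<phi> \<noteq> 0" "\<psi> \<noteq> 0" and eq: "rat_dlog c \<phi> = rat_dlog d \<psi>"
  shows "(of_rat c * of_int (val P \<phi>) :: 'k) = of_rat d * of_int (val P \<psi>)"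
proof -
  obtain a b where ab: "c = of_int a / of_int b" "b \<noteq> 0"
    using quotient_of_div[of c] quotient_of_denom_pos[of c] by (metis less_irrefl surj_pair)
  obtain a' b' where ab': "d = of_int a' / of_int b'" "b' \<noteq> 0"
    using quotient_of_div[of d] quotient_of_denom_pos[of d] by (metis less_irrefl surj_pair)
  have "dlog_K \<iota> (\<phi> powi (a * b')) \<theta> = dlog_K \<iota> (\<psi> powi (a' * b)) \<theta>" for \<theta>
    using fun_cong[OF eq, of \<theta>] nz ab(2) ab'(2)
    by (simp add: dlog_powi rat_dlog_def ab ab' of_rat_divide field_simps)
  then have "a * b' * val P \<phi> = a' * b * val P \<psi>"
    using val_eq_of_dlog_eq[OF P, of "\<phi> powi (a * b')" "\<psi> powi (a' * b)"] nz val_powi[OF P] by simp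
  then have "(of_int (a * b' * val P \<phi>) :: 'k) = of_int (a' * b * val P \<psi>)" by simp
  then show ?thesis
    using ab(2) ab'(2) by (simp add: ab ab' of_rat_divide field_simps)
qed

lemma residue_rat_dlog:
  assumes "P \<in> height_one I" "\<phi> \<noteq> 0"
  shows "residue \<iota> \<xi> P (rat_dlog c \<phi>) = of_rat c * of_int (val P \<phi>)"
  unfolding residue_def
proof (rule the_equality)
  show "\<exists>d \<psi>. \<psi> \<noteq> 0 \<and> rat_dlog c \<phi> = (\<lambda>\<theta>. of_rat d * dlog_K \<iota> \<psi> \<theta>) \<and>
      of_rat c * of_int (val P \<phi>) = of_rat d * of_int (val P \<psi>)"
    using assms(2) by (auto simp: rat_dlog_def)
  fix r :: 'k
  assume "\<exists>d \<psi>. \<psi> \<noteq> 0 \<and> rat_dlog c \<phi> = (\<lambda>\<theta>. of_rat d * dlog_K \<iota> \<psi> \<theta>) \<and>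
      r = of_rat d * of_int (val P \<psi>)"
  then obtain d \<psi> where d: "\<psi> \<noteq> 0" "rat_dlog c \<phi> = rat_dlog d \<psi>" "r = of_rat d * of_int (val P \<psi>)"
    unfolding rat_dlog_def by blast
  show "r = of_rat c * of_int (val P \<phi>)"
    unfolding d(3) by (rule rat_dlog_val[OF assms d(1,2), symmetric])
qed

abbreviation divisor :: "'K \<Rightarrow> (('i, 'k) mpoly set \<Rightarrow> 'k)" where "divisor \<equiv> div_of I \<iota> \<xi>"

lemma Res_rat_dlog: "\<phi> \<noteq> 0 \<Longrightarrow> Res I \<iota> \<xi> (rat_dlog c \<phi>) = (\<lambda>x. of_rat c * divisor \<phi> x)"
  by (auto simp: Res_def div_of_def residue_rat_dlog)

lemma divisor_mult: "\<phi> \<noteq> 0 \<Longrightarrow> \<psi> \<noteq> 0 \<Longrightarrow> divisor (\<phi> * \<psi>) x = divisor \<phi> x + divisor \<psi> x"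
  by (simp add: div_of_def val_mult)

lemma divisor_inverse: "\<phi> \<noteq> 0 \<Longrightarrow> divisor (inverse \<phi>) x = - divisor \<phi> x"
  by (simp add: div_of_def val_inverse)

lemma divisor_one: "divisor 1 x = 0"
  by (simp add: div_of_def val_one)

lemma divisor_power: "\<phi> \<noteq> 0 \<Longrightarrow> divisor (\<phi> ^ n) x = of_nat n * divisor \<phi> x"
  by (simp add: div_of_def val_power)

text \<open>The quotient has neither zeros nor poles, so it is constant and its dlog vanishes.
  Divisors take their values in the base field; characteristic 0 recovers the integer valuations
  from them.\<close>

lemma div_eq_imp_dlog_eq:
  assumes "\<phi> \<noteq> 0" "\<psi> \<noteq> 0" "divisor \<phi> = divisor \<psi>"
  shows "dlog_K \<iota> \<phi> \<theta> = dlog_K \<iota> \<psi> \<theta>"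
proof -
  have "\<phi> * inverse \<psi> \<in> range \<iota>"
  proof (rule div_zero_imp_constant)
    fix P assume P: "P \<in> height_one I"
    then have "(of_int (val P \<phi>) :: 'k) = of_int (val P \<psi>)"
      using fun_cong[OF assms(3), of P] by (simp add: div_of_def)
    then show "val P (\<phi> * inverse \<psi>) = 0" using P assms by (simp add: val_mult val_inverse)
  qed (use assms in simp)
  then obtain c where "\<phi> * inverse \<psi> = \<iota> c" by blast
  then have "dlog_K \<iota> (\<phi> * inverse \<psi>) \<theta> = 0" by (simp add: dlog_constant)
  then show ?thesis using assms by (simp add: dlog_mult dlog_inverse)
qed

section \<open>Rational Weil divisors and their class group\<close>

lemma Div_Q_comm_group: "comm_group (Div_Q I)"
proof (rule comm_groupI)
  fix D assume D: "D \<in> carrier (Div_Q I)"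
  then show "\<exists>E\<in>carrier (Div_Q I). E \<otimes>\<^bsub>Div_Q I\<^esub> D = \<one>\<^bsub>Div_Q I\<^esub>"
    by (intro bexI[of _ "\<lambda>x. - D x"]) (auto simp: Div_Q_def)
next
  fix D E assume "D \<in> carrier (Div_Q I)" "E \<in> carrier (Div_Q I)"
  then have fin: "finite ({x. D x \<noteq> 0} \<union> {x. E x \<noteq> 0})"
    and "\<forall>x. D x \<in> \<rat>" "\<forall>x. E x \<in> \<rat>" "\<forall>x. x \<notin> height_one I \<longrightarrow> D x = 0 \<and> E x = 0"
    by (auto simp: Div_Q_def)
  moreover have "finite {x. D x + E x \<noteq> 0}" by (rule finite_subset[OF _ fin]) auto
  ultimately show "D \<otimes>\<^bsub>Div_Q I\<^esub> E \<in> carrier (Div_Q I)" by (simp add: Div_Q_def)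
qed (auto simp: Div_Q_def algebra_simps)

lemma rat_div_in_Div_Q:
  assumes "\<phi> \<noteq> 0"
  shows "(\<lambda>x. of_rat c * divisor \<phi> x) \<in> carrier (Div_Q I)"
proof -
  have "{x. of_rat c * divisor \<phi> x \<noteq> 0} \<subseteq> {P \<in> height_one I. val P \<phi> \<noteq> 0}"
    by (auto simp: div_of_def split: if_splits)
  then have "finite {x. of_rat c * divisor \<phi> x \<noteq> 0}"
    by (rule finite_subset) (rule finite_val_support[OF assms])
  then show ?thesis by (auto simp: Div_Q_def div_of_def)
qed

lemma div_in_Div_Q: "\<phi> \<noteq> 0 \<Longrightarrow> divisor \<phi> \<in> carrier (Div_Q I)"
  using rat_div_in_Div_Q[of \<phi> 1] by simp

lemma principal_divisors_subgroup: "subgroup (principal_divisors I \<iota> \<xi>) (Div_Q I)"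
proof -
  interpret comm_group "Div_Q I" by (rule Div_Q_comm_group)
  show ?thesis
  proof (rule subgroupI)
    show "principal_divisors I \<iota> \<xi> \<subseteq> carrier (Div_Q I)"
      using div_in_Div_Q by (auto simp: principal_divisors_def)
    show "principal_divisors I \<iota> \<xi> \<noteq> {}" by (auto simp: principal_divisors_def intro: exI[of _ 1])
    fix D assume "D \<in> principal_divisors I \<iota> \<xi>"
    then obtain \<phi> where \<phi>: "\<phi> \<noteq> 0" "D = divisor \<phi>" by (auto simp: principal_divisors_def)
    have "divisor (inverse \<phi>) \<otimes>\<^bsub>Div_Q I\<^esub> D = \<one>\<^bsub>Div_Q I\<^esub>"
      using \<phi> by (simp add: Div_Q_def divisor_inverse)
    then have "inv\<^bsub>Div_Q I\<^esub> D = divisor (inverse \<phi>)"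
      using \<phi> by (intro inv_equality) (auto simp: div_in_Div_Q)
    then show "inv\<^bsub>Div_Q I\<^esub> D \<in> principal_divisors I \<iota> \<xi>"
      using \<phi>(1) unfolding principal_divisors_def by auto
    fix E assume "E \<in> principal_divisors I \<iota> \<xi>"
    then obtain \<psi> where \<psi>: "\<psi> \<noteq> 0" "E = divisor \<psi>" by (auto simp: principal_divisors_def)
    have "D \<otimes>\<^bsub>Div_Q I\<^esub> E = divisor (\<phi> * \<psi>)"
      using \<phi> \<psi> by (simp add: Div_Q_def divisor_mult fun_eq_iff)
    then show "D \<otimes>\<^bsub>Div_Q I\<^esub> E \<in> principal_divisors I \<iota> \<xi>"
      using \<phi>(1) \<psi>(1) unfolding principal_divisors_def by auto
  qed
qed

lemma divisor_class_eq_iff: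
  "divisor_class I \<iota> \<xi> D = divisor_class I \<iota> \<xi> E \<longleftrightarrow> (\<exists>\<psi>. \<psi> \<noteq> 0 \<and> D = (\<lambda>x. divisor \<psi> x + E x))"
proof -
  have cls: "divisor_class I \<iota> \<xi> D = {\<lambda>x. divisor \<psi> x + D x | \<psi>. \<psi> \<noteq> 0}" for D
    by (auto simp: divisor_class_def r_coset_def principal_divisors_def Div_Q_def)
  show ?thesis
  proof
    assume "divisor_class I \<iota> \<xi> D = divisor_class I \<iota> \<xi> E"
    moreover have "D \<in> divisor_class I \<iota> \<xi> D"
      unfolding cls by (intro CollectI exI[of _ 1]) (simp add: divisor_one)
    ultimately show "\<exists>\<psi>. \<psi> \<noteq> 0 \<and> D = (\<lambda>x. divisor \<psi> x + E x)" unfolding cls by blast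
  next
    assume "\<exists>\<psi>. \<psi> \<noteq> 0 \<and> D = (\<lambda>x. divisor \<psi> x + E x)"
    then obtain \<psi> where \<psi>: "\<psi> \<noteq> 0" "D = (\<lambda>x. divisor \<psi> x + E x)" by blast
    show "divisor_class I \<iota> \<xi> D = divisor_class I \<iota> \<xi> E"
    proof (intro equalityI subsetI)
      fix F assume "F \<in> divisor_class I \<iota> \<xi> D"
      then obtain \<chi> where "\<chi> \<noteq> 0" "F = (\<lambda>x. divisor \<chi> x + D x)" unfolding cls by blast
      then have "\<chi> * \<psi> \<noteq> 0" "F = (\<lambda>x. divisor (\<chi> * \<psi>) x + E x)"
        using \<psi> by (auto simp: divisor_mult algebra_simps)
      then show "F \<in> divisor_class I \<iota> \<xi> E" unfolding cls by blast
    next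
      fix F assume "F \<in> divisor_class I \<iota> \<xi> E"
      then obtain \<chi> where "\<chi> \<noteq> 0" "F = (\<lambda>x. divisor \<chi> x + E x)" unfolding cls by blast
      then have "\<chi> * inverse \<psi> \<noteq> 0" "F = (\<lambda>x. divisor (\<chi> * inverse \<psi>) x + D x)"
        using \<psi> by (auto simp: divisor_mult divisor_inverse algebra_simps)
      then show "F \<in> divisor_class I \<iota> \<xi> D" unfolding cls by blast
    qed
  qed
qed

lemma Cl_Q_comm_group: "comm_group (Cl_Q I \<iota> \<xi>)"
  unfolding Cl_Q_def
  by (rule comm_group.abelian_FactGroup[OF Div_Q_comm_group principal_divisors_subgroup])

lemma carrier_Cl_Q: "carrier (Cl_Q I \<iota> \<xi>) = divisor_class I \<iota> \<xi> ` carrier (Div_Q I)"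
  by (auto simp: Cl_Q_def carrier_FactGroup divisor_class_def)

lemma divisor_class_mult:
  assumes "D \<in> carrier (Div_Q I)" "E \<in> carrier (Div_Q I)"
  shows "divisor_class I \<iota> \<xi> D \<otimes>\<^bsub>Cl_Q I \<iota> \<xi>\<^esub> divisor_class I \<iota> \<xi> E = divisor_class I \<iota> \<xi> (\<lambda>x. D x + E x)"
proof -
  interpret normal "principal_divisors I \<iota> \<xi>" "Div_Q I"
    by (rule comm_group.subgroup_imp_normal[OF Div_Q_comm_group principal_divisors_subgroup])
  have "D \<otimes>\<^bsub>Div_Q I\<^esub> E = (\<lambda>x. D x + E x)" by (simp add: Div_Q_def)
  then show ?thesis using rcos_sum[OF assms] by (simp add: Cl_Q_def divisor_class_def)
qed

lemma divisor_class_tors_iff: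
  assumes D: "D \<in> carrier (Div_Q I)"
  shows "divisor_class I \<iota> \<xi> D \<in> carrier (Cl_Q_tors I \<iota> \<xi>) \<longleftrightarrow>
    (\<exists>n \<phi>. n > 0 \<and> \<phi> \<noteq> 0 \<and> (\<lambda>x. of_nat n * D x) = divisor \<phi>)"
proof -
  interpret normal "principal_divisors I \<iota> \<xi>" "Div_Q I"
    by (rule comm_group.subgroup_imp_normal[OF Div_Q_comm_group principal_divisors_subgroup])
  have pow: "D [^]\<^bsub>Div_Q I\<^esub> n = (\<lambda>x. of_nat n * D x)" for n :: nat
    by (induction n) (auto simp: Div_Q_def nat_pow_def algebra_simps)
  have one: "\<one>\<^bsub>Cl_Q I \<iota> \<xi>\<^esub> = divisor_class I \<iota> \<xi> (\<lambda>x. 0)"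
    by (auto simp: Cl_Q_def divisor_class_def r_coset_def Div_Q_def)
  have "divisor_class I \<iota> \<xi> D [^]\<^bsub>Cl_Q I \<iota> \<xi>\<^esub> n = \<one>\<^bsub>Cl_Q I \<iota> \<xi>\<^esub> \<longleftrightarrow>
      (\<exists>\<phi>. \<phi> \<noteq> 0 \<and> (\<lambda>x. of_nat n * D x) = divisor \<phi>)" for n :: nat
  proof -
    have "divisor_class I \<iota> \<xi> D [^]\<^bsub>Cl_Q I \<iota> \<xi>\<^esub> n = divisor_class I \<iota> \<xi> (\<lambda>x. of_nat n * D x)"
      using FactGroup_pow[OF D, of n] by (simp add: Cl_Q_def divisor_class_def pow)
    then show ?thesis unfolding one by (simp add: divisor_class_eq_iff)
  qed
  then show ?thesis
    using D by (auto simp: Cl_Q_tors_def torsion_subgroup_def carrier_Cl_Q)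
qed

section \<open>Etale trivial forms and their residues\<close>

lemma rat_dlog_etale_trivial:
  assumes "\<phi> \<noteq> 0"
  shows "rat_dlog c \<phi> \<in> carrier (closed_forms \<iota>)" "etale_trivial \<iota> (rat_dlog c \<phi>)"
proof -
  show closed: "rat_dlog c \<phi> \<in> carrier (closed_forms \<iota>)"
    using closed_form_scale[OF closed_form_dlog[OF assms], of "of_rat c"]
    by (simp add: closed_forms_def rat_dlog_def map_of_rat)
  obtain a b where ab: "c = of_int a / of_int b" "b > 0"
    using quotient_of_div[of c] quotient_of_denom_pos[of c] by (metis surj_pair)
  have "of_nat (nat b) * rat_dlog c \<phi> \<theta> = dlog_K \<iota> (\<phi> powi a) \<theta>" for \<theta>
    using ab(2) assms by (simp add: rat_dlog_def ab(1) dlog_powi of_rat_divide)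
  then show "etale_trivial \<iota> (rat_dlog c \<phi>)"
    using closed ab(2) assms
    by (intro multiple_dlog_imp_etale_trivial[of _ _ "nat b" "\<phi> powi a"])
       (auto simp: closed_forms_def closed_form_def)
qed

lemma etale_trivial_imp_rat_dlog:
  assumes "etale_trivial \<iota> \<gamma>"
  obtains n \<phi> where "n > 0" "\<phi> \<noteq> 0" "\<gamma> = rat_dlog (1 / of_nat n) \<phi>"
proof -
  obtain n \<phi> where n: "n > 0" "\<phi> \<noteq> 0" "\<And>\<theta>. of_nat n * \<gamma> \<theta> = dlog_K \<iota> \<phi> \<theta>"
    using etale_trivial_imp_multiple_dlog[OF assms] by blast
  then have "\<gamma> = rat_dlog (1 / of_nat n) \<phi>"
    by (auto simp: rat_dlog_def of_rat_divide n(3)[symmetric])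
  then show ?thesis using that n by blast
qed

lemma rat_dlog_add:
  assumes "n > 0" "m > 0" "\<phi> \<noteq> 0" "\<psi> \<noteq> 0"
  shows "rat_dlog (1 / of_nat n) \<phi> \<theta> + rat_dlog (1 / of_nat m) \<psi> \<theta> =
    rat_dlog (1 / of_nat (n * m)) (\<phi> ^ m * \<psi> ^ n) \<theta>"
  using assms by (simp add: rat_dlog_def of_rat_divide of_rat_mult dlog_mult dlog_power field_simps)

text \<open>Both forms are brought to the common denominator n m. The sum is 1/(n m) times the dlog
  of \<phi>^m \<psi>^n, and its residue is read off from this presentation.\<close>

lemma Res_add:
  assumes "etale_trivial \<iota> \<gamma>" "etale_trivial \<iota> \<delta>"
  shows "etale_trivial \<iota> (\<lambda>\<theta>. \<gamma> \<theta> + \<delta> \<theta>)"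
    "Res I \<iota> \<xi> (\<lambda>\<theta>. \<gamma> \<theta> + \<delta> \<theta>) = (\<lambda>x. Res I \<iota> \<xi> \<gamma> x + Res I \<iota> \<xi> \<delta> x)"
proof -
  obtain n \<phi> where n: "n > 0" "\<phi> \<noteq> 0" "\<gamma> = rat_dlog (1 / of_nat n) \<phi>"
    by (rule etale_trivial_imp_rat_dlog[OF assms(1)])
  obtain m \<psi> where m: "m > 0" "\<psi> \<noteq> 0" "\<delta> = rat_dlog (1 / of_nat m) \<psi>"
    by (rule etale_trivial_imp_rat_dlog[OF assms(2)])
  have nz: "\<phi> ^ m * \<psi> ^ n \<noteq> 0" using n m by simp
  have sum: "(\<lambda>\<theta>. \<gamma> \<theta> + \<delta> \<theta>) = rat_dlog (1 / of_nat (n * m)) (\<phi> ^ m * \<psi> ^ n)"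
    unfolding n(3) m(3) using rat_dlog_add n m by (intro ext) blast
  show "etale_trivial \<iota> (\<lambda>\<theta>. \<gamma> \<theta> + \<delta> \<theta>)"
    unfolding sum by (rule rat_dlog_etale_trivial[OF nz])
  show "Res I \<iota> \<xi> (\<lambda>\<theta>. \<gamma> \<theta> + \<delta> \<theta>) = (\<lambda>x. Res I \<iota> \<xi> \<gamma> x + Res I \<iota> \<xi> \<delta> x)"
    unfolding sum unfolding n(3) m(3) Res_rat_dlog[OF nz] Res_rat_dlog[OF n(2)] Res_rat_dlog[OF m(2)]
    using n m by (intro ext) (simp add: divisor_mult divisor_power of_rat_divide of_rat_mult field_simps)
qed

lemma etale_trivial_dlog: "\<psi> \<noteq> 0 \<Longrightarrow> etale_trivial \<iota> (dlog_K \<iota> \<psi>)"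
  and Res_dlog: "\<psi> \<noteq> 0 \<Longrightarrow> Res I \<iota> \<xi> (dlog_K \<iota> \<psi>) = divisor \<psi>"
  using rat_dlog_etale_trivial(2)[of \<psi> 1] Res_rat_dlog[of \<psi> 1] by (simp_all add: rat_dlog_def)

lemma Res_in_tors:
  assumes "etale_trivial \<iota> \<gamma>"
  shows "Res I \<iota> \<xi> \<gamma> \<in> carrier (Div_Q I)" "divisor_class I \<iota> \<xi> (Res I \<iota> \<xi> \<gamma>) \<in> carrier (Cl_Q_tors I \<iota> \<xi>)"
proof -
  obtain n \<phi> where n: "n > 0" "\<phi> \<noteq> 0" "\<gamma> = rat_dlog (1 / of_nat n) \<phi>"
    by (rule etale_trivial_imp_rat_dlog[OF assms])
  have Res: "Res I \<iota> \<xi> \<gamma> = (\<lambda>x. of_rat (1 / of_nat n) * divisor \<phi> x)"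
    unfolding n(3) by (rule Res_rat_dlog[OF n(2)])
  then show mem: "Res I \<iota> \<xi> \<gamma> \<in> carrier (Div_Q I)" using rat_div_in_Div_Q[OF n(2)] by simp
  have "(\<lambda>x. of_nat n * Res I \<iota> \<xi> \<gamma> x) = divisor \<phi>" using n(1) by (auto simp: Res of_rat_divide)
  then show "divisor_class I \<iota> \<xi> (Res I \<iota> \<xi> \<gamma>) \<in> carrier (Cl_Q_tors I \<iota> \<xi>)"
    unfolding divisor_class_tors_iff[OF mem] using n by blast
qed

text \<open>One direction makes the map on classes well defined, since adding dlog \<psi> to a form
  adds the divisor of \<psi> to its residue. The other direction is injectivity.\<close>

lemma Res_class_eq_iff:
  assumes "etale_trivial \<iota> \<gamma>" "etale_trivial \<iota> \<delta>"
  shows "divisor_class I \<iota> \<xi> (Res I \<iota> \<xi> \<gamma>) = divisor_class I \<iota> \<xi> (Res I \<iota> \<xi> \<delta>) \<longleftrightarrow>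
    form_class \<iota> \<gamma> = form_class \<iota> \<delta>"
proof
  assume "form_class \<iota> \<gamma> = form_class \<iota> \<delta>"
  then obtain \<psi> where \<psi>: "\<psi> \<noteq> 0" "\<gamma> = (\<lambda>\<theta>. dlog_K \<iota> \<psi> \<theta> + \<delta> \<theta>)" unfolding form_class_eq_iff by blast
  then have "Res I \<iota> \<xi> \<gamma> = (\<lambda>x. divisor \<psi> x + Res I \<iota> \<xi> \<delta> x)"
    using Res_add(2)[OF etale_trivial_dlog[OF \<psi>(1)] assms(2)] by (simp add: Res_dlog)
  then show "divisor_class I \<iota> \<xi> (Res I \<iota> \<xi> \<gamma>) = divisor_class I \<iota> \<xi> (Res I \<iota> \<xi> \<delta>)"
    unfolding divisor_class_eq_iff using \<psi>(1) by blast
next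
  assume "divisor_class I \<iota> \<xi> (Res I \<iota> \<xi> \<gamma>) = divisor_class I \<iota> \<xi> (Res I \<iota> \<xi> \<delta>)"
  then obtain \<psi> where \<psi>: "\<psi> \<noteq> 0" "Res I \<iota> \<xi> \<gamma> = (\<lambda>x. divisor \<psi> x + Res I \<iota> \<xi> \<delta> x)"
    unfolding divisor_class_eq_iff by blast
  \<comment> \<open>The principal divisor is absorbed into the form: \<epsilon> represents the class
    of \<delta> and has exactly the residue of \<gamma>. Then \<phi>^m and \<chi>^n have equal
    divisors, hence equal dlog, and \<gamma> = \<epsilon>.\<close>
  define \<epsilon> where "\<epsilon> = (\<lambda>\<theta>. dlog_K \<iota> \<psi> \<theta> + \<delta> \<theta>)"
  have \<epsilon>: "etale_trivial \<iota> \<epsilon>" "Res I \<iota> \<xi> \<epsilon> = Res I \<iota> \<xi> \<gamma>"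
    using Res_add[OF etale_trivial_dlog[OF \<psi>(1)] assms(2)] \<psi> by (simp_all add: \<epsilon>_def Res_dlog)
  obtain n \<phi> where n: "n > 0" "\<phi> \<noteq> 0" "\<gamma> = rat_dlog (1 / of_nat n) \<phi>"
    by (rule etale_trivial_imp_rat_dlog[OF assms(1)])
  obtain m \<chi> where m: "m > 0" "\<chi> \<noteq> 0" "\<epsilon> = rat_dlog (1 / of_nat m) \<chi>"
    by (rule etale_trivial_imp_rat_dlog[OF \<epsilon>(1)])
  have "of_rat (1 / of_nat n) * divisor \<phi> x = of_rat (1 / of_nat m) * divisor \<chi> x" for x
    using fun_cong[OF \<epsilon>(2), of x] unfolding n(3) m(3) Res_rat_dlog[OF n(2)] Res_rat_dlog[OF m(2)] by simp
  then have "divisor (\<phi> ^ m) = divisor (\<chi> ^ n)"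
    using n m by (intro ext) (simp add: divisor_power of_rat_divide field_simps)
  then have "dlog_K \<iota> (\<phi> ^ m) \<theta> = dlog_K \<iota> (\<chi> ^ n) \<theta>" for \<theta>
    using n m by (intro div_eq_imp_dlog_eq) auto
  then have "\<gamma> = \<epsilon>"
    unfolding n(3) m(3) using n(1,2) m(1,2)
    by (intro ext) (simp add: rat_dlog_def dlog_power of_rat_divide field_simps)
  then show "form_class \<iota> \<gamma> = form_class \<iota> \<delta>"
    unfolding form_class_eq_iff using \<psi>(1) \<epsilon>_def by blast
qed

abbreviation etale_forms :: "'K form set" where
  "etale_forms \<equiv> {\<gamma> \<in> carrier (closed_forms \<iota>). etale_trivial \<iota> \<gamma>}"

lemma etale_forms_subgroup: "subgroup etale_forms (closed_forms \<iota>)"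
proof -
  interpret comm_group "closed_forms \<iota>" by (rule closed_forms_comm_group)
  show ?thesis
  proof (rule subgroupI)
    show "etale_forms \<noteq> {}"
      using rat_dlog_etale_trivial[of 1 1] by auto
    fix \<gamma> assume \<gamma>: "\<gamma> \<in> etale_forms"
    then obtain n \<phi> where n: "n > 0" "\<phi> \<noteq> 0" "\<gamma> = rat_dlog (1 / of_nat n) \<phi>"
      using etale_trivial_imp_rat_dlog[of \<gamma>] by blast
    have "rat_dlog (1 / of_nat n) (inverse \<phi>) \<otimes>\<^bsub>closed_forms \<iota>\<^esub> \<gamma> = \<one>\<^bsub>closed_forms \<iota>\<^esub>"
      using n by (simp add: closed_forms_def rat_dlog_def dlog_inverse fun_eq_iff)
    then have "inv\<^bsub>closed_forms \<iota>\<^esub> \<gamma> = rat_dlog (1 / of_nat n) (inverse \<phi>)"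
      using \<gamma> n(2) rat_dlog_etale_trivial(1) by (intro inv_equality) auto
    then show "inv\<^bsub>closed_forms \<iota>\<^esub> \<gamma> \<in> etale_forms"
      using rat_dlog_etale_trivial n(2) by simp
    fix \<delta> assume "\<delta> \<in> etale_forms"
    then show "\<gamma> \<otimes>\<^bsub>closed_forms \<iota>\<^esub> \<delta> \<in> etale_forms"
      using \<gamma> Res_add(1) m_closed by (auto simp: closed_forms_def closed_form_add)
  qed auto
qed

lemma carrier_I_et: "carrier (I_et \<iota>) = form_class \<iota> ` etale_forms"
  by (auto simp: I_et_def)

lemma form_class_mult:
  assumes "\<gamma> \<in> carrier (closed_forms \<iota>)" "\<delta> \<in> carrier (closed_forms \<iota>)"
  shows "form_class \<iota> \<gamma> \<otimes>\<^bsub>I_et \<iota>\<^esub> form_class \<iota> \<delta> = form_class \<iota> (\<lambda>\<theta>. \<gamma> \<theta> + \<delta> \<theta>)"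
proof -
  interpret normal "dlog_forms \<iota>" "closed_forms \<iota>"
    by (rule comm_group.subgroup_imp_normal[OF closed_forms_comm_group dlog_forms_subgroup])
  have "\<gamma> \<otimes>\<^bsub>closed_forms \<iota>\<^esub> \<delta> = (\<lambda>\<theta>. \<gamma> \<theta> + \<delta> \<theta>)" by (simp add: closed_forms_def)
  then show ?thesis using rcos_sum[OF assms] by (simp add: I_et_def form_class_def)
qed

text \<open>\<open>I_et\<close> is the image of the subgroup \<open>etale_forms\<close> under the
  quotient map, hence a subgroup of an abelian group.\<close>

lemma I_et_comm_group: "comm_group (I_et \<iota>)"
proof -
  interpret normal "dlog_forms \<iota>" "closed_forms \<iota>"
    by (rule comm_group.subgroup_imp_normal[OF closed_forms_comm_group dlog_forms_subgroup])
  have quot: "comm_group (closed_forms \<iota> Mod dlog_forms \<iota>)"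
    by (rule comm_group.abelian_FactGroup[OF closed_forms_comm_group dlog_forms_subgroup])
  interpret group_hom "closed_forms \<iota>" "closed_forms \<iota> Mod dlog_forms \<iota>" "\<lambda>\<gamma>. dlog_forms \<iota> #>\<^bsub>closed_forms \<iota>\<^esub> \<gamma>"
    using r_coset_hom_Mod factorgroup_is_group by (intro group_hom.intro group_hom_axioms.intro is_group)
  have "I_et \<iota> = (closed_forms \<iota> Mod dlog_forms \<iota>)\<lparr>carrier := (\<lambda>\<gamma>. dlog_forms \<iota> #>\<^bsub>closed_forms \<iota>\<^esub> \<gamma>) ` etale_forms\<rparr>"
    unfolding I_et_def form_class_def by (rule arg_cong[of _ _ "\<lambda>S. _\<lparr>carrier := S\<rparr>"]) blast
  then show ?thesis
    using subgroup_comm_group[OF quot subgroup_img_is_subgroup[OF etale_forms_subgroup]] by simp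
qed

text \<open>A representative is chosen because residues are defined on forms; by
  \<open>Res_class_eq_iff\<close> the choice does not matter.\<close>

definition Res_class :: "'K form set \<Rightarrow> (('i, 'k) mpoly set \<Rightarrow> 'k) set" where
  "Res_class c = divisor_class I \<iota> \<xi> (Res I \<iota> \<xi> (SOME \<gamma>. \<gamma> \<in> etale_forms \<and> form_class \<iota> \<gamma> = c))"

lemma Res_class_form_class:
  assumes "\<gamma> \<in> etale_forms"
  shows "Res_class (form_class \<iota> \<gamma>) = divisor_class I \<iota> \<xi> (Res I \<iota> \<xi> \<gamma>)"
proof -
  define \<delta> where "\<delta> = (SOME \<delta>. \<delta> \<in> etale_forms \<and> form_class \<iota> \<delta> = form_class \<iota> \<gamma>)"
  have "\<delta> \<in> etale_forms \<and> form_class \<iota> \<delta> = form_class \<iota> \<gamma>"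
    unfolding \<delta>_def using assms
    by (intro someI[of "\<lambda>\<delta>. \<delta> \<in> etale_forms \<and> form_class \<iota> \<delta> = form_class \<iota> \<gamma>" \<gamma>]) simp
  then show ?thesis
    unfolding Res_class_def \<delta>_def[symmetric] using Res_class_eq_iff assms by simp
qed

lemma Res_class_inj: "inj_on Res_class (carrier (I_et \<iota>))"
proof (rule inj_onI)
  fix c d assume "c \<in> carrier (I_et \<iota>)" "d \<in> carrier (I_et \<iota>)" and eq: "Res_class c = Res_class d"
  then obtain \<gamma> \<delta> where "\<gamma> \<in> etale_forms" "c = form_class \<iota> \<gamma>" "\<delta> \<in> etale_forms" "d = form_class \<iota> \<delta>"
    unfolding carrier_I_et by blast
  then show "c = d" using eq Res_class_eq_iff[of \<gamma> \<delta>] Res_class_form_class by simp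
qed

lemma Res_class_surj: "Res_class ` carrier (I_et \<iota>) = carrier (Cl_Q_tors I \<iota> \<xi>)"
proof (intro equalityI subsetI)
  fix c assume "c \<in> Res_class ` carrier (I_et \<iota>)"
  then show "c \<in> carrier (Cl_Q_tors I \<iota> \<xi>)"
    using Res_class_form_class Res_in_tors(2) by (auto simp: carrier_I_et)
next
  fix c assume c: "c \<in> carrier (Cl_Q_tors I \<iota> \<xi>)"
  then obtain D where D: "D \<in> carrier (Div_Q I)" "c = divisor_class I \<iota> \<xi> D"
    by (auto simp: Cl_Q_tors_def torsion_subgroup_def carrier_Cl_Q)
  then obtain n \<phi> where n: "n > 0" "\<phi> \<noteq> 0" "(\<lambda>x. of_nat n * D x) = divisor \<phi>"
    using c divisor_class_tors_iff[OF D(1)] by blast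
  define \<gamma> where "\<gamma> = rat_dlog (1 / of_nat n) \<phi>"
  have \<gamma>: "\<gamma> \<in> etale_forms" using rat_dlog_etale_trivial[OF n(2)] by (simp add: \<gamma>_def)
  have "Res I \<iota> \<xi> \<gamma> = D"
    unfolding \<gamma>_def Res_rat_dlog[OF n(2)] n(3)[symmetric] using n(1) by (auto simp: of_rat_divide)
  then have "Res_class (form_class \<iota> \<gamma>) = c" using Res_class_form_class[OF \<gamma>] D(2) by simp
  then show "c \<in> Res_class ` carrier (I_et \<iota>)" using \<gamma> unfolding carrier_I_et by blast
qed

lemma Res_class_iso: "Res_class \<in> iso (I_et \<iota>) (Cl_Q_tors I \<iota> \<xi>)"
proof (rule isoI)
  show "Res_class \<in> hom (I_et \<iota>) (Cl_Q_tors I \<iota> \<xi>)"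
  proof (rule homI)
    show "Res_class c \<in> carrier (Cl_Q_tors I \<iota> \<xi>)" if "c \<in> carrier (I_et \<iota>)" for c
      using Res_class_surj that by blast
    fix c d assume "c \<in> carrier (I_et \<iota>)" "d \<in> carrier (I_et \<iota>)"
    then obtain \<gamma> \<delta> where \<gamma>: "\<gamma> \<in> etale_forms" "c = form_class \<iota> \<gamma>" and \<delta>: "\<delta> \<in> etale_forms" "d = form_class \<iota> \<delta>"
      unfolding carrier_I_et by blast
    define \<epsilon> where "\<epsilon> = (\<lambda>\<theta>. \<gamma> \<theta> + \<delta> \<theta>)"
    have "c \<otimes>\<^bsub>I_et \<iota>\<^esub> d = form_class \<iota> \<epsilon>"
      using \<gamma> \<delta> form_class_mult by (simp add: \<epsilon>_def)
    moreover have "\<epsilon> \<in> etale_forms"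
      using \<gamma>(1) \<delta>(1) Res_add(1) by (auto simp: \<epsilon>_def closed_forms_def closed_form_add)
    ultimately have "Res_class (c \<otimes>\<^bsub>I_et \<iota>\<^esub> d) = divisor_class I \<iota> \<xi> (\<lambda>x. Res I \<iota> \<xi> \<gamma> x + Res I \<iota> \<xi> \<delta> x)"
      using Res_class_form_class[of \<epsilon>] Res_add(2)[of \<gamma> \<delta>] \<gamma>(1) \<delta>(1) by (simp add: \<epsilon>_def)
    also have "\<dots> = Res_class c \<otimes>\<^bsub>Cl_Q I \<iota> \<xi>\<^esub> Res_class d"
      using \<gamma> \<delta> Res_class_form_class Res_in_tors(1) by (simp add: divisor_class_mult)
    finally show "Res_class (c \<otimes>\<^bsub>I_et \<iota>\<^esub> d) = Res_class c \<otimes>\<^bsub>Cl_Q_tors I \<iota> \<xi>\<^esub> Res_class d"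
      by (simp add: Cl_Q_tors_def torsion_subgroup_def)
  qed
  show "bij_betw Res_class (carrier (I_et \<iota>)) (carrier (Cl_Q_tors I \<iota> \<xi>))"
    using Res_class_inj Res_class_surj by (simp add: bij_betw_def)
qed

end

theorem theorem5p26:
  fixes I :: "('i::finite, 'k::{alg_closed_field, field_char_0}) mpoly set"
    and \<iota> :: "'k \<Rightarrow> 'K::field_char_0"
    and \<xi> :: "'i \<Rightarrow> 'K"
  assumes "projective_variety I"
    and "function_field I \<iota> \<xi>"
    and "normal_variety I \<iota> \<xi>"
  shows "comm_group (I_et \<iota>) \<and> comm_group (Cl_Q_tors I \<iota> \<xi>) \<and>
    (\<exists>R \<in> iso (I_et \<iota>) (Cl_Q_tors I \<iota> \<xi>).
       (\<forall>\<gamma> \<in> carrier (closed_forms \<iota>). etale_trivial \<iota> \<gamma> \<longrightarrow>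
          R (form_class \<iota> \<gamma>) = divisor_class I \<iota> \<xi> (Res I \<iota> \<xi> \<gamma>)) \<and>
       (\<forall>D \<in> carrier (Div_Q I). divisor_class I \<iota> \<xi> D \<in> carrier (Cl_Q_tors I \<iota> \<xi>) \<longrightarrow>
          (\<exists>(r::rat) \<phi>. r \<noteq> 0 \<and> \<phi> \<noteq> 0 \<and> (\<lambda>x. of_rat r * D x) = div_of I \<iota> \<xi> \<phi>) \<and>
          (\<forall>(r::rat) \<phi>. r \<noteq> 0 \<and> \<phi> \<noteq> 0 \<and> (\<lambda>x. of_rat r * D x) = div_of I \<iota> \<xi> \<phi> \<longrightarrow>
             inv_into (carrier (I_et \<iota>)) R (divisor_class I \<iota> \<xi> D)
               = form_class \<iota> (\<lambda>\<theta>. of_rat (1 / r) * dlog_K \<iota> \<phi> \<theta>))))"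
proof -
  interpret residue_setting I \<iota> \<xi>
    using assms by unfold_locales
  have exists: "\<exists>(r::rat) \<phi>. r \<noteq> 0 \<and> \<phi> \<noteq> 0 \<and> (\<lambda>x. of_rat r * D x) = divisor \<phi>"
    if D: "D \<in> carrier (Div_Q I)" "divisor_class I \<iota> \<xi> D \<in> carrier (Cl_Q_tors I \<iota> \<xi>)" for D
  proof -
    obtain n \<phi> where "n > 0" "\<phi> \<noteq> 0" "(\<lambda>x. of_nat n * D x) = divisor \<phi>"
      using D divisor_class_tors_iff[OF D(1)] by blast
    then show ?thesis by (intro exI[of _ "of_nat n"] exI[of _ \<phi>]) simp
  qed
  \<comment> \<open>Every nonzero rational r is admissible, negative ones included: r D = (\<phi>)
    alone already gives Res ((1/r) dlog \<phi>) = D, so all pairs r, \<phi> lead to the same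
    class.\<close>
  have inverse: "inv_into (carrier (I_et \<iota>)) Res_class (divisor_class I \<iota> \<xi> D) = form_class \<iota> (rat_dlog (1 / r) \<phi>)"
    if "r \<noteq> 0" "\<phi> \<noteq> 0" "(\<lambda>x. of_rat r * D x) = divisor \<phi>" for D r \<phi>
  proof -
    have \<gamma>: "rat_dlog (1 / r) \<phi> \<in> etale_forms" using rat_dlog_etale_trivial[OF that(2)] by simp
    have "Res I \<iota> \<xi> (rat_dlog (1 / r) \<phi>) = D"
      unfolding Res_rat_dlog[OF that(2)] that(3)[symmetric] using that(1) by (auto simp: of_rat_divide)
    then have "Res_class (form_class \<iota> (rat_dlog (1 / r) \<phi>)) = divisor_class I \<iota> \<xi> D"
      using Res_class_form_class[OF \<gamma>] by simp
    then show ?thesis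
      using inv_into_f_f[OF Res_class_inj, of "form_class \<iota> (rat_dlog (1 / r) \<phi>)"] \<gamma>
      unfolding carrier_I_et by auto
  qed
  have "comm_group (Cl_Q_tors I \<iota> \<xi>)"
    unfolding Cl_Q_tors_def by (rule torsion_subgroup_comm_group[OF Cl_Q_comm_group])
  with I_et_comm_group show ?thesis
    using Res_class_iso Res_class_form_class exists inverse[unfolded rat_dlog_def]
    by (intro conjI bexI[of _ Res_class]) blast+
qed

end
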